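(* Let $d,m\ge1$ be integers and $n=d+m$. The set of $d$-dimensional non-extremal affine subspaces of $\mathbb{R}^n$ has Hausdorff dimension $(d+1)m-d$.
   Context: The space of all $d$-dimensional affine subspaces of $\mathbb{R}^n$ is identified, through homogenization, with (an open subset of) the Grassmannian $\mathbf{Gr}(d+1,n+1)$ of $(d+1)$-dimensional linear subspaces of $\mathbb{R}^{n+1}$, a manifold of dimension $(d+1)m$. Local coordinates are given, up to a permutation of the coordinates of $\mathbb{R}^n$, by matrices $A\in\mathbb{R}^{(d+1)\times m}$ through $\mathcal{L}_A=\{(\bm{x},(1,\bm{x})A)\mid\bm{x}\in\mathbb{R}^d\}$. Hausdorff dimension is taken in this manifold. For $\bm{y}\in\mathbb{R}^n$, $\|\bm{y}\|$ is the sup-norm distance to the nearest integer vector. For $\tau\in\mathbb{R}$ let $\mathcal{S}_n(\tau)=\{\bm{y}\in\mathbb{R}^n: \|q\bm{y}\|<q^{-\tau}\text{ for infinitely many }q\in\mathbb{N}\}$. A submanifold $\mathcal{M}\subseteq\mathbb{R}^n$ is extremal if $|\mathcal{S}_n(\tau)\cap\mathcal{M}|_{\mathcal{M}}=0$ for every $\tau>1/n$, where $|\cdot|_{\mathcal{M}}$ is the induced Lebesgue measure on $\mathcal{M}$. *)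

theory Defs
  imports "HOL-Analysis.Analysis"
begin

section \<open>Simultaneous approximation\<close>

definition dist_to_int :: "real ^ 'n \<Rightarrow> real" where
  "dist_to_int y = (INF p\<in>{p. \<forall>i. p $ i \<in> \<int>}. infnorm (y - p))"

definition approximable_set :: "real \<Rightarrow> (real ^ 'n) set" where
  "approximable_set \<tau> = {y. infinite {q::nat. dist_to_int (real q *\<^sub>R y) < real q powr (- \<tau>)}}"

lemma approximable_set_borel: "(approximable_set \<tau> :: (real ^ 'n) set) \<in> sets borel"
proof -
  have lt: "dist_to_int z < c \<longleftrightarrow> (\<exists>p. (\<forall>i. p $ i \<in> \<int>) \<and> infnorm (z - p) < c)"
    for z :: "real ^ 'n" and c
    unfolding dist_to_int_def
    by (subst cINF_less_iff) (auto intro!: bdd_belowI2[of _ 0] infnorm_pos_le exI[of _ 0])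
  have "open {y :: real ^ 'n. dist_to_int (real q *\<^sub>R y) < c}" for q c
  proof -
    have "{y :: real ^ 'n. dist_to_int (real q *\<^sub>R y) < c}
        = (\<Union>p\<in>{p. \<forall>i. p $ i \<in> \<int>}. {y. infnorm (real q *\<^sub>R y - p) < c})"
      unfolding lt by blast
    also have "open \<dots>"
      by (intro open_UN ballI open_Collect_less continuous_on_infnorm continuous_intros)
    finally show ?thesis .
  qed
  then have "{y :: real ^ 'n. dist_to_int (real q *\<^sub>R y) < c} \<in> sets borel" for q c
    by (rule borel_open)
  moreover have "approximable_set \<tau>
      = (\<Inter>N. \<Union>q\<in>{N<..}. {y :: real ^ 'n. dist_to_int (real q *\<^sub>R y) < real q powr (- \<tau>)})"
    unfolding approximable_set_def infinite_nat_iff_unbounded by auto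
  ultimately show ?thesis
    by auto
qed


section \<open>Lebesgue measure on an affine subspace, and extremality\<close>

definition orthonormal :: "'a::euclidean_space set \<Rightarrow> bool" where
  "orthonormal B \<longleftrightarrow> pairwise orthogonal B \<and> (\<forall>b\<in>B. norm b = 1)"

text \<open>
  The push-forward of Lebesgue measure on \<open>\<real>\<^sup>B\<close> under the isometric parametrisation of \<open>L\<close>
  given by a base point of \<open>L\<close> and an orthonormal basis \<open>B\<close> of its direction space. It does not
  depend on the choice of either. It is a Borel measure on the whole ambient space, concentrated
  on \<open>L\<close>.
\<close>

definition affine_lborel :: "'a::euclidean_space set \<Rightarrow> 'a measure" where
  "affine_lborel L =
    (let a = (SOME a. a \<in> L);
         B = (SOME B. orthonormal B \<and> span B = {x - y | x y. x \<in> L \<and> y \<in> L})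
     in distr (\<Pi>\<^sub>M b\<in>B. (lborel :: real measure)) borel (\<lambda>f. a + (\<Sum>b\<in>B. f b *\<^sub>R b)))"

definition extremal :: "(real ^ 'n) set \<Rightarrow> bool" where
  "extremal L \<longleftrightarrow>
    (\<forall>\<tau> > 1 / real CARD('n). emeasure (affine_lborel L) (approximable_set \<tau> \<inter> L) = 0)"

lemma direction_orthonormal_basis_exists:
  fixes L :: "'a::euclidean_space set"
  assumes "affine L" "L \<noteq> {}"
  shows "\<exists>B. orthonormal B \<and> span B = {x - y | x y. x \<in> L \<and> y \<in> L}"
proof -
  obtain a where a: "a \<in> L"
    using assms by blast
  have sub: "subspace ((\<lambda>x. x - a) ` L)"
    using affine_diffs_subspace_subtract[OF assms(1) a] .
  have "{x - y | x y. x \<in> L \<and> y \<in> L} = (\<lambda>x. x - a) ` L" (is "?V = _")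
  proof (intro equalityI subsetI)
    fix z assume "z \<in> ?V"
    then obtain x y where "x \<in> L" "y \<in> L" "z = (x - a) - (y - a)"
      by auto
    then show "z \<in> (\<lambda>x. x - a) ` L"
      using subspace_diff[OF sub] by blast
  qed (use a in blast)
  then have "subspace ?V"
    using sub by simp
  then show ?thesis
    unfolding orthonormal_def by (rule orthonormal_basis_subspace) (intro exI conjI ballI)
qed

lemma affine_parametrisation_measurable:
  fixes B :: "'a::euclidean_space set"
  shows "(\<lambda>f. a + (\<Sum>b\<in>B. f b *\<^sub>R b)) \<in> (\<Pi>\<^sub>M b\<in>B. (lborel :: real measure)) \<rightarrow>\<^sub>M borel"
  by measurable


section \<open>Hausdorff dimension\<close>

definition hausdorff_premeasure :: "real \<Rightarrow> real \<Rightarrow> 'a::metric_space set \<Rightarrow> ennreal" where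
  "hausdorff_premeasure s \<delta> E =
    (INF U\<in>{U :: nat \<Rightarrow> 'a set. E \<subseteq> (\<Union>i. U i) \<and> (\<forall>i. bounded (U i) \<and> diameter (U i) \<le> \<delta>)}.
       (\<Sum>i. ennreal (diameter (U i) powr s)))"

definition hausdorff_measure :: "real \<Rightarrow> 'a::metric_space set \<Rightarrow> ennreal" where
  "hausdorff_measure s E = (SUP \<delta>\<in>{0<..}. hausdorff_premeasure s \<delta> E)"

text \<open>
  Only exponents \<open>s > 0\<close> are used, because \<open>0 powr 0 = 0\<close> makes the case \<open>s = 0\<close> differ from
  counting measure; the infimum is not affected.
\<close>

definition hausdorff_dim :: "'a::metric_space set \<Rightarrow> ereal" where
  "hausdorff_dim E = Inf {ereal s | s. 0 < s \<and> hausdorff_measure s E = 0}"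


section \<open>The space of affine subspaces\<close>

definition homogenization :: "'a::real_vector set \<Rightarrow> (real \<times> 'a) set" where
  "homogenization L = span ((\<lambda>x. (1, x)) ` L)"

text \<open>
  A linear subspace is represented by its orthogonal projection, so that the Grassmannian becomes
  a compact submanifold of the space of linear operators. The operator norm metric is locally
  bi-Lipschitz to every Riemannian metric on the Grassmannian, so Hausdorff dimension may be
  computed in it.
\<close>

definition orthogonal_projection :: "'a::euclidean_space set \<Rightarrow> 'a \<Rightarrow>\<^sub>L 'a" where
  "orthogonal_projection V = Blinfun (closest_point V)"

definition grassmann_point :: "'a::euclidean_space set \<Rightarrow> (real \<times> 'a) \<Rightarrow>\<^sub>L (real \<times> 'a)" where
  "grassmann_point L = orthogonal_projection (homogenization L)"

definition affine_subspaces :: "nat \<Rightarrow> 'a::euclidean_space set set" where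
  "affine_subspaces d = {L. affine L \<and> aff_dim L = int d}"

lemma bounded_linear_closest_point:
  fixes V :: "'a::euclidean_space set"
  assumes "subspace V"
  shows "bounded_linear (closest_point V)"
proof -
  have V: "convex V" "closed V" "V \<noteq> {}"
    using assms subspace_0[OF assms] by (auto simp: subspace_imp_convex closed_subspace)
  have span: "span V = V"
    using assms by (simp add: span_eq_iff)
  have eq: "closest_point V x = y" if "y \<in> V" "\<And>w. w \<in> V \<Longrightarrow> orthogonal (x - y) w" for x y
  proof (rule closest_point_unique[OF V(1,2) that(1), symmetric], intro ballI)
    fix w assume w: "w \<in> V"
    then have "orthogonal (x - y) (y - w)"
      using that assms by (simp add: subspace_diff)
    then have "(norm (x - w))\<^sup>2 = (norm (x - y))\<^sup>2 + (norm (y - w))\<^sup>2"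
      using norm_add_Pythagorean[of "x - y" "y - w"] by simp
    then show "dist x y \<le> dist x w"
      by (metis dist_norm le_add_same_cancel1 norm_ge_zero power2_le_imp_le zero_le_power2)
  qed
  have orth: "closest_point V x \<in> V \<and> (\<forall>w\<in>V. orthogonal (x - closest_point V x) w)" for x
  proof -
    obtain y z where yz: "y \<in> V" "\<And>w. w \<in> V \<Longrightarrow> orthogonal z w" "x = y + z"
      using orthogonal_subspace_decomp_exists[of V x] unfolding span by blast
    then have "closest_point V x = y"
      by (intro eq) auto
    then show ?thesis
      using yz by auto
  qed
  have "linear (closest_point V)"
  proof (rule linearI)
    fix x y
    show "closest_point V (x + y) = closest_point V x + closest_point V y"
      using orth[of x] orth[of y] assms
      by (intro eq) (auto simp: subspace_add orthogonal_def inner_diff_left inner_add_left)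
  next
    fix c x
    show "closest_point V (c *\<^sub>R x) = c *\<^sub>R closest_point V x"
      using orth[of x] assms
      by (intro eq) (auto simp: subspace_scale orthogonal_def inner_diff_left)
  qed
  then show ?thesis
    by (simp add: linear_conv_bounded_linear)
qed

lemma orthogonal_projection_apply:
  "subspace V \<Longrightarrow> blinfun_apply (orthogonal_projection V) x = closest_point V x"
  by (simp add: orthogonal_projection_def bounded_linear_Blinfun_apply
      bounded_linear_closest_point)

lemma mem_homogenization_iff:
  fixes L :: "'a::real_vector set"
  assumes "affine L"
  shows "(1, x) \<in> homogenization L \<longleftrightarrow> x \<in> L"
proof
  assume "(1, x) \<in> homogenization L"
  then obtain T :: "(real \<times> 'a) set" and r
    where T: "finite T" "T \<subseteq> (\<lambda>x. (1, x)) ` L" "(1, x) = (\<Sum>v\<in>T. r v *\<^sub>R v)"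
    unfolding homogenization_def span_explicit by blast
  have snd_in: "snd v \<in> L" and fst_1: "fst v = (1::real)" if "v \<in> T" for v
    using T(2) that by auto
  have 1: "(\<Sum>v\<in>T. r v) = 1"
    using arg_cong[OF T(3), of fst] fst_1 by (simp add: fst_sum)
  have x: "x = (\<Sum>v\<in>T. r v *\<^sub>R snd v)"
    using arg_cong[OF T(3), of snd] by (simp add: snd_sum)
  have "T \<noteq> {}"
    using 1 by auto
  have inj: "inj_on snd T"
    using fst_1 by (intro inj_onI) (simp add: prod_eq_iff)
  have r: "r (1, snd v) = r v" if "v \<in> T" for v
    using fst_1[OF that] by (metis prod.collapse)
  have "(\<Sum>y\<in>snd ` T. r (1, y) *\<^sub>R y) \<in> L"
    using assms[unfolded affine, rule_format, of "snd ` T" "\<lambda>y. r (1, y)"] T(1) \<open>T \<noteq> {}\<close> 1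
    by (simp add: sum.reindex[OF inj] r image_subset_iff snd_in)
  then show "x \<in> L"
    by (simp add: x sum.reindex[OF inj] r)
qed (simp add: homogenization_def span_base)

lemma inj_on_grassmann_point: "inj_on grassmann_point (affine_subspaces d)"
proof (rule inj_onI)
  fix L M :: "'a set"
  assume L: "L \<in> affine_subspaces d" and M: "M \<in> affine_subspaces d"
    and eq: "grassmann_point L = grassmann_point M"
  have sub: "subspace (homogenization N)" for N :: "'a set"
    by (simp add: homogenization_def)
  have fixed_iff: "z \<in> homogenization N \<longleftrightarrow> blinfun_apply (grassmann_point N) z = z"
    for z and N :: "'a set"
  proof -
    have "closest_point (homogenization N) z \<in> homogenization N"
      using closest_point_in_set[OF closed_subspace[OF sub]] subspace_0[OF sub, of N] by fastforce
    then show ?thesis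
      unfolding grassmann_point_def orthogonal_projection_apply[OF sub]
      by (metis closest_point_self)
  qed
  have hom: "homogenization L = homogenization M"
    by (intro set_eqI) (simp only: fixed_iff eq)
  have "affine L" "affine M"
    using L M by (simp_all add: affine_subspaces_def)
  then show "L = M"
    by (intro set_eqI) (simp only: mem_homogenization_iff[symmetric] hom)
qed

end

theory Submission
  imports Defs "HOL-Real_Asymp.Real_Asymp"
begin

text \<open>
  In a chart a subspace is given by a matrix \<open>A\<close> with \<open>d + 1\<close> rows and \<open>m\<close> columns. Write
  \<open>\<parallel>A b\<parallel>\<close> for the largest distance of a coordinate of \<open>A b\<close> to the integers, where \<open>b\<close> is an
  integer vector of height \<open>N = max \<bar>b j\<bar>\<close>, and \<open>n = d + m\<close>.

  If \<open>\<parallel>A b\<parallel> < N powr - \<omega>\<close> only finitely often for some \<open>\<omega> < n\<close>, the subspace is extremal: rational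
  points of denominator \<open>q\<close> near it correspond to integer vectors \<open>v\<close> with \<open>v A\<close> almost integral,
  a large sieve argument shows that there are not more of them than expected, and the Borel--Cantelli
  lemma applies. Covering the remaining matrices by boxes around the planes \<open>A b = p\<close> gives the upper
  bound for the dimension.

  If \<open>\<parallel>A b\<parallel> < N powr - \<omega>\<close> infinitely often for some \<open>\<omega> > n\<close>, the subspace lies close to rational
  hyperplanes of height \<open>N\<close>, in which Dirichlet's theorem approximates every point better than in
  \<open>\<real>\<^sup>n\<close>, so the subspace is not extremal. For almost every choice of the first \<open>m - 1\<close> columns, the
  points \<open>(p - A' b') / q\<close> are well distributed, and a nested choice of boxes around them shows that the
  set of last columns with this property has positive \<open>t\<close>-dimensional Hausdorff content for every
  \<open>t < 1\<close> when \<open>\<omega>\<close> is close enough to \<open>n\<close>. Integrating over the first \<open>m - 1\<close> columns gives dimension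
  at least \<open>(d + 1) * (m - 1) + t\<close>.
\<close>

section \<open>Systems of linear forms close to integers\<close>

text \<open>The threshold \<open>\<omega> = n\<close> is a dimension count. At height
  \<open>N\<close> there are about \<open>N ^ n\<close> planes \<open>A b = p\<close>, of
  codimension \<open>d + 1\<close> in the space of matrices, and the condition puts \<open>A\<close>
  within about \<open>N powr - (\<omega> + 1)\<close> of one of them. Summed over \<open>N\<close>,
  the \<open>s\<close>-weights of the covers converge when
  \<open>(\<omega> + 1) * (s - (d + 1) * (m - 1)) > n + 1\<close>, which for
  \<open>\<omega> = n\<close> is \<open>s > (d + 1) * m - d\<close>. The value
  \<open>\<omega> = n\<close> itself is never decided: each bound for the dimension leaves room to
  move \<open>\<omega>\<close> to the convenient side.

  For the lower bound the planes, of dimension \<open>(d + 1) * (m - 1)\<close>, are sliced by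
  fixing all columns but one, which leaves points. Dirichlet's theorem may however give a solution
  in which the last column has coefficient \<open>0\<close>. This is excluded by taking fixed
  columns that are not well approximable for some \<open>\<mu>\<close> below the Dirichlet exponent
  of all columns together; as \<open>\<mu>\<close> can still exceed the exponent of the fixed
  columns alone, almost every choice of them is allowed.\<close>

definition lin_forms :: "'j set \<Rightarrow> ('i \<Rightarrow> 'j \<Rightarrow> real) \<Rightarrow> ('j \<Rightarrow> int) \<Rightarrow> 'i \<Rightarrow> real" where
  "lin_forms J A b i = (\<Sum>j\<in>J. A i j * real_of_int (b j))"

definition near_int :: "real \<Rightarrow> real \<Rightarrow> bool" where
  "near_int \<delta> x \<longleftrightarrow> (\<exists>p::int. \<bar>x - real_of_int p\<bar> < \<delta>)"

text \<open>The second condition fails for empty \<open>J\<close>, so a matrix without columns is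
  never well approximable. With \<open>m = 1\<close> this is the matrix that remains after one
  column has been removed, and the argument for the lower bound needs no separate case for
  it.\<close>

definition has_height :: "'j set \<Rightarrow> ('j \<Rightarrow> int) \<Rightarrow> nat \<Rightarrow> bool" where
  "has_height J b N \<longleftrightarrow> (\<forall>j\<in>J. \<bar>b j\<bar> \<le> int N) \<and> (\<exists>j\<in>J. \<bar>b j\<bar> = int N)"

text \<open>The index sets are arguments because the same notion is applied to the full matrix of a
  chart and to the matrix with one column removed.\<close>

definition well_approx ::
  "'i set \<Rightarrow> 'j set \<Rightarrow> ('i \<Rightarrow> 'j \<Rightarrow> real) \<Rightarrow> real \<Rightarrow> nat \<Rightarrow> bool" where
  "well_approx I J A \<omega> N \<longleftrightarrow>
    (\<exists>b. has_height J b N \<and> (\<forall>i\<in>I. near_int (real N powr - \<omega>) (lin_forms J A b i)))"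

lemma near_int_uminus: "near_int \<delta> (- x) \<longleftrightarrow> near_int \<delta> x"
proof -
  have "near_int \<delta> (- x)" if "near_int \<delta> x" for x
  proof -
    obtain p :: int where "\<bar>x - p\<bar> < \<delta>" using \<open>near_int \<delta> x\<close> by (auto simp: near_int_def)
    then have "\<bar>- x - of_int (- p)\<bar> < \<delta>" by simp
    then show ?thesis unfolding near_int_def by blast
  qed
  from this[of x] this[of "- x"] show ?thesis by auto
qed

lemma near_int_mono: "near_int \<delta> x \<Longrightarrow> \<delta> \<le> \<epsilon> \<Longrightarrow> near_int \<epsilon> x"
  unfolding near_int_def by (meson less_le_trans)

lemma has_height_exists:
  assumes "finite J" "j \<in> J" "b j \<noteq> 0"
  shows "\<exists>N\<ge>1. has_height J b N"
proof -
  let ?M = "Max ((\<lambda>j. nat \<bar>b j\<bar>) ` J)"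
  have fin: "finite ((\<lambda>j. nat \<bar>b j\<bar>) ` J)" "(\<lambda>j. nat \<bar>b j\<bar>) ` J \<noteq> {}"
    using assms by auto
  have le: "nat \<bar>b j\<bar> \<le> ?M" if "j \<in> J" for j
    using fin that by (intro Max_ge) auto
  obtain j' where "j' \<in> J" "?M = nat \<bar>b j'\<bar>"
    using Max_in[OF fin] by auto
  then have "has_height J b ?M"
    unfolding has_height_def using le by (auto intro!: bexI[of _ j'] simp: nat_le_iff)
  moreover have "?M \<ge> 1"
    using le[OF assms(2)] assms(3) by linarith
  ultimately show ?thesis by blast
qed

lemma has_height_le:
  assumes "finite J" "j \<in> J" "b j \<noteq> 0" "\<And>j. j \<in> J \<Longrightarrow> \<bar>b j\<bar> \<le> int H"
  obtains N where "1 \<le> N" "N \<le> H" "has_height J b N"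
proof -
  obtain N where N: "N \<ge> 1" "has_height J b N"
    using has_height_exists assms by metis
  then obtain j' where "j' \<in> J" "\<bar>b j'\<bar> = int N"
    by (auto simp: has_height_def)
  then have "N \<le> H" using assms(4)[of j'] by simp
  then show ?thesis using that N by blast
qed

lemma lin_forms_scale: "lin_forms J A (\<lambda>j. c * b j) i = of_int c * lin_forms J A b i"
  by (simp add: lin_forms_def sum_distrib_left algebra_simps)

text \<open>Multiplying \<open>b\<close> by \<open>K\<close> multiplies its height by
  \<open>K\<close> and the errors by \<open>K\<close>, so an exceptional vector of small height
  would give one beyond the last exceptional height. Finitely many exceptions therefore cost only a
  constant, and every height \<open>N \<ge> 1\<close> is controlled.\<close>

lemma not_near_int_if_finite_well_approx:
  assumes "0 < \<omega>" and fin: "\<not> (\<exists>\<^sub>\<infinity>N. well_approx I J A \<omega> N)"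
  shows "\<exists>c>0. \<forall>N\<ge>1. \<forall>b. has_height J b N \<longrightarrow>
    (\<exists>i\<in>I. \<not> near_int (c * real N powr - \<omega>) (lin_forms J A b i))"
proof -
  obtain K0 where K0: "\<And>N. N > K0 \<Longrightarrow> \<not> well_approx I J A \<omega> N"
    using fin unfolding INFM_nat by auto
  define K where "K = Suc K0"
  have K1: "K > 0" by (simp add: K_def)
  \<comment> \<open>Chosen so that
    \<open>K * (c * N powr - \<omega>) = (K * N) powr - \<omega>\<close>.\<close>
  define c where "c = real K powr - \<omega> / real K"
  have "c > 0" by (simp add: c_def K_def)
  moreover have "\<exists>i\<in>I. \<not> near_int (c * real N powr - \<omega>) (lin_forms J A b i)"
    if N: "N \<ge> 1" and b: "has_height J b N" for N b
  proof (rule ccontr)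
    assume "\<not> ?thesis"
    then have near: "near_int (c * real N powr - \<omega>) (lin_forms J A b i)" if "i \<in> I" for i
      using that by blast
    have "has_height J (\<lambda>j. int K * b j) (K * N)"
      using b by (auto simp: has_height_def abs_mult mult_left_mono)
    moreover have "near_int (real (K * N) powr - \<omega>) (lin_forms J A (\<lambda>j. int K * b j) i)"
      if i: "i \<in> I" for i
    proof -
      obtain p :: int where p: "\<bar>lin_forms J A b i - p\<bar> < c * real N powr - \<omega>"
        using near[OF i] by (auto simp: near_int_def)
      have "\<bar>lin_forms J A (\<lambda>j. int K * b j) i - of_int (int K * p)\<bar>
          = real K * \<bar>lin_forms J A b i - p\<bar>"
        unfolding lin_forms_scale by (simp add: abs_mult flip: right_diff_distrib)
      also have "\<dots> < real K * (c * real N powr - \<omega>)"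
        using p by (intro mult_strict_left_mono) (auto simp: K_def)
      also have "\<dots> = real (K * N) powr - \<omega>"
        using K1 by (simp add: c_def powr_mult)
      finally show ?thesis unfolding near_int_def by blast
    qed
    ultimately have "well_approx I J A \<omega> (K * N)"
      unfolding well_approx_def by blast
    moreover have "K * N > K0"
      using N mult_le_mono2[of 1 N K] by (simp add: K_def)
    ultimately show False using K0 by blast
  qed
  ultimately show ?thesis by blast
qed

section \<open>Covering the well approximable matrices of a given height by boxes\<close>

lemma abs_entry_le_sum:
  fixes A :: "'i \<Rightarrow> 'j \<Rightarrow> real"
  assumes "finite I" "finite J" "i \<in> I" "j \<in> J"
  shows "\<bar>A i j\<bar> \<le> (\<Sum>i\<in>I. \<Sum>j\<in>J. \<bar>A i j\<bar>)"
proof -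
  have "\<bar>A i j\<bar> \<le> (\<Sum>j\<in>J. \<bar>A i j\<bar>)" using assms by (intro member_le_sum) auto
  also have "\<dots> \<le> (\<Sum>i\<in>I. \<Sum>j\<in>J. \<bar>A i j\<bar>)"
    using assms by (intro member_le_sum[of i I "\<lambda>i. \<Sum>j\<in>J. \<bar>A i j\<bar>"]) (auto intro: sum_nonneg)
  finally show ?thesis .
qed

text \<open>It suffices to code the matrices by finitely many integers: one matrix per code serves
  as a centre, so no centre has to be constructed from a code.\<close>

lemma finite_index_representatives:
  assumes "finite T" "\<And>A. A \<in> S \<Longrightarrow> f A \<in> T"
    and "\<And>A B. A \<in> S \<Longrightarrow> B \<in> S \<Longrightarrow> f A = f B \<Longrightarrow> R A B"
  shows "\<exists>X. finite X \<and> card X \<le> card T \<and> (\<forall>A\<in>S. \<exists>B\<in>X. R A B)"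
proof -
  define r where "r t = (SOME A. A \<in> S \<and> f A = t)" for t
  have r: "r (f A) \<in> S \<and> f (r (f A)) = f A" if "A \<in> S" for A
    unfolding r_def by (rule someI[of _ A]) (use that in auto)
  have sub: "f ` S \<subseteq> T" using assms(2) by auto
  then have fin: "finite (f ` S)" using assms(1) finite_subset by blast
  have "card (r ` f ` S) \<le> card (f ` S)" using fin by (rule card_image_le)
  also have "\<dots> \<le> card T" using assms(1) sub by (rule card_mono)
  finally have "card (r ` f ` S) \<le> card T" .
  moreover have "\<forall>A\<in>S. \<exists>B\<in>r ` f ` S. R A B"
    using r assms(3) by (metis imageI)
  ultimately show ?thesis using fin by blast
qed

lemma card_int_symmetric: "card {- int n..int n} = 2 * n + 1"
  by (simp add: nat_add_distrib nat_mult_distrib)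

text \<open>A matrix is coded by the position \<open>j0\<close> of a largest coefficient, by
  \<open>b\<close>, by the nearby integers \<open>p\<close>, and by the grid cells \<open>g\<close>
  of mesh \<open>N powr - (\<omega> + 1)\<close> of all columns except \<open>j0\<close>. The column
  \<open>j0\<close> is then known up to a multiple of the mesh, because its coefficient in the forms
  has absolute value \<open>N\<close>. The exponent counts \<open>N ^ (m - 1)\<close> vectors
  \<open>b\<close>, \<open>N ^ a\<close> vectors \<open>p\<close>, and the cells, where
  \<open>m = card J\<close> and \<open>a = card I\<close>.\<close>

lemma well_approx_cover:
  fixes R \<omega> :: real
  assumes I: "finite I" and J: "finite J" and \<omega>: "0 < \<omega>" and R: "0 \<le> R"
  shows "\<exists>C>0. \<forall>N\<ge>1. \<exists>X :: ('i \<Rightarrow> 'j \<Rightarrow> real) set. finite X \<and>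
    real (card X) \<le> C * real N powr
      (real (card J) - 1 + real (card I) + (\<omega> + 1) * (real (card I) * (real (card J) - 1))) \<and>
    (\<forall>A. (\<forall>i\<in>I. \<forall>j\<in>J. \<bar>A i j\<bar> \<le> R) \<and> well_approx I J A \<omega> N \<longrightarrow>
      (\<exists>Y\<in>X. \<forall>i\<in>I. \<forall>j\<in>J. \<bar>A i j - Y i j\<bar> \<le> real (card J + 1) * real N powr - (\<omega> + 1)))"
proof (cases "J = {}")
  case True
  then have "\<not> well_approx I J A \<omega> N" for A N
    by (simp add: well_approx_def has_height_def)
  then show ?thesis by (intro exI[of _ 1]) (auto intro: exI[of _ "{}"])
next
  case False
  define m where "m = card J"
  define a where "a = card I"
  have m: "m \<ge> 1" using False J by (simp add: m_def Suc_leI card_gt_0_iff)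
  \<comment> \<open>\<open>c1 * N\<close> bounds the entries of \<open>p\<close>: the linear forms
    are at most \<open>m * R * N\<close> and lie within \<open>1\<close> of them.\<close>
  define c1 where "c1 = nat \<lceil>real m * R + 1\<rceil>"
  define C where "C = real m * (2 * 3 ^ (m - 1)) * real (2 * c1 + 1) ^ a * (2 * R + 3) ^ (a * (m - 1))"
  have "C > 0" unfolding C_def using m R by auto
  moreover have "\<exists>X. finite X \<and>
    real (card X) \<le> C * real N powr (real m - 1 + real a + (\<omega> + 1) * (real a * (real m - 1))) \<and>
    (\<forall>A. (\<forall>i\<in>I. \<forall>j\<in>J. \<bar>A i j\<bar> \<le> R) \<and> well_approx I J A \<omega> N \<longrightarrow>
      (\<exists>Y\<in>X. \<forall>i\<in>I. \<forall>j\<in>J. \<bar>A i j - Y i j\<bar> \<le> real (m + 1) * real N powr - (\<omega> + 1)))"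
    if N: "N \<ge> 1" for N
  proof -
    define \<rho> where "\<rho> = real N powr - (\<omega> + 1)"
    have \<rho>: "\<rho> > 0" using N by (simp add: \<rho>_def)
    have N\<rho>: "real N * \<rho> = real N powr - \<omega>"
      unfolding \<rho>_def using N powr_add[of "real N" 1 "- (\<omega> + 1)"] by simp
    have inv\<rho>: "1 / \<rho> = real N powr (\<omega> + 1)"
      unfolding \<rho>_def using N by (metis divide_inverse mult_1 powr_minus inverse_inverse_eq)
    have inv\<rho>_ge: "1 / \<rho> \<ge> 1"
      unfolding inv\<rho> using N \<omega> by (intro ge_one_powr_ge_zero) auto
    define G where "G = nat \<lfloor>(R + 1) / \<rho>\<rfloor>"
    define P where "P = c1 * N"
    define S where "S = {A. (\<forall>i\<in>I. \<forall>j\<in>J. \<bar>A i j\<bar> \<le> R) \<and> well_approx I J A \<omega> N}"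
    define T :: "('j \<times> ('j \<Rightarrow> int) \<times> ('i \<Rightarrow> int) \<times> ('i \<times> 'j \<Rightarrow> int)) set" where
      "T = (SIGMA j0:J. (\<Pi>\<^sub>E j\<in>J. if j = j0 then {- int N, int N} else {- int N..int N}) \<times>
             (\<Pi>\<^sub>E i\<in>I. {- int P..int P}) \<times> (\<Pi>\<^sub>E ij\<in>I \<times> (J - {j0}). {- int G..int G}))"
    have finT: "finite T"
      unfolding T_def using I J by (auto intro!: finite_PiE finite_SigmaI)
    have cardT: "card T = m * (2 * (2 * N + 1) ^ (m - 1) * ((2 * P + 1) ^ a * (2 * G + 1) ^ (a * (m - 1))))"
    proof -
      have "card (\<Pi>\<^sub>E j\<in>J. if j = j0 then {- int N, int N} else {- int N..int N})
          = 2 * (2 * N + 1) ^ (m - 1)" if j0: "j0 \<in> J" for j0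
      proof -
        have "card (\<Pi>\<^sub>E j\<in>J. if j = j0 then {- int N, int N} else {- int N..int N})
           = (\<Prod>j\<in>J. if j = j0 then 2 else 2 * N + 1)"
          using J N by (subst card_PiE) (auto intro!: prod.cong)
        also have "\<dots> = 2 * (\<Prod>j\<in>J - {j0}. 2 * N + 1)"
          by (subst prod.remove[OF J j0]) (auto intro!: arg_cong2[where f = "(*)"] prod.cong)
        finally show ?thesis using J j0 by (simp add: m_def)
      qed
      moreover have "card (\<Pi>\<^sub>E i\<in>I. {- int P..int P}) = (2 * P + 1) ^ a"
        using I by (subst card_PiE) (simp_all only: card_int_symmetric prod_constant a_def)
      moreover have "card (\<Pi>\<^sub>E ij\<in>I \<times> (J - {j0}). {- int G..int G}) = (2 * G + 1) ^ (a * (m - 1))"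
        if "j0 \<in> J" for j0
        using I J that
        by (subst card_PiE) (simp_all add: card_int_symmetric a_def m_def card_cartesian_product del: card_atLeastAtMost_int)
      ultimately show ?thesis
        unfolding T_def using I J
        by (subst card_SigmaI) (auto intro!: finite_PiE finite_cartesian_product simp: card_cartesian_product m_def)
    qed
    have "\<forall>A\<in>S. \<exists>t. case t of (j0, b, p, g) \<Rightarrow> t \<in> T \<and> j0 \<in> J \<and> \<bar>b j0\<bar> = int N \<and>
        (\<forall>j\<in>J. \<bar>b j\<bar> \<le> int N) \<and>
        (\<forall>i\<in>I. \<bar>lin_forms J A b i - of_int (p i)\<bar> < real N powr - \<omega>) \<and>
        (\<forall>i\<in>I. \<forall>j\<in>J - {j0}. g (i, j) = \<lfloor>A i j / \<rho>\<rfloor>)"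
    proof
      fix A assume A: "A \<in> S"
      then obtain b where b: "has_height J b N"
        and near: "\<forall>i\<in>I. near_int (real N powr - \<omega>) (lin_forms J A b i)"
        by (auto simp: S_def well_approx_def)
      from near obtain p where p: "\<forall>i\<in>I. \<bar>lin_forms J A b i - of_int (p i)\<bar> < real N powr - \<omega>"
        unfolding near_int_def by metis
      obtain j0 where j0: "j0 \<in> J" "\<bar>b j0\<bar> = int N" and ble: "\<forall>j\<in>J. \<bar>b j\<bar> \<le> int N"
        using b by (auto simp: has_height_def)
      define b' where "b' = restrict b J"
      define p' where "p' = restrict p I"
      define g where "g = (\<lambda>(i, j)\<in>I \<times> (J - {j0}). \<lfloor>A i j / \<rho>\<rfloor>)"
      have lf: "lin_forms J A b' i = lin_forms J A b i" for i
        by (simp add: lin_forms_def b'_def)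
      have b': "b' \<in> (\<Pi>\<^sub>E j\<in>J. if j = j0 then {- int N, int N} else {- int N..int N})"
        using ble j0 by (fastforce simp: b'_def)
      have "\<bar>p i\<bar> \<le> int P" if i: "i \<in> I" for i
      proof -
        have "\<bar>lin_forms J A b i\<bar> \<le> (\<Sum>j\<in>J. R * real N)"
          unfolding lin_forms_def
        proof (rule order_trans[OF sum_abs], rule sum_mono)
          fix j assume j: "j \<in> J"
          have "\<bar>real_of_int (b j)\<bar> \<le> real N" using ble j by (metis of_int_abs of_int_le_iff of_int_of_nat_eq)
          moreover have "\<bar>A i j\<bar> \<le> R" using A i j by (auto simp: S_def)
          ultimately show "\<bar>A i j * real_of_int (b j)\<bar> \<le> R * real N"
            unfolding abs_mult by (intro mult_mono) (use R in auto)
        qed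
        then have 1: "\<bar>lin_forms J A b i\<bar> \<le> real m * R * real N" by (simp add: m_def)
        have "real N powr - \<omega> \<le> 1" using N \<omega> by (simp add: powr_minus_divide ge_one_powr_ge_zero)
        then have "\<bar>real_of_int (p i)\<bar> \<le> real m * R * real N + 1"
          using 1 p i by (smt (verit))
        also have "\<dots> \<le> (real m * R + 1) * real N" using N by (simp add: algebra_simps)
        also have "\<dots> \<le> real c1 * real N"
          unfolding c1_def using R by (intro mult_right_mono) linarith+
        finally show ?thesis unfolding P_def by (metis of_int_abs of_int_le_iff of_int_of_nat_eq of_nat_mult)
      qed
      then have p': "p' \<in> (\<Pi>\<^sub>E i\<in>I. {- int P..int P})"
        unfolding p'_def by (auto simp: abs_le_iff) (metis minus_le_iff)
      have "\<bar>\<lfloor>A i j / \<rho>\<rfloor>\<bar> \<le> int G" if "i \<in> I" "j \<in> J" for i j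
      proof -
        have "\<bar>A i j / \<rho>\<bar> \<le> R / \<rho>"
          using A that \<rho> by (auto simp: S_def abs_divide divide_right_mono)
        then have "real_of_int \<bar>\<lfloor>A i j / \<rho>\<rfloor>\<bar> \<le> R / \<rho> + 1"
          by linarith
        also have "\<dots> \<le> (R + 1) / \<rho>"
          using inv\<rho>_ge by (simp add: add_divide_distrib)
        finally show ?thesis
          unfolding G_def by linarith
      qed
      then have g: "g \<in> (\<Pi>\<^sub>E ij\<in>I \<times> (J - {j0}). {- int G..int G})"
        unfolding g_def by (auto simp: abs_le_iff minus_le_iff)
      have "(j0, b', p', g) \<in> T" unfolding T_def using j0 b' p' g by blast
      then show "\<exists>t. case t of (j0, b, p, g) \<Rightarrow> t \<in> T \<and> j0 \<in> J \<and> \<bar>b j0\<bar> = int N \<and>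
        (\<forall>j\<in>J. \<bar>b j\<bar> \<le> int N) \<and>
        (\<forall>i\<in>I. \<bar>lin_forms J A b i - of_int (p i)\<bar> < real N powr - \<omega>) \<and>
        (\<forall>i\<in>I. \<forall>j\<in>J - {j0}. g (i, j) = \<lfloor>A i j / \<rho>\<rfloor>)"
        by (intro exI[of _ "(j0, b', p', g)"])
          (use j0 ble p in \<open>auto simp: b'_def p'_def g_def lf[unfolded b'_def]\<close>)
    qed
    from bchoice[OF this] obtain f where f: "\<forall>A\<in>S. case f A of (j0, b, p, g) \<Rightarrow> f A \<in> T \<and> j0 \<in> J \<and> \<bar>b j0\<bar> = int N \<and>
        (\<forall>j\<in>J. \<bar>b j\<bar> \<le> int N) \<and>
        (\<forall>i\<in>I. \<bar>lin_forms J A b i - of_int (p i)\<bar> < real N powr - \<omega>) \<and>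
        (\<forall>i\<in>I. \<forall>j\<in>J - {j0}. g (i, j) = \<lfloor>A i j / \<rho>\<rfloor>)"
      by blast
    have fT: "f A \<in> T" if "A \<in> S" for A
      using f[rule_format, OF that] by (auto split: prod.splits)
    have close: "\<forall>i\<in>I. \<forall>j\<in>J. \<bar>A i j - B i j\<bar> \<le> real (m + 1) * \<rho>"
      if A: "A \<in> S" and B: "B \<in> S" and eq: "f A = f B" for A B
    proof (intro ballI)
      fix i j assume i: "i \<in> I" and j: "j \<in> J"
      obtain j0 b p g where fA: "f A = (j0, b, p, g)" by (cases "f A") auto
      have fB: "f B = (j0, b, p, g)" using fA eq by simp
      note fA' = f[rule_format, OF A, unfolded fA prod.case]
      note fB' = f[rule_format, OF B, unfolded fB prod.case]
      have other: "\<bar>A i j - B i j\<bar> \<le> \<rho>" if "j \<in> J - {j0}" for j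
      proof -
        have "\<lfloor>A i j / \<rho>\<rfloor> = \<lfloor>B i j / \<rho>\<rfloor>"
          using fA' fB' i that by metis
        then have "\<bar>A i j / \<rho> - B i j / \<rho>\<bar> \<le> 1" by linarith
        then have "\<bar>(A i j - B i j) / \<rho>\<bar> \<le> 1" by (simp add: diff_divide_distrib)
        then show ?thesis using \<rho> by (simp add: abs_divide)
      qed
      show "\<bar>A i j - B i j\<bar> \<le> real (m + 1) * \<rho>"
      proof (cases "j = j0")
        case False
        have "1 * \<rho> \<le> real (m + 1) * \<rho>" using \<rho> by (intro mult_right_mono) auto
        then show ?thesis using other[of j] False j by simp
      next
        case True
        have j0: "j0 \<in> J" "\<bar>real_of_int (b j0)\<bar> = real N"
          using fA' by (auto simp flip: of_int_abs)
        have split: "lin_forms J E b i = E i j0 * b j0 + (\<Sum>j\<in>J - {j0}. E i j * b j)" for E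
          unfolding lin_forms_def using sum.remove[OF J j0(1)] by blast
        have sum_le: "\<bar>\<Sum>j\<in>J - {j0}. (A i j - B i j) * b j\<bar> \<le> (\<Sum>j\<in>J - {j0}. \<rho> * real N)"
        proof (rule order_trans[OF sum_abs], rule sum_mono)
          fix j assume j: "j \<in> J - {j0}"
          have "\<bar>real_of_int (b j)\<bar> \<le> real N"
            using fA' j by (metis DiffD1 of_int_abs of_int_le_iff of_int_of_nat_eq)
          then show "\<bar>(A i j - B i j) * b j\<bar> \<le> \<rho> * real N"
            unfolding abs_mult using other[OF j] \<rho> by (intro mult_mono) auto
        qed
        have "\<bar>lin_forms J A b i - lin_forms J B b i\<bar> \<le> 2 * real N powr - \<omega>"
          using fA' fB' i by (smt (verit))
        moreover have "lin_forms J A b i - lin_forms J B b i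
            = (A i j0 - B i j0) * b j0 + (\<Sum>j\<in>J - {j0}. (A i j - B i j) * b j)"
          unfolding split by (simp add: algebra_simps sum_subtractf)
        ultimately have "\<bar>(A i j0 - B i j0) * b j0\<bar>
            \<le> 2 * real N powr - \<omega> + (\<Sum>j\<in>J - {j0}. \<rho> * real N)"
          using sum_le by linarith
        \<comment> \<open>As \<open>N * \<rho> = N powr - \<omega>\<close>, the two approximations
          contribute \<open>2\<close> and the other columns \<open>m - 1\<close>; this is the origin
          of \<open>m + 1\<close>.\<close>
        also have "\<dots> = real (m + 1) * \<rho> * real N"
          using J j0 m by (simp add: m_def of_nat_diff Suc_leI card_gt_0_iff algebra_simps flip: N\<rho>)
        finally have "\<bar>A i j0 - B i j0\<bar> * real N \<le> real (m + 1) * \<rho> * real N"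
          by (simp add: abs_mult j0)
        then show ?thesis using N True by simp
      qed
    qed
    obtain X where X: "finite X" "card X \<le> card T"
        "\<forall>A\<in>S. \<exists>B\<in>X. \<forall>i\<in>I. \<forall>j\<in>J. \<bar>A i j - B i j\<bar> \<le> real (m + 1) * \<rho>"
      using finite_index_representatives[OF finT, of S f
          "\<lambda>A B. \<forall>i\<in>I. \<forall>j\<in>J. \<bar>A i j - B i j\<bar> \<le> real (m + 1) * \<rho>"] fT close by blast
    have "real (card X) \<le> real (card T)" using X by simp
    also have "\<dots> = real m * (2 * real (2 * N + 1) ^ (m - 1) * (real (2 * P + 1) ^ a * real (2 * G + 1) ^ (a * (m - 1))))"
      unfolding cardT of_nat_mult of_nat_power by simp
    also have "\<dots> \<le> real m * (2 * (3 * real N) ^ (m - 1) *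
        ((real (2 * c1 + 1) * real N) ^ a * ((2 * R + 3) * (1 / \<rho>)) ^ (a * (m - 1))))"
    proof (intro mult_left_mono mult_mono power_mono)
      show "real (2 * N + 1) \<le> 3 * real N" using N by simp
      show "real (2 * P + 1) \<le> real (2 * c1 + 1) * real N"
        using N by (simp add: P_def algebra_simps)
      have "real G \<le> (R + 1) / \<rho>" unfolding G_def using R \<rho> by simp
      then show "real (2 * G + 1) \<le> (2 * R + 3) * (1 / \<rho>)"
        using inv\<rho>_ge by (simp add: add_divide_distrib)
    qed (use R \<rho> in auto)
    also have "\<dots> = C * (real N ^ (m - 1) * real N ^ a * (1 / \<rho>) ^ (a * (m - 1)))"
      unfolding C_def power_mult_distrib by (simp only: mult_ac)
    also have "real N ^ (m - 1) * real N ^ a * (1 / \<rho>) ^ (a * (m - 1))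
        = real N powr (real m - 1 + real a + (\<omega> + 1) * (real a * (real m - 1)))"
    proof -
      have "real N ^ (m - 1) = real N powr (real m - 1)"
        using N m by (simp add: of_nat_diff flip: powr_realpow)
      moreover have "real N ^ a = real N powr real a" using N by (simp add: powr_realpow)
      moreover have "(1 / \<rho>) ^ (a * (m - 1)) = real N powr ((\<omega> + 1) * (real a * (real m - 1)))"
        unfolding inv\<rho> using N m
        by (subst powr_realpow[symmetric]) (auto simp: powr_powr of_nat_diff)
      ultimately show ?thesis by (simp add: powr_add)
    qed
    finally show ?thesis
      using X unfolding S_def \<rho>_def by (intro exI[of _ X]) blast
  qed
  ultimately show ?thesis unfolding m_def a_def by blast
qed

lemma well_approx_cover_sequence:
  fixes R \<omega> :: real
  assumes I: "finite I" and J: "finite J" and \<omega>: "0 < \<omega>" and R: "0 \<le> R"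
  obtains C and X :: "nat \<Rightarrow> ('i \<Rightarrow> 'j \<Rightarrow> real) set" where "C > 0" "\<And>N. finite (X N)"
    "\<And>N. real (card (X N)) \<le> C * real N powr
      (real (card J) - 1 + real (card I) + (\<omega> + 1) * (real (card I) * (real (card J) - 1)))"
    "\<And>N A. N \<ge> 1 \<Longrightarrow> \<forall>i\<in>I. \<forall>j\<in>J. \<bar>A i j\<bar> \<le> R \<Longrightarrow> well_approx I J A \<omega> N \<Longrightarrow>
      \<exists>Y\<in>X N. \<forall>i\<in>I. \<forall>j\<in>J. \<bar>A i j - Y i j\<bar> \<le> real (card J + 1) * real N powr - (\<omega> + 1)"
proof -
  define good where "good C N X \<longleftrightarrow> finite X \<and> real (card X) \<le> C * real N powr
      (real (card J) - 1 + real (card I) + (\<omega> + 1) * (real (card I) * (real (card J) - 1))) \<and>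
    (\<forall>A. (\<forall>i\<in>I. \<forall>j\<in>J. \<bar>A i j\<bar> \<le> R) \<and> well_approx I J A \<omega> N \<longrightarrow>
      (\<exists>Y\<in>X. \<forall>i\<in>I. \<forall>j\<in>J. \<bar>A i j - Y i j\<bar> \<le> real (card J + 1) * real N powr - (\<omega> + 1)))"
    for C N and X :: "('i \<Rightarrow> 'j \<Rightarrow> real) set"
  obtain C where C: "C > 0" and cov: "\<forall>N\<ge>1. \<exists>X. good C N X"
    using well_approx_cover[OF assms] unfolding good_def by blast
  from cov obtain X where X: "\<And>N. N \<ge> 1 \<Longrightarrow> good C N (X N)" by metis
  \<comment> \<open>\<open>0 powr e = 0\<close>, so the bound on the cardinality at
    \<open>N = 0\<close> leaves only the empty set.\<close>
  show ?thesis
  proof (rule that[OF C, of "\<lambda>N. if N = 0 then {} else X N"])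
    fix N
    show "finite (if N = 0 then {} else X N)" using X[of N] by (simp add: good_def)
    show "real (card (if N = 0 then {} else X N)) \<le> C * real N powr
        (real (card J) - 1 + real (card I) + (\<omega> + 1) * (real (card I) * (real (card J) - 1)))"
      using X[of N] by (simp add: good_def)
  next
    fix N A assume N: "N \<ge> 1" and A: "\<forall>i\<in>I. \<forall>j\<in>J. \<bar>A i j\<bar> \<le> R" "well_approx I J A \<omega> N"
    have "\<exists>Y\<in>X N. \<forall>i\<in>I. \<forall>j\<in>J. \<bar>A i j - Y i j\<bar> \<le> real (card J + 1) * real N powr - (\<omega> + 1)"
      using X[OF N] A unfolding good_def by blast
    then show "\<exists>Y\<in>(if N = 0 then {} else X N). \<forall>i\<in>I. \<forall>j\<in>J.
        \<bar>A i j - Y i j\<bar> \<le> real (card J + 1) * real N powr - (\<omega> + 1)"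
      using N by simp
  qed
qed

section \<open>Hausdorff null sets\<close>

lemma hausdorff_measure_eq_0I:
  assumes "\<And>\<delta> \<epsilon>. 0 < \<delta> \<Longrightarrow> 0 < \<epsilon> \<Longrightarrow> \<exists>U :: nat \<Rightarrow> 'a::metric_space set. E \<subseteq> (\<Union>i. U i) \<and>
    (\<forall>i. bounded (U i) \<and> diameter (U i) \<le> \<delta>) \<and> (\<Sum>i. ennreal (diameter (U i) powr s)) \<le> ennreal \<epsilon>"
  shows "hausdorff_measure s E = 0"
proof -
  have "hausdorff_premeasure s \<delta> E = 0" if "\<delta> > 0" for \<delta>
  proof -
    have "hausdorff_premeasure s \<delta> E \<le> 0 + ennreal \<epsilon>" if "\<epsilon> > 0" for \<epsilon>
    proof -
      obtain U :: "nat \<Rightarrow> 'a set" where "E \<subseteq> (\<Union>i. U i)" "\<forall>i. bounded (U i) \<and> diameter (U i) \<le> \<delta>"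
        "(\<Sum>i. ennreal (diameter (U i) powr s)) \<le> ennreal \<epsilon>"
        using assms[OF \<open>\<delta> > 0\<close> \<open>\<epsilon> > 0\<close>] by blast
      then show ?thesis
        unfolding hausdorff_premeasure_def by (auto intro!: INF_lower2[of U])
    qed
    then have "hausdorff_premeasure s \<delta> E \<le> 0"
      by (rule ennreal_le_epsilon) auto
    then show ?thesis by simp
  qed
  then show ?thesis
    unfolding hausdorff_measure_def by (intro SUP_eq_const) auto
qed

lemma hausdorff_measure_eq_0D:
  assumes "hausdorff_measure s (E :: 'a::metric_space set) = 0" "0 < \<delta>" "0 < \<epsilon>"
  shows "\<exists>U :: nat \<Rightarrow> 'a set. E \<subseteq> (\<Union>i. U i) \<and>
    (\<forall>i. bounded (U i) \<and> diameter (U i) \<le> \<delta>) \<and> (\<Sum>i. ennreal (diameter (U i) powr s)) \<le> ennreal \<epsilon>"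
proof -
  have "hausdorff_premeasure s \<delta> E \<le> hausdorff_measure s E"
    unfolding hausdorff_measure_def using assms by (intro SUP_upper) auto
  then have "hausdorff_premeasure s \<delta> E < ennreal \<epsilon>"
    using assms by simp
  then show ?thesis
    unfolding hausdorff_premeasure_def INF_less_iff by (auto intro: less_imp_le)
qed

lemma hausdorff_measure_subset_0:
  assumes "hausdorff_measure s F = 0" "E \<subseteq> F"
  shows "hausdorff_measure s E = 0"
  using hausdorff_measure_eq_0D[OF assms(1)] assms(2)
  by (intro hausdorff_measure_eq_0I) (meson order_trans)

lemma hausdorff_measure_UN_0:
  fixes E :: "nat \<Rightarrow> 'a::metric_space set"
  assumes null: "\<And>l. hausdorff_measure s (E l) = 0"
  shows "hausdorff_measure s (\<Union>l. E l) = 0"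
proof (rule hausdorff_measure_eq_0I)
  fix \<delta> \<epsilon> :: real assume pos: "0 < \<delta>" "0 < \<epsilon>"
  have "\<exists>U. E l \<subseteq> (\<Union>i::nat. U i) \<and> (\<forall>i. bounded (U i) \<and> diameter (U i) \<le> \<delta>) \<and>
    (\<Sum>i. ennreal (diameter (U i) powr s)) \<le> ennreal (\<epsilon> * (1 / 2) ^ Suc l)" for l
    using pos by (intro hausdorff_measure_eq_0D[OF null]) auto
  then obtain U :: "nat \<Rightarrow> nat \<Rightarrow> 'a set" where U: "\<And>l. E l \<subseteq> (\<Union>i. U l i)"
    "\<And>l i. bounded (U l i)" "\<And>l i. diameter (U l i) \<le> \<delta>"
    "\<And>l. (\<Sum>i. ennreal (diameter (U l i) powr s)) \<le> ennreal (\<epsilon> * (1 / 2) ^ Suc l)"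
    by metis
  define V where "V k = (case prod_decode k of (l, i) \<Rightarrow> U l i)" for k
  have "(\<Sum>k. ennreal (diameter (V k) powr s))
      = (\<Sum>k. (\<lambda>(l, i). ennreal (diameter (U l i) powr s)) (prod_decode k))"
    by (simp add: V_def case_prod_unfold)
  also have "\<dots> = (\<Sum>l. \<Sum>i. ennreal (diameter (U l i) powr s))"
    by (rule suminf_ennreal_2dimen) simp
  also have "\<dots> \<le> (\<Sum>l. ennreal (\<epsilon> * (1 / 2) ^ Suc l))"
    using U(4) by (rule suminf_le) auto
  also have "\<dots> = ennreal \<epsilon>"
    using pos sums_mult[OF power_half_series, of \<epsilon>]
    by (intro suminf_ennreal_eq) auto
  finally have "(\<Sum>k. ennreal (diameter (V k) powr s)) \<le> ennreal \<epsilon>" .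
  moreover have "(\<Union>l. E l) \<subseteq> (\<Union>k. V k)"
  proof safe
    fix l x assume "x \<in> E l"
    then obtain i where "x \<in> U l i" using U(1) by blast
    then have "x \<in> V (prod_encode (l, i))" by (simp add: V_def)
    then show "x \<in> (\<Union>k. V k)" by blast
  qed
  moreover have "bounded (V k) \<and> diameter (V k) \<le> \<delta>" for k
    using U(2,3) by (simp add: V_def case_prod_unfold)
  ultimately show "\<exists>V :: nat \<Rightarrow> 'a set. (\<Union>l. E l) \<subseteq> (\<Union>i. V i) \<and>
      (\<forall>i. bounded (V i) \<and> diameter (V i) \<le> \<delta>) \<and> (\<Sum>i. ennreal (diameter (V i) powr s)) \<le> ennreal \<epsilon>"
    by blast
qed

text \<open>Hausdorff-Cantelli lemma: every tail of the double family covers \<open>E\<close>, its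
  sets become small, and its total weight tends to \<open>0\<close> because the series
  converges.\<close>

lemma hausdorff_measure_limsup_0:
  fixes E :: "'a::metric_space set" and X :: "nat \<Rightarrow> 'b set" and U :: "nat \<Rightarrow> 'b \<Rightarrow> 'a set"
  assumes s: "0 < s" and fin: "\<And>N. finite (X N)"
    and bd: "\<And>N x. x \<in> X N \<Longrightarrow> bounded (U N x)"
    and diam: "\<And>N x. x \<in> X N \<Longrightarrow> diameter (U N x) \<le> r N"
    and r: "r \<longlonglongrightarrow> 0" "\<And>N. 0 \<le> r N"
    and sm: "summable (\<lambda>N. real (card (X N)) * r N powr s)"
    and cover: "\<And>y. y \<in> E \<Longrightarrow> \<exists>\<^sub>\<infinity>N. \<exists>x\<in>X N. y \<in> U N x"
  shows "hausdorff_measure s E = 0"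
proof (rule hausdorff_measure_eq_0I)
  fix \<delta> \<epsilon> :: real assume pos: "0 < \<delta>" "0 < \<epsilon>"
  obtain K1 where K1: "\<And>N. N \<ge> K1 \<Longrightarrow> r N < \<delta>"
    using order_tendstoD(2)[OF r(1) pos(1)] by (auto simp: eventually_sequentially)
  have "(\<lambda>K. \<Sum>N. real (card (X (N + K))) * r (N + K) powr s) \<longlonglongrightarrow> 0"
    using suminf_exist_split2[OF sm] .
  from order_tendstoD(2)[OF this pos(2)] obtain K2 where
    K2: "\<And>K. K \<ge> K2 \<Longrightarrow> (\<Sum>N. real (card (X (N + K))) * r (N + K) powr s) < \<epsilon>"
    by (auto simp: eventually_sequentially)
  define K where "K = max K1 K2"
  obtain e :: "nat \<Rightarrow> nat \<Rightarrow> 'b" where e: "\<And>N. bij_betw (e N) {0..<card (X N)} (X N)"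
    using ex_bij_betw_nat_finite[OF fin] by metis
  define W where "W N i = (if i < card (X (N + K)) then U (N + K) (e (N + K) i) else {})" for N i
  define V where "V k = (case prod_decode k of (N, i) \<Rightarrow> W N i)" for k
  have mem: "e N i \<in> X N" if "i < card (X N)" for N i
    using bij_betwE[OF e[of N]] that by auto
  have W: "bounded (W N i) \<and> diameter (W N i) \<le> \<delta>" for N i
    using bd[OF mem] diam[OF mem] K1[of "N + K"] pos
    by (auto simp: W_def K_def intro!: order_trans[OF diam[OF mem]] less_imp_le[OF K1])
  have inner: "(\<Sum>i. ennreal (diameter (W N i) powr s))
      \<le> ennreal (real (card (X (N + K))) * r (N + K) powr s)" for N
  proof -
    have "(\<Sum>i. ennreal (diameter (W N i) powr s))
        = (\<Sum>i<card (X (N + K)). ennreal (diameter (W N i) powr s))"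
      by (intro suminf_finite) (auto simp: W_def)
    also have "\<dots> \<le> (\<Sum>i<card (X (N + K)). ennreal (r (N + K) powr s))"
      using s by (intro sum_mono ennreal_leI powr_mono2)
        (auto simp: W_def diameter_ge_0[OF bd[OF mem]] diam[OF mem])
    also have "\<dots> = ennreal (real (card (X (N + K))) * r (N + K) powr s)"
      by (simp add: ennreal_mult ennreal_of_nat_eq_real_of_nat)
    finally show ?thesis .
  qed
  have "(\<Sum>k. ennreal (diameter (V k) powr s))
      = (\<Sum>k. (\<lambda>(N, i). ennreal (diameter (W N i) powr s)) (prod_decode k))"
    by (simp add: V_def case_prod_unfold)
  also have "\<dots> = (\<Sum>N. \<Sum>i. ennreal (diameter (W N i) powr s))"
    by (rule suminf_ennreal_2dimen) simp
  also have "\<dots> \<le> (\<Sum>N. ennreal (real (card (X (N + K))) * r (N + K) powr s))"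
    using inner by (rule suminf_le) auto
  also have "\<dots> = ennreal (\<Sum>N. real (card (X (N + K))) * r (N + K) powr s)"
    using sm by (intro suminf_ennreal2) (auto simp: summable_iff_shift[of "\<lambda>N. real (card (X N)) * r N powr s"])
  also have "\<dots> \<le> ennreal \<epsilon>"
    using K2[of K] by (intro ennreal_leI) (auto simp: K_def)
  finally have sum: "(\<Sum>k. ennreal (diameter (V k) powr s)) \<le> ennreal \<epsilon>" .
  have cov: "E \<subseteq> (\<Union>k. V k)"
  proof
    fix y assume "y \<in> E"
    then obtain N x where N: "N \<ge> K" "x \<in> X N" "y \<in> U N x"
      using cover[of y] unfolding INFM_nat_le by blast
    then have "x \<in> e N ` {0..<card (X N)}"
      using bij_betw_imp_surj_on[OF e[of N]] by simp
    then obtain i where "i < card (X N)" "x = e N i" by auto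
    then have "y \<in> V (prod_encode (N - K, i))"
      using N by (simp add: V_def W_def)
    then show "y \<in> (\<Union>k. V k)" by blast
  qed
  have "bounded (V k) \<and> diameter (V k) \<le> \<delta>" for k
    using W by (simp add: V_def case_prod_unfold)
  then show "\<exists>V :: nat \<Rightarrow> 'a set. E \<subseteq> (\<Union>i. V i) \<and>
      (\<forall>i. bounded (V i) \<and> diameter (V i) \<le> \<delta>) \<and> (\<Sum>i. ennreal (diameter (V i) powr s)) \<le> ennreal \<epsilon>"
    using sum cov by blast
qed

lemma hausdorff_dim_eqI:
  fixes k :: real
  assumes "0 < k" "\<And>s. k < s \<Longrightarrow> hausdorff_measure s E = 0"
    and "\<And>s. 0 < s \<Longrightarrow> s < k \<Longrightarrow> hausdorff_measure s E \<noteq> 0"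
  shows "hausdorff_dim E = ereal k"
proof (rule antisym)
  show "hausdorff_dim E \<le> ereal k"
  proof (rule ereal_le_epsilon2)
    fix e :: real assume "0 < e"
    then have "0 < k + e \<and> hausdorff_measure (k + e) E = 0" using assms by auto
    then show "hausdorff_dim E \<le> ereal k + ereal e"
      unfolding hausdorff_dim_def by (intro Inf_lower) auto
  qed
  show "ereal k \<le> hausdorff_dim E"
    unfolding hausdorff_dim_def using assms(3) by (intro Inf_greatest) (force simp: not_less)
qed

section \<open>Counting almost integer vectors\<close>

lemma norm_sum_cis_square:
  fixes x :: "'b \<Rightarrow> real"
  shows "(norm (\<Sum>b\<in>X. cis (x b)))\<^sup>2 = (\<Sum>b\<in>X. \<Sum>b'\<in>X. cos (x b - x b'))"
proof -
  have "(norm (\<Sum>b\<in>X. cis (x b)))\<^sup>2 = (\<Sum>b\<in>X. cos (x b))\<^sup>2 + (\<Sum>b\<in>X. sin (x b))\<^sup>2"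
    by (simp add: cmod_power2)
  also have "\<dots> = (\<Sum>b\<in>X. \<Sum>b'\<in>X. cos (x b) * cos (x b') + sin (x b) * sin (x b'))"
    by (simp add: power2_eq_square sum_product sum.distrib)
  finally show ?thesis by (simp add: cos_diff)
qed

text \<open>Expanded, both sides are the same fourfold sum of cosines of mixed differences of
  \<open>P\<close>. The duality trades differences of \<open>u\<close>, which will be the vectors to
  be counted, for differences of \<open>b\<close>, about which the separation hypothesis gives
  information.\<close>

lemma exponential_sum_duality:
  fixes P :: "'u \<Rightarrow> 'b \<Rightarrow> real"
  shows "(\<Sum>u\<in>U. \<Sum>u'\<in>U. (norm (\<Sum>b\<in>X. cis (P u b - P u' b)))\<^sup>2)
       = (\<Sum>b\<in>X. \<Sum>b'\<in>X. (norm (\<Sum>u\<in>U. cis (P u b - P u b')))\<^sup>2)"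
proof -
  have "(\<Sum>u\<in>U. \<Sum>u'\<in>U. (norm (\<Sum>b\<in>X. cis (P u b - P u' b)))\<^sup>2)
      = (\<Sum>u\<in>U. \<Sum>b\<in>X. \<Sum>u'\<in>U. \<Sum>b'\<in>X. cos ((P u b - P u b') - (P u' b - P u' b')))"
    unfolding norm_sum_cis_square
    by (rule sum.cong[OF refl], subst sum.swap) (simp add: algebra_simps)
  also have "\<dots> = (\<Sum>b\<in>X. \<Sum>u\<in>U. \<Sum>b'\<in>X. \<Sum>u'\<in>U. cos ((P u b - P u b') - (P u' b - P u' b')))"
    by (subst sum.swap) (rule sum.cong[OF refl], rule sum.cong[OF refl], rule sum.swap)
  also have "\<dots> = (\<Sum>b\<in>X. \<Sum>b'\<in>X. (norm (\<Sum>u\<in>U. cis (P u b - P u b')))\<^sup>2)"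
    unfolding norm_sum_cis_square by (rule sum.cong[OF refl], rule sum.swap)
  finally show ?thesis .
qed

lemma cis_sum: "finite I \<Longrightarrow> cis (\<Sum>i\<in>I. f i) = (\<Prod>i\<in>I. cis (f i))"
  by (induction I rule: finite_induct) (auto simp: cis_mult[symmetric])

lemma sum_cis_box:
  assumes "finite I"
  shows "(\<Sum>u\<in>(\<Pi>\<^sub>E i\<in>I. {0..<n::nat}). cis (\<Sum>i\<in>I. real (u i) * \<theta> i))
       = (\<Prod>i\<in>I. \<Sum>k<n. cis (real k * \<theta> i))"
proof -
  have "(\<Prod>i\<in>I. \<Sum>k<n. cis (real k * \<theta> i)) = (\<Prod>i\<in>I. \<Sum>k\<in>{0..<n}. cis (real k * \<theta> i))"
    by (simp add: atLeast0LessThan)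
  also have "\<dots> = (\<Sum>u\<in>(\<Pi>\<^sub>E i\<in>I. {0..<n}). \<Prod>i\<in>I. cis (real (u i) * \<theta> i))"
    using assms by (subst prod_sum_PiE) auto
  finally show ?thesis by (simp add: cis_sum[OF assms])
qed

section \<open>Bounds for geometric sums of exponentials\<close>

lemma sin_ge_half:
  fixes x :: real
  assumes "0 \<le> x" "x \<le> pi / 2"
  shows "x / 2 \<le> sin x"
proof (cases "x \<le> pi / 3")
  case True
  have "sin 0 - 0 / 2 \<le> sin x - x / 2"
  proof (rule DERIV_nonneg_imp_nondecreasing[OF assms(1)])
    fix y assume y: "0 \<le> y" "y \<le> x"
    have "cos (pi / 3) \<le> cos y"
      using y True by (intro cos_monotone_0_pi_le) auto
    then show "\<exists>D. ((\<lambda>x. sin x - x / 2) has_real_derivative D) (at y) \<and> 0 \<le> D"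
      by (intro exI[of _ "cos y - 1 / 2"]) (auto intro!: derivative_eq_intros simp: cos_60)
  qed
  then show ?thesis by simp
next
  case False
  have "x / 2 \<le> 0.8" using assms pi_approx by simp
  also have "0.8 \<le> sqrt 3 / 2" using real_le_rsqrt[of "1.6" 3] by (simp add: power2_eq_square)
  also have "\<dots> = sin (pi / 3)" by (simp add: sin_60)
  also have "\<dots> \<le> sin x" using False assms by (intro sin_monotone_2pi_le) auto
  finally show ?thesis .
qed

text \<open>The sum is \<open>(1 - z ^ n) / (1 - z)\<close>, and \<open>norm (1 - z)\<close> is
  twice the sine of \<open>pi * y\<close>, where \<open>y\<close> is the distance of
  \<open>\<theta>\<close> to the nearest integer.\<close>

lemma norm_geometric_cis_le:
  assumes f: "0 < f" "f \<le> frac \<theta>" "frac \<theta> \<le> 1 - f"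
  shows "norm (\<Sum>k<n. cis (real k * (2 * pi * \<theta>))) \<le> 1 / f"
proof -
  define z where "z = cis (2 * pi * \<theta>)"
  define y where "y = min (frac \<theta>) (1 - frac \<theta>)"
  have y: "f \<le> y" "y \<le> 1 / 2" using f by (auto simp: y_def min_def)
  have "z = cis (2 * pi * frac \<theta>) * cis (2 * pi * of_int \<lfloor>\<theta>\<rfloor>)"
    by (simp add: z_def cis_mult frac_def algebra_simps)
  also have "cis (2 * pi * of_int \<lfloor>\<theta>\<rfloor>) = 1"
    by (simp add: cis.ctr one_complex.ctr cos_integer_2pi sin_integer_2pi)
  finally have z: "z = cis (2 * pi * frac \<theta>)" by simp
  have "(norm (1 - z))\<^sup>2 = (1 - cos (2 * pi * frac \<theta>))\<^sup>2 + (sin (2 * pi * frac \<theta>))\<^sup>2"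
    unfolding z by (simp add: cmod_power2)
  also have "\<dots> = 2 - 2 * cos (2 * (pi * frac \<theta>))"
    using sin_cos_squared_add[of "2 * pi * frac \<theta>"] by (simp add: power2_eq_square algebra_simps)
  also have "\<dots> = (2 * sin (pi * frac \<theta>))\<^sup>2"
    unfolding cos_double_sin by (simp add: power_mult_distrib)
  also have "sin (pi * frac \<theta>) = sin (pi * y)"
    unfolding y_def min_def by (simp add: right_diff_distrib sin_diff)
  finally have "(norm (1 - z))\<^sup>2 = (2 * sin (pi * y))\<^sup>2" .
  moreover have sin: "pi * y / 2 \<le> sin (pi * y)"
    using y f by (intro sin_ge_half) auto
  moreover have "3 * y \<le> pi * y" using y f pi_gt3 by (intro mult_right_mono) auto
  moreover have "0 \<le> sin (pi * y)"
    using sin \<open>3 * y \<le> pi * y\<close> y f by linarith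
  ultimately have nz: "norm (1 - z) = 2 * sin (pi * y)"
    using y f by (intro power2_eq_imp_eq[of "norm (1 - z)"]) (simp_all del: power2_eq_iff_nonneg)
  have ge: "2 * f \<le> norm (1 - z)"
    unfolding nz using sin \<open>3 * y \<le> pi * y\<close> y f by linarith
  have "(\<Sum>k<n. cis (real k * (2 * pi * \<theta>))) = (\<Sum>k<n. z ^ k)"
    unfolding z_def by (intro sum.cong refl) (rule Complex.DeMoivre[symmetric])
  also have "\<dots> = (1 - z ^ n) / (1 - z)"
    using ge f by (subst sum_gp_strict) auto
  finally have "norm (\<Sum>k<n. cis (real k * (2 * pi * \<theta>))) = norm (1 - z ^ n) / norm (1 - z)"
    by (simp add: norm_divide)
  also have "\<dots> \<le> 2 / (2 * f)"
  proof (rule frac_le)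
    show "norm (1 - z ^ n) \<le> 2"
      using norm_triangle_ineq4[of 1 "z ^ n"] by (simp add: norm_power z_def)
  qed (use ge f in auto)
  finally show ?thesis using f by simp
qed

text \<open>The circle is cut into \<open>Q\<close> cells of length \<open>1 / Q\<close>, and the
  bound depends on \<open>\<theta>\<close> only through its cell \<open>\<kappa>\<close>, counted
  from both ends. Summed over distinct cells it stays of order \<open>Q ^ 2\<close>, although a
  single cell may already contribute that much.\<close>

lemma norm_geometric_cis_square_le:
  assumes Q: "Q \<ge> 1" and \<kappa>: "\<kappa> = nat \<lfloor>real Q * frac \<theta>\<rfloor>"
  shows "(norm (\<Sum>k<3 * Q. cis (real k * (2 * pi * \<theta>))))\<^sup>2
    \<le> 9 * (real Q)\<^sup>2 * (1 / (real \<kappa> + 1)\<^sup>2 + 1 / (real Q - real \<kappa>)\<^sup>2)"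
proof -
  let ?D = "norm (\<Sum>k<3 * Q. cis (real k * (2 * pi * \<theta>)))"
  have \<kappa>_le: "real \<kappa> \<le> real Q * frac \<theta>" and \<kappa>_gt: "real Q * frac \<theta> < real \<kappa> + 1"
    unfolding \<kappa> using frac_ge_0[of \<theta>] by (auto simp: of_nat_nat)
  have "real Q * frac \<theta> < real Q" using Q frac_lt_1[of \<theta>] by simp
  then have "real \<kappa> < real Q" using \<kappa>_le by linarith
  then have \<kappa>Q: "\<kappa> + 1 \<le> Q" by simp
  have triv: "?D\<^sup>2 \<le> 9 * (real Q)\<^sup>2"
  proof -
    have "?D \<le> (\<Sum>k<3 * Q. norm (cis (real k * (2 * pi * \<theta>))))" by (rule norm_sum)
    then have "?D \<le> 3 * real Q" by simp
    then have "?D\<^sup>2 \<le> (3 * real Q)\<^sup>2" by (intro power_mono) auto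
    then show ?thesis by (simp add: power_mult_distrib)
  qed
  have key: "?D\<^sup>2 \<le> 9 * (real Q)\<^sup>2 * (1 / (real l + 1)\<^sup>2)"
    if l: "l \<ge> 1" "real l \<le> real Q * frac \<theta>" "real Q * frac \<theta> \<le> real Q - real l" for l :: nat
  proof -
    have "?D \<le> 1 / (real l / real Q)"
      using l Q by (intro norm_geometric_cis_le) (auto simp: field_simps)
    then have "?D\<^sup>2 \<le> (real Q / real l)\<^sup>2" by (intro power_mono) auto
    also have "\<dots> = (real Q)\<^sup>2 * (1 / (real l)\<^sup>2)" by (simp add: power_divide)
    \<comment> \<open>\<open>l + 1 \<le> 3 * l\<close> is used rather than \<open>2 * l\<close>, so
      that the constant \<open>9\<close> agrees with the one of the trivial bound by
      \<open>3 * Q\<close> terms.\<close>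
    also have "1 / (real l)\<^sup>2 \<le> 9 * (1 / (real l + 1)\<^sup>2)"
    proof -
      have "(real l + 1)\<^sup>2 \<le> (3 * real l)\<^sup>2" using l by (intro power_mono) auto
      then show ?thesis using l by (simp add: field_simps power_mult_distrib)
    qed
    finally have "?D\<^sup>2 \<le> (real Q)\<^sup>2 * (9 * (1 / (real l + 1)\<^sup>2))"
      by (simp add: mult_left_mono)
    then show ?thesis by (simp only: mult_ac)
  qed
  \<comment> \<open>The two cells next to an integer need the trivial bound; in the others the
    nearer end decides.\<close>
  consider "\<kappa> = 0" | "\<kappa> + 1 = Q" | "\<kappa> \<ge> 1" "2 * \<kappa> + 1 \<le> Q" | "Q - 1 - \<kappa> \<ge> 1" "2 * \<kappa> + 1 > Q"
    using \<kappa>Q by linarith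
  then show ?thesis
  proof cases
    case 1
    have "?D\<^sup>2 \<le> 9 * (real Q)\<^sup>2 * 1" using triv by simp
    also have "\<dots> \<le> 9 * (real Q)\<^sup>2 * (1 / (real \<kappa> + 1)\<^sup>2 + 1 / (real Q - real \<kappa>)\<^sup>2)"
      using 1 by (intro mult_left_mono) auto
    finally show ?thesis .
  next
    case 2
    then have "real Q - real \<kappa> = 1" by linarith
    have "?D\<^sup>2 \<le> 9 * (real Q)\<^sup>2 * 1" using triv by simp
    also have "\<dots> \<le> 9 * (real Q)\<^sup>2 * (1 / (real \<kappa> + 1)\<^sup>2 + 1 / (real Q - real \<kappa>)\<^sup>2)"
      using \<open>real Q - real \<kappa> = 1\<close> by (intro mult_left_mono) auto
    finally show ?thesis .
  next
    case 3
    then have "?D\<^sup>2 \<le> 9 * (real Q)\<^sup>2 * (1 / (real \<kappa> + 1)\<^sup>2)"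
      using \<kappa>_le \<kappa>_gt by (intro key) auto
    also have "\<dots> \<le> 9 * (real Q)\<^sup>2 * (1 / (real \<kappa> + 1)\<^sup>2 + 1 / (real Q - real \<kappa>)\<^sup>2)"
      by (intro mult_left_mono) auto
    finally show ?thesis .
  next
    case 4
    have "?D\<^sup>2 \<le> 9 * (real Q)\<^sup>2 * (1 / (real (Q - 1 - \<kappa>) + 1)\<^sup>2)"
      using 4 \<kappa>_le \<kappa>_gt by (intro key) auto
    also have "real (Q - 1 - \<kappa>) + 1 = real Q - real \<kappa>" using \<kappa>Q by linarith
    also have "9 * (real Q)\<^sup>2 * (1 / (real Q - real \<kappa>)\<^sup>2)
        \<le> 9 * (real Q)\<^sup>2 * (1 / (real \<kappa> + 1)\<^sup>2 + 1 / (real Q - real \<kappa>)\<^sup>2)"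
      by (intro mult_left_mono) auto
    finally show ?thesis .
  qed
qed

lemma sum_inverse_squares_le: "(\<Sum>k<n. 1 / (real k + 1)\<^sup>2) \<le> 2"
proof -
  have "(\<Sum>k<n. 1 / (real k + 1)\<^sup>2) \<le> 2 - 1 / real n" if "n \<ge> 1"
    using that
  proof (induction n rule: dec_induct)
    case (step n)
    have "1 / (real n + 1)\<^sup>2 \<le> 1 / (real n * (real n + 1))"
      using step by (intro divide_left_mono) (auto simp: power2_eq_square)
    also have "\<dots> = 1 / real n - 1 / (real n + 1)" using step by (simp add: field_simps)
    finally show ?case using step by (simp add: add.commute)
  qed simp
  then show ?thesis by (cases "n = 0") (auto intro: order_trans)
qed

lemma sum_kernel_bound:
  "(\<Sum>\<kappa><Q. 9 * (real Q)\<^sup>2 * (1 / (real \<kappa> + 1)\<^sup>2 + 1 / (real Q - real \<kappa>)\<^sup>2)) \<le> 36 * (real Q)\<^sup>2"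
proof -
  have "(\<Sum>\<kappa><Q. 1 / (real Q - real \<kappa>)\<^sup>2) = (\<Sum>\<kappa><Q. 1 / (real Q - real (Q - Suc \<kappa>))\<^sup>2)"
    by (rule sum.nat_diff_reindex[symmetric])
  also have "\<dots> = (\<Sum>\<kappa><Q. 1 / (real \<kappa> + 1)\<^sup>2)"
    by (intro sum.cong) (auto simp: of_nat_diff add.commute)
  finally have "(\<Sum>\<kappa><Q. (1 / (real \<kappa> + 1)\<^sup>2 + 1 / (real Q - real \<kappa>)\<^sup>2)) \<le> 4"
    using sum_inverse_squares_le[of Q] by (simp add: sum.distrib)
  then have "9 * (real Q)\<^sup>2 * (\<Sum>\<kappa><Q. (1 / (real \<kappa> + 1)\<^sup>2 + 1 / (real Q - real \<kappa>)\<^sup>2)) \<le> 9 * (real Q)\<^sup>2 * 4"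
    by (intro mult_left_mono) auto
  then show ?thesis by (simp add: sum_distrib_left)
qed

lemma lin_forms_diff: "lin_forms J A (\<lambda>j. b j - b' j) i = lin_forms J A b i - lin_forms J A b' i"
  by (simp add: lin_forms_def sum_subtractf algebra_simps)

lemma near_int_if_same_cell:
  assumes Q: "Q \<ge> 1" and eq: "nat \<lfloor>real Q * frac x\<rfloor> = nat \<lfloor>real Q * frac y\<rfloor>"
  shows "near_int (1 / real Q) (x - y)"
proof -
  have "\<lfloor>real Q * frac x\<rfloor> = \<lfloor>real Q * frac y\<rfloor>"
    using eq by (subst (asm) eq_nat_nat_iff) auto
  then have "\<bar>real Q * frac x - real Q * frac y\<bar> < 1" by linarith
  then have "real Q * \<bar>frac x - frac y\<bar> < 1" using Q by (simp add: abs_mult flip: right_diff_distrib)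
  then have "\<bar>frac x - frac y\<bar> < 1 / real Q" using Q by (simp add: field_simps)
  then have "\<bar>x - y - of_int (\<lfloor>x\<rfloor> - \<lfloor>y\<rfloor>)\<bar> < 1 / real Q" by (simp add: frac_def algebra_simps)
  then show ?thesis unfolding near_int_def by blast
qed

text \<open>Two vectors \<open>b\<close> in the box with the same cells would have a difference
  whose forms are all near integers, against \<open>sep\<close>. So every tuple of cells is used at
  most once, and the sum over \<open>b\<close> is at most the sum over all tuples, which factorises
  over \<open>I\<close>. The shift \<open>\<beta>\<close> cancels in differences.\<close>

lemma separated_exponential_sum_le:
  assumes I: "finite I" and J: "finite J" and Q: "Q \<ge> 1"
    and sep: "\<And>b. (\<exists>j\<in>J. b j \<noteq> 0) \<Longrightarrow> (\<forall>j\<in>J. \<bar>b j\<bar> \<le> int T) \<Longrightarrow>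
      \<exists>i\<in>I. \<not> near_int (1 / real Q) (lin_forms J A b i)"
  shows "(\<Sum>b\<in>(\<Pi>\<^sub>E j\<in>J. {0..int T}). \<Prod>i\<in>I.
      (norm (\<Sum>k<3 * Q. cis (real k * (2 * pi * (lin_forms J A b i - \<beta> i)))))\<^sup>2)
    \<le> (36 * (real Q)\<^sup>2) ^ card I"
proof -
  define X where "X = (\<Pi>\<^sub>E j\<in>J. {0..int T})"
  define h where "h \<kappa> = 9 * (real Q)\<^sup>2 * (1 / (real \<kappa> + 1)\<^sup>2 + 1 / (real Q - real \<kappa>)\<^sup>2)" for \<kappa> :: nat
  define \<theta> where "\<theta> b i = lin_forms J A b i - \<beta> i" for b i
  define c where "c b = (\<lambda>i\<in>I. nat \<lfloor>real Q * frac (\<theta> b i)\<rfloor>)" for b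
  have h0: "h \<kappa> \<ge> 0" for \<kappa> by (simp add: h_def)
  have inj: "inj_on c X"
  proof (rule inj_onI, rule ccontr)
    fix b b' assume b: "b \<in> X" "b' \<in> X" "c b = c b'" "b \<noteq> b'"
    have "\<exists>j\<in>J. b j \<noteq> b' j"
      using b unfolding X_def by (metis PiE_ext)
    moreover have "\<forall>j\<in>J. \<bar>b j - b' j\<bar> \<le> int T"
    proof
      fix j assume "j \<in> J"
      then have "b j \<in> {0..int T}" "b' j \<in> {0..int T}" using b(1,2) unfolding X_def by auto
      then show "\<bar>b j - b' j\<bar> \<le> int T" by auto
    qed
    ultimately obtain i where i: "i \<in> I" "\<not> near_int (1 / real Q) (lin_forms J A (\<lambda>j. b j - b' j) i)"
      using sep[of "\<lambda>j. b j - b' j"] by auto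
    have "c b i = c b' i" using b by simp
    then have "near_int (1 / real Q) (\<theta> b i - \<theta> b' i)"
      using i Q by (intro near_int_if_same_cell) (auto simp: c_def)
    then show False using i by (simp add: \<theta>_def lin_forms_diff)
  qed
  have cX: "c b \<in> (\<Pi>\<^sub>E i\<in>I. {..<Q})" for b
  proof -
    have "nat \<lfloor>real Q * frac x\<rfloor> < Q" for x
    proof -
      have "real Q * frac x < real Q" using Q frac_lt_1[of x] by simp
      then have "\<lfloor>real Q * frac x\<rfloor> < int Q" by linarith
      then show ?thesis using Q by linarith
    qed
    then show ?thesis by (auto simp: c_def)
  qed
  have "(\<Sum>b\<in>X. \<Prod>i\<in>I. (norm (\<Sum>k<3 * Q. cis (real k * (2 * pi * \<theta> b i))))\<^sup>2)
      \<le> (\<Sum>b\<in>X. \<Prod>i\<in>I. h (c b i))"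
    unfolding h_def
    by (intro sum_mono prod_mono conjI norm_geometric_cis_square_le Q) (auto simp: c_def)
  also have "\<dots> = (\<Sum>\<kappa>\<in>c ` X. \<Prod>i\<in>I. h (\<kappa> i))"
    using sum.reindex[OF inj, of "\<lambda>\<kappa>. \<Prod>i\<in>I. h (\<kappa> i)"] by simp
  also have "\<dots> \<le> (\<Sum>\<kappa>\<in>(\<Pi>\<^sub>E i\<in>I. {..<Q}). \<Prod>i\<in>I. h (\<kappa> i))"
    using cX I h0 by (intro sum_mono2 finite_PiE prod_nonneg) auto
  also have "\<dots> = (\<Prod>i\<in>I. \<Sum>\<kappa><Q. h \<kappa>)"
    using I by (subst prod_sum_PiE) auto
  also have "\<dots> \<le> (\<Prod>i\<in>I. 36 * (real Q)\<^sup>2)"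
    using h0 sum_kernel_bound[of Q] by (intro prod_mono conjI sum_nonneg) (auto simp: h_def)
  finally show ?thesis by (simp add: X_def \<theta>_def)
qed

lemma cos_ge_half:
  assumes "\<bar>x\<bar> \<le> pi / 4"
  shows "1 / 2 \<le> cos (2 * pi * of_int k + x)"
proof -
  have "cos (pi / 3) \<le> cos \<bar>x\<bar>"
    using assms by (intro cos_monotone_0_pi_le) auto
  then have "1 / 2 \<le> cos x" by (simp add: cos_60)
  moreover have "cos (2 * pi * of_int k + x) = cos x"
    by (simp add: cos_add cos_integer_2pi sin_integer_2pi)
  ultimately show ?thesis by simp
qed

text \<open>A large sieve. For \<open>v\<close> in \<open>S\<close>, the sum of
  \<open>cis (P (u + v) b - P u b)\<close> over \<open>b\<close> in the box \<open>X\<close> has all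
  phases within \<open>pi / 4\<close> of multiples of \<open>2 * pi\<close>, which is what the
  factor \<open>8 * card J * T\<close> in \<open>near\<close> achieves; so its norm is at least
  \<open>card X / 2\<close>. There are \<open>card S * Q ^ card I\<close> such pairs
  \<open>(u + v, u)\<close>, while by duality and separation the sum of all squared norms is at most
  \<open>card X * (36 * Q ^ 2) ^ card I\<close>.\<close>

theorem card_almost_integer_vectors:
  fixes A :: "'i \<Rightarrow> 'j \<Rightarrow> real" and S :: "('i \<Rightarrow> int) set"
  assumes I: "finite I" and J: "finite J" and Q: "Q \<ge> 1"
    and sep: "\<And>b. (\<exists>j\<in>J. b j \<noteq> 0) \<Longrightarrow> (\<forall>j\<in>J. \<bar>b j\<bar> \<le> int T) \<Longrightarrow>
      \<exists>i\<in>I. \<not> near_int (1 / real Q) (lin_forms J A b i)"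
    and S: "S \<subseteq> (\<Pi>\<^sub>E i\<in>I. {- int Q..int Q})"
    and near: "\<And>v j. v \<in> S \<Longrightarrow> j \<in> J \<Longrightarrow>
      \<exists>p::int. 8 * real (card J) * real T * \<bar>(\<Sum>i\<in>I. of_int (v i) * A i j) - of_int p\<bar> \<le> 1"
  shows "real (card S) * real (T + 1) ^ card J \<le> 4 * 36 ^ card I * real Q ^ card I"
proof -
  define X where "X = (\<Pi>\<^sub>E j\<in>J. {0..int T})"
  define U where "U = (\<Pi>\<^sub>E i\<in>I. {0..<3 * Q})"
  \<comment> \<open>The middle third of \<open>U\<close>: its translates by vectors of
    \<open>S\<close> stay inside \<open>U\<close>.\<close>
  define U0 where "U0 = (\<Pi>\<^sub>E i\<in>I. {Q..<2 * Q})"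
  define P where "P u b = (\<Sum>i\<in>I. real (u i) * (2 * pi * lin_forms J A b i))" for u :: "'i \<Rightarrow> nat" and b
  have fin: "finite X" "finite U" "finite U0" "finite S"
    using I J S by (auto simp: X_def U_def U0_def intro!: finite_PiE intro: finite_subset[OF S])
  have cardX: "card X = (T + 1) ^ card J"
    using J by (simp add: X_def card_PiE nat_add_distrib)
  have cardU0: "card U0 = Q ^ card I"
    using I by (simp add: U0_def card_PiE)
  define g where "g = (\<lambda>(v :: 'i \<Rightarrow> int, u :: 'i \<Rightarrow> nat). ((\<lambda>i\<in>I. nat (int (u i) + v i)), u))"
  have shift: "int (u i) + v i \<ge> 0" "int (u i) + v i < 3 * int Q"
    if "v \<in> S" "u \<in> U0" "i \<in> I" for v u i
  proof -
    have "v i \<in> {- int Q..int Q}" using that S by blast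
    moreover have "u i \<in> {Q..<2 * Q}" using that by (auto simp: U0_def)
    ultimately show "int (u i) + v i \<ge> 0" "int (u i) + v i < 3 * int Q" by auto
  qed
  have g_inj: "inj_on g (S \<times> U0)"
  proof (rule inj_onI, clarsimp simp: g_def)
    fix v u v' assume v: "v \<in> S" "v' \<in> S" and u: "u \<in> U0"
      and eq: "(\<lambda>i\<in>I. nat (int (u i) + v i)) = (\<lambda>i\<in>I. nat (int (u i) + v' i))"
    show "v = v'"
    proof (rule PiE_ext)
      show "v \<in> (\<Pi>\<^sub>E i\<in>I. {- int Q..int Q})" "v' \<in> (\<Pi>\<^sub>E i\<in>I. {- int Q..int Q})"
        using v S by auto
      fix i assume i: "i \<in> I"
      have "nat (int (u i) + v i) = nat (int (u i) + v' i)" using fun_cong[OF eq, of i] i by simp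
      then show "v i = v' i" using shift(1)[OF v(1) u i] shift(1)[OF v(2) u i] by linarith
    qed
  qed
  have g_sub: "g ` (S \<times> U0) \<subseteq> U \<times> U"
  proof (clarsimp simp: g_def)
    fix v u assume v: "v \<in> S" and u: "u \<in> U0"
    have "nat (int (u i) + v i) < 3 * Q" if "i \<in> I" for i
      using shift[OF v u that] by linarith
    moreover have "u \<in> U" using u by (auto simp: U_def U0_def PiE_iff)
    ultimately show "(\<lambda>i\<in>I. nat (int (u i) + v i)) \<in> U \<and> u \<in> U"
      by (auto simp: U_def)
  qed
  define F where "F = (\<lambda>(u, u'). (norm (\<Sum>b\<in>X. cis (P u b - P u' b)))\<^sup>2)"
  have F_ge: "(real (card X) / 2)\<^sup>2 \<le> F (g (v, u))" if v: "v \<in> S" and u: "u \<in> U0" for v u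
  proof -
    define w where "w = (\<lambda>i\<in>I. nat (int (u i) + v i))"
    have diff: "P w b - P u b = 2 * pi * (\<Sum>j\<in>J. of_int (b j) * (\<Sum>i\<in>I. of_int (v i) * A i j))" for b
    proof -
      have "P w b - P u b = (\<Sum>i\<in>I. of_int (v i) * (2 * pi * lin_forms J A b i))"
        unfolding P_def sum_subtractf[symmetric]
      proof (rule sum.cong[OF refl])
        fix i assume i: "i \<in> I"
        have "real (w i) = real (u i) + of_int (v i)"
          using shift(1)[OF v u i] i by (simp add: w_def of_nat_nat)
        then show "real (w i) * (2 * pi * lin_forms J A b i) - real (u i) * (2 * pi * lin_forms J A b i)
            = of_int (v i) * (2 * pi * lin_forms J A b i)"
          by (simp add: algebra_simps)
      qed
      also have "\<dots> = (\<Sum>i\<in>I. \<Sum>j\<in>J. 2 * pi * (of_int (b j) * (of_int (v i) * A i j)))"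
        by (simp add: lin_forms_def sum_distrib_left mult_ac)
      also have "\<dots> = (\<Sum>j\<in>J. \<Sum>i\<in>I. 2 * pi * (of_int (b j) * (of_int (v i) * A i j)))"
        by (rule sum.swap)
      finally show ?thesis by (simp add: sum_distrib_left)
    qed
    obtain p :: "'j \<Rightarrow> int" where p: "\<And>j. j \<in> J \<Longrightarrow>
        8 * real (card J) * real T * \<bar>(\<Sum>i\<in>I. of_int (v i) * A i j) - of_int (p j)\<bar> \<le> 1"
      using near[OF v] by metis
    have cos: "1 / 2 \<le> cos (P w b - P u b)" if b: "b \<in> X" for b
    proof -
      define e where "e j = (\<Sum>i\<in>I. of_int (v i) * A i j) - of_int (p j)" for j
      have "P w b - P u b = 2 * pi * of_int (\<Sum>j\<in>J. b j * p j) + 2 * pi * (\<Sum>j\<in>J. of_int (b j) * e j)"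
        unfolding diff e_def by (simp add: algebra_simps sum_subtractf flip: sum.distrib)
      moreover have "\<bar>2 * pi * (\<Sum>j\<in>J. of_int (b j) * e j)\<bar> \<le> pi / 4"
      proof -
        have "8 * \<bar>\<Sum>j\<in>J. of_int (b j) * e j\<bar> \<le> 1"
        proof (cases "J = {}")
          case False
          then have cJ: "real (card J) > 0" using J by (simp add: card_gt_0_iff)
          have "8 * \<bar>of_int (b j) * e j\<bar> \<le> 1 / real (card J)" if j: "j \<in> J" for j
          proof -
            have "b j \<in> {0..int T}" using b j by (auto simp: X_def)
            then have "\<bar>of_int (b j) * e j\<bar> \<le> real T * \<bar>e j\<bar>"
              unfolding abs_mult by (intro mult_right_mono) auto
            then have "8 * real (card J) * \<bar>of_int (b j) * e j\<bar> \<le> 8 * real (card J) * (real T * \<bar>e j\<bar>)"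
              by (intro mult_left_mono) auto
            then have "8 * real (card J) * \<bar>of_int (b j) * e j\<bar> \<le> 1"
              using p[OF j] unfolding e_def by linarith
            then show ?thesis using cJ by (simp add: field_simps del: abs_mult)
          qed
          then have "(\<Sum>j\<in>J. 8 * \<bar>of_int (b j) * e j\<bar>) \<le> (\<Sum>j\<in>J. 1 / real (card J))"
            by (rule sum_mono)
          moreover have "8 * \<bar>\<Sum>j\<in>J. of_int (b j) * e j\<bar> \<le> (\<Sum>j\<in>J. 8 * \<bar>of_int (b j) * e j\<bar>)"
            by (simp flip: sum_distrib_left)
          ultimately show ?thesis using cJ by simp
        qed simp
        then have "pi * (8 * \<bar>\<Sum>j\<in>J. of_int (b j) * e j\<bar>) \<le> pi * 1" by (intro mult_left_mono) auto
        then show ?thesis by (simp add: abs_mult)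
      qed
      ultimately show ?thesis using cos_ge_half by metis
    qed
    have "real (card X) / 2 = (\<Sum>b\<in>X. 1 / 2)" by simp
    also have "\<dots> \<le> (\<Sum>b\<in>X. cos (P w b - P u b))" by (intro sum_mono cos)
    also have "\<dots> = Re (\<Sum>b\<in>X. cis (P w b - P u b))" by simp
    also have "\<dots> \<le> norm (\<Sum>b\<in>X. cis (P w b - P u b))" by (rule complex_Re_le_cmod)
    finally have "(real (card X) / 2)\<^sup>2 \<le> (norm (\<Sum>b\<in>X. cis (P w b - P u b)))\<^sup>2"
      by (intro power_mono) auto
    then show ?thesis by (simp add: F_def g_def w_def)
  qed
  have "real (card S) * real (card U0) * (real (card X) / 2)\<^sup>2
      = (\<Sum>x\<in>S \<times> U0. (real (card X) / 2)\<^sup>2)"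
    by (simp add: card_cartesian_product)
  also have "\<dots> \<le> (\<Sum>x\<in>S \<times> U0. F (g x))"
    using F_ge by (intro sum_mono) auto
  also have "\<dots> = (\<Sum>x\<in>g ` (S \<times> U0). F x)"
    using sum.reindex[OF g_inj, of F] by simp
  also have "\<dots> \<le> (\<Sum>x\<in>U \<times> U. F x)"
    using g_sub fin by (intro sum_mono2) (auto simp: F_def)
  also have "\<dots> = (\<Sum>u\<in>U. \<Sum>u'\<in>U. (norm (\<Sum>b\<in>X. cis (P u b - P u' b)))\<^sup>2)"
    by (simp add: F_def sum.cartesian_product)
  also have "\<dots> = (\<Sum>b\<in>X. \<Sum>b'\<in>X. (norm (\<Sum>u\<in>U. cis (P u b - P u b')))\<^sup>2)"
    by (rule exponential_sum_duality)
  also have "\<dots> = (\<Sum>b'\<in>X. \<Sum>b\<in>X. (norm (\<Sum>u\<in>U. cis (P u b - P u b')))\<^sup>2)"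
    by (rule sum.swap)
  also have "\<dots> \<le> (\<Sum>b'\<in>X. (36 * (real Q)\<^sup>2) ^ card I)"
  proof (rule sum_mono)
    \<comment> \<open>For fixed \<open>b'\<close>, its own linear forms are the shift
      \<open>\<beta>\<close> of the separated estimate.\<close>
    fix b' assume "b' \<in> X"
    have "(norm (\<Sum>u\<in>U. cis (P u b - P u b')))\<^sup>2
        = (\<Prod>i\<in>I. (norm (\<Sum>k<3 * Q. cis (real k * (2 * pi * (lin_forms J A b i - lin_forms J A b' i)))))\<^sup>2)" for b
    proof -
      have "P u b - P u b' = (\<Sum>i\<in>I. real (u i) * (2 * pi * (lin_forms J A b i - lin_forms J A b' i)))" for u
        by (simp add: P_def sum_subtractf algebra_simps)
      then show ?thesis
        unfolding U_def by (simp add: sum_cis_box[OF I] prod_norm[symmetric] prod_power_distrib)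
    qed
    then show "(\<Sum>b\<in>X. (norm (\<Sum>u\<in>U. cis (P u b - P u b')))\<^sup>2) \<le> (36 * (real Q)\<^sup>2) ^ card I"
      using separated_exponential_sum_le[OF I J Q, of T A "lin_forms J A b'", OF sep]
      unfolding X_def by simp
  qed
  also have "\<dots> = real (card X) * (36 * (real Q)\<^sup>2) ^ card I" by simp
  finally have main: "real (card S) * real (Q ^ card I) * (real (card X) / 2)\<^sup>2
      \<le> real (card X) * (36 * (real Q)\<^sup>2) ^ card I"
    by (simp add: cardU0)
  have pos: "real (card X) * real Q ^ card I > 0" using Q by (simp add: cardX)
  have "real (card X) * real Q ^ card I * (real (card S) * real (card X))
      = 4 * (real (card S) * real (Q ^ card I) * (real (card X) / 2)\<^sup>2)"
    by (simp add: power2_eq_square)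
  also have "\<dots> \<le> 4 * (real (card X) * (36 * (real Q)\<^sup>2) ^ card I)"
    using main by simp
  also have "\<dots> = real (card X) * real Q ^ card I * (4 * 36 ^ card I * real Q ^ card I)"
    by (simp add: power_mult_distrib power2_eq_square)
  finally have "real (card S) * real (card X) \<le> 4 * 36 ^ card I * real Q ^ card I"
    using pos mult_le_cancel_left_pos by blast
  then show ?thesis by (simp add: cardX)
qed

section \<open>Charts of the space of affine subspaces\<close>

text \<open>\<open>D\<close> is the set of free coordinates; letting it vary replaces the
  permutations of the coordinates. The row \<open>None\<close> of the matrix belongs to the entry
  \<open>1\<close> of \<open>(1, x)\<close>, the row \<open>Some i\<close> to the coordinate
  \<open>i\<close>.\<close>

definition chart_subspace :: "'n set \<Rightarrow> ('n option \<Rightarrow> 'n \<Rightarrow> real) \<Rightarrow> (real ^ 'n) set" where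
  "chart_subspace D A = {y. \<forall>j. j \<notin> D \<longrightarrow> y $ j = A None j + (\<Sum>i\<in>D. A (Some i) j * y $ i)}"

definition chart_cone :: "'n set \<Rightarrow> ('n option \<Rightarrow> 'n \<Rightarrow> real) \<Rightarrow> (real \<times> (real ^ 'n)) set" where
  "chart_cone D A = {(t, y). \<forall>j. j \<notin> D \<longrightarrow> y $ j = t * A None j + (\<Sum>i\<in>D. A (Some i) j * y $ i)}"

definition chart_index :: "'n set \<Rightarrow> 'n option set" where
  "chart_index D = insert None (Some ` D)"

lemma finite_chart_index: "finite D \<Longrightarrow> finite (chart_index D)"
  by (simp add: chart_index_def)

lemma card_chart_index: "finite D \<Longrightarrow> card (chart_index D) = card D + 1"
  by (simp add: chart_index_def card_insert_if card_image)

lemma sum_chart_index: "finite D \<Longrightarrow> (\<Sum>i\<in>chart_index D. f i) = f None + (\<Sum>i\<in>D. f (Some i))"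
  by (simp add: chart_index_def sum.insert_if sum.reindex)

lemma affine_chart_subspace: "affine (chart_subspace (D :: 'n::finite set) A)"
  unfolding affine_def
proof (intro ballI allI impI)
  fix x y :: "real ^ 'n" and u v :: real
  assume x: "x \<in> chart_subspace D A" and y: "y \<in> chart_subspace D A" and uv: "u + v = 1"
  have "u * x $ j + v * y $ j = A None j + (\<Sum>i\<in>D. A (Some i) j * (u * x $ i + v * y $ i))"
    if "j \<notin> D" for j
  proof -
    have "u * x $ j + v * y $ j = u * (A None j + (\<Sum>i\<in>D. A (Some i) j * x $ i))
        + v * (A None j + (\<Sum>i\<in>D. A (Some i) j * y $ i))"
      using x y that unfolding chart_subspace_def by simp
    also have "\<dots> = (u + v) * A None j + (\<Sum>i\<in>D. A (Some i) j * (u * x $ i + v * y $ i))"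
      by (simp add: algebra_simps sum_distrib_left sum.distrib)
    finally show ?thesis using uv by simp
  qed
  then show "u *\<^sub>R x + v *\<^sub>R y \<in> chart_subspace D A"
    by (simp add: chart_subspace_def)
qed

lemma subspace_chart_cone: "subspace (chart_cone (D :: 'n::finite set) A)"
  unfolding subspace_def chart_cone_def
  by (auto simp: algebra_simps sum.distrib sum_distrib_left zero_prod_def)

definition chart_base :: "'n set \<Rightarrow> ('n option \<Rightarrow> 'n \<Rightarrow> real) \<Rightarrow> real ^ 'n" where
  "chart_base D A = (\<chi> j. if j \<in> D then 0 else A None j)"

lemma chart_base_mem: "chart_base D A \<in> chart_subspace D A"
  by (simp add: chart_subspace_def chart_base_def)

lemma dim_coordinate_subspace: "dim {y :: real ^ 'n. \<forall>i. i \<notin> D \<longrightarrow> y $ i = 0} = card D"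
proof -
  have "{y :: real ^ 'n. \<forall>i. i \<notin> D \<longrightarrow> y $ i = 0}
      = {y. \<forall>b\<in>Basis. b \<notin> (\<lambda>j. axis j 1) ` D \<longrightarrow> y \<bullet> b = 0}"
    by (force simp: Basis_vec_def inner_axis axis_eq_axis)
  moreover have "card ((\<lambda>j. axis j (1::real) :: real ^ 'n) ` D) = card D"
    by (intro card_image inj_onI) (simp add: axis_eq_axis)
  moreover have "(\<lambda>j. axis j 1) ` D \<subseteq> (Basis :: (real ^ 'n) set)"
    by (auto simp: Basis_vec_def)
  ultimately show ?thesis
    using dim_substandard[of "(\<lambda>j. axis j (1::real) :: real ^ 'n) ` D"] by simp
qed

lemma aff_dim_chart_subspace: "aff_dim (chart_subspace (D :: 'n::finite set) A) = int (card D)"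
proof -
  \<comment> \<open>The parametrisation of the direction space, extended to an injective shear of
    the whole space so that it visibly preserves dimension.\<close>
  define f :: "real ^ 'n \<Rightarrow> real ^ 'n" where
    "f y = (\<chi> j. if j \<in> D then y $ j else y $ j + (\<Sum>i\<in>D. A (Some i) j * y $ i))" for y
  define Z where "Z = {y :: real ^ 'n. \<forall>i. i \<notin> D \<longrightarrow> y $ i = 0}"
  have f_lin: "linear f"
    by (rule linearI) (auto simp: f_def vec_eq_iff algebra_simps sum.distrib sum_distrib_left)
  have f_inj: "inj f"
  proof (rule injI)
    fix x y assume eq: "f x = f y"
    have D: "x $ i = y $ i" if "i \<in> D" for i
      using arg_cong[OF eq, of "\<lambda>z. z $ i"] that by (simp add: f_def)
    have "x $ i = y $ i" if "i \<notin> D" for i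
      using arg_cong[OF eq, of "\<lambda>z. z $ i"] that D by (simp add: f_def)
    then show "x = y" using D by (metis vec_eq_iff)
  qed
  have "(\<lambda>x. x - chart_base D A) ` chart_subspace D A = f ` Z"
  proof (intro equalityI subsetI)
    fix z assume "z \<in> (\<lambda>x. x - chart_base D A) ` chart_subspace D A"
    then obtain x where x: "x \<in> chart_subspace D A" "z = x - chart_base D A" by blast
    define w :: "real ^ 'n" where "w = (\<chi> j. if j \<in> D then x $ j else 0)"
    have "w \<in> Z" by (simp add: Z_def w_def)
    moreover have "z = f w"
      using x by (auto simp: vec_eq_iff f_def w_def chart_base_def chart_subspace_def intro!: sum.cong)
    ultimately show "z \<in> f ` Z" by blast
  next
    fix z assume "z \<in> f ` Z"
    then obtain w where w: "w \<in> Z" "z = f w" by blast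
    have "f w + chart_base D A \<in> chart_subspace D A"
      using w by (auto simp: f_def chart_base_def chart_subspace_def Z_def)
    then show "z \<in> (\<lambda>x. x - chart_base D A) ` chart_subspace D A"
      using w by (intro image_eqI[of _ _ "f w + chart_base D A"]) auto
  qed
  moreover have "dim (f ` Z) = dim Z"
    using f_lin f_inj by (intro dim_image_eq) (auto intro: inj_on_subset)
  moreover have "dim Z = card D"
    unfolding Z_def by (rule dim_coordinate_subspace)
  ultimately show ?thesis
    using aff_dim_eq_dim_subtract[of "chart_base D A" "chart_subspace D A"] chart_base_mem hull_inc
    by metis
qed

lemma chart_subspace_in_affine_subspaces:
  "chart_subspace D A \<in> affine_subspaces (card D)"
  by (simp add: affine_subspaces_def affine_chart_subspace aff_dim_chart_subspace)

text \<open>Steinitz exchange: a basis of the direction space \<open>V\<close> is extended to one of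
  the whole space by coordinate axes, indexed by \<open>E\<close>. By dimensions, \<open>V\<close>
  meets the coordinate subspace \<open>W\<close> of these axes only in \<open>0\<close>, so the
  coordinates in \<open>D = - E\<close> determine a vector of \<open>V\<close>.\<close>

lemma affine_subspace_is_chart:
  fixes L :: "(real ^ 'n) set"
  assumes "L \<in> affine_subspaces d"
  shows "\<exists>D A. card D = d \<and> L = chart_subspace D A"
proof -
  have L: "affine L" "aff_dim L = int d" using assms by (auto simp: affine_subspaces_def)
  then have "L \<noteq> {}" by auto
  then obtain a where a: "a \<in> L" by blast
  define V where "V = (\<lambda>x. x - a) ` L"
  have V: "subspace V" unfolding V_def using affine_diffs_subspace_subtract[OF L(1) a] .
  have dimV: "dim V = d"
    using aff_dim_eq_dim_subtract[of a L] a L hull_inc[of a L] by (simp add: V_def)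
  obtain B where B: "B \<subseteq> V" "independent B" "V \<subseteq> span B" "card B = dim V"
    using basis_exists[of V] by metis
  have spanB: "span B = V" using B V by (simp add: span_subspace)
  obtain B' where B': "B \<subseteq> B'" "B' \<subseteq> B \<union> Basis" "independent B'" "B \<union> Basis \<subseteq> span B'"
    using maximal_independent_subset_extend[of B "B \<union> Basis"] B(2) by blast
  have spanB': "span B' = UNIV"
    using B'(4) span_Basis span_mono[of Basis "span B'"] by (auto simp: span_span)
  have finB': "finite B'" using B'(3) independent_bound by blast
  define E where "E = {j. axis j (1::real) \<in> B' - B}"
  define D where "D = - E"
  have BE: "B' - B = (\<lambda>j. axis j 1) ` E"
    using B'(2) by (auto simp: E_def Basis_vec_def)
  have "card (B' - B) = card E"
    unfolding BE by (intro card_image inj_onI) (simp add: axis_eq_axis)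
  moreover have "card B' = CARD('n)"
    using dim_span_eq_card_independent[OF B'(3)] spanB' by (simp add: dim_UNIV)
  moreover have "card (B' - B) = card B' - card B"
    using B' finB' by (intro card_Diff_subset) (auto intro: finite_subset)
  moreover have "card B \<le> card B'" using B' finB' card_mono by blast
  ultimately have cardE: "card E + d = CARD('n)" using B dimV by simp
  have cardD: "card D = d"
    unfolding D_def Compl_eq_Diff_UNIV using cardE by (simp add: card_Diff_subset)
  define W where "W = {y :: real ^ 'n. \<forall>i. i \<notin> E \<longrightarrow> y $ i = 0}"
  have W: "subspace W" by (auto simp: subspace_def W_def)
  have dimW: "dim W = card E" unfolding W_def by (rule dim_coordinate_subspace)
  have BW: "span (B' - B) \<subseteq> W"
    using W by (intro span_minimal) (auto simp: BE W_def axis_def)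
  have decomp: "\<exists>v\<in>V. \<exists>w\<in>W. x = v + w" for x
  proof -
    have "x \<in> span (B \<union> (B' - B))" using B'(1) spanB' by (simp add: Un_absorb1)
    then show ?thesis unfolding span_Un using spanB BW by blast
  qed
  have "{x + y |x y. x \<in> V \<and> y \<in> W} = UNIV" using decomp by blast
  then have "CARD('n) + dim (V \<inter> W) = d + card E"
    using dim_sums_Int[OF V W] dimV dimW by (simp add: dim_UNIV)
  then have "dim (V \<inter> W) = 0" using cardE by linarith
  then have VW: "V \<inter> W \<subseteq> {0}" by simp
  \<comment> \<open>For \<open>i\<close> in \<open>D\<close> this is the vector of \<open>V\<close>
    lying over the unit vector of the coordinate \<open>i\<close>; it becomes the row
    \<open>Some i\<close> of the matrix.\<close>
  have "\<exists>v\<in>V. \<forall>k\<in>D. v $ k = (if k = i then 1 else 0)" for i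
  proof -
    obtain v w where vw: "v \<in> V" "w \<in> W" "axis i 1 = v + w" using decomp by blast
    have "v $ k = (if k = i then 1 else 0)" if "k \<in> D" for k
    proof -
      have "w $ k = 0" using vw that by (auto simp: W_def D_def)
      then show ?thesis using arg_cong[OF vw(3), of "\<lambda>z. z $ k"] by (auto simp: axis_def)
    qed
    then show ?thesis using vw by blast
  qed
  then obtain v where v: "\<And>i. v i \<in> V" "\<And>i k. k \<in> D \<Longrightarrow> v i $ k = (if k = i then 1 else 0)"
    by metis
  have sum_in: "(\<Sum>i\<in>D. x $ i *\<^sub>R v i) \<in> V" for x :: "real ^ 'n"
    using V v by (intro subspace_sum subspace_scale) auto
  have sum_nth: "(\<Sum>i\<in>D. x $ i *\<^sub>R v i) $ k = x $ k" if "k \<in> D" for x :: "real ^ 'n" and k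
  proof -
    have "(\<Sum>i\<in>D. x $ i *\<^sub>R v i) $ k = (\<Sum>i\<in>D. x $ i * (if k = i then 1 else 0))"
      using v(2) that by simp
    also have "\<dots> = x $ k" using that by (simp add: if_distrib cong: if_cong)
    finally show ?thesis .
  qed
  have repr: "x = (\<Sum>i\<in>D. x $ i *\<^sub>R v i)" if "x \<in> V" for x
  proof -
    have "x - (\<Sum>i\<in>D. x $ i *\<^sub>R v i) \<in> V" using V sum_in that by (simp add: subspace_diff)
    moreover have "x - (\<Sum>i\<in>D. x $ i *\<^sub>R v i) \<in> W"
      using sum_nth by (auto simp: W_def D_def)
    ultimately show ?thesis using VW by auto
  qed
  \<comment> \<open>The point of the subspace whose coordinates in \<open>D\<close> vanish; it
    becomes the row \<open>None\<close>.\<close>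
  define a0 where "a0 = a - (\<Sum>i\<in>D. a $ i *\<^sub>R v i)"
  have a0D: "a0 $ k = 0" if "k \<in> D" for k using sum_nth[OF that] by (simp add: a0_def)
  have memL: "y \<in> L \<longleftrightarrow> y - a0 \<in> V" for y
  proof -
    have "y \<in> L \<longleftrightarrow> y - a \<in> V" unfolding V_def by force
    also have "\<dots> \<longleftrightarrow> y - a0 \<in> V"
    proof -
      have "y - a0 = (y - a) + (\<Sum>i\<in>D. a $ i *\<^sub>R v i)" by (simp add: a0_def)
      moreover from this have "y - a = (y - a0) - (\<Sum>i\<in>D. a $ i *\<^sub>R v i)" by simp
      ultimately show ?thesis
        using subspace_add[OF V _ sum_in[of a]] subspace_diff[OF V _ sum_in[of a]] by metis
    qed
    finally show ?thesis .
  qed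
  define A where "A i j = (case i of None \<Rightarrow> a0 $ j | Some k \<Rightarrow> v k $ j)" for i j
  have "L = chart_subspace D A"
  proof (intro set_eqI iffI)
    fix y assume "y \<in> L"
    then have "y - a0 = (\<Sum>i\<in>D. (y - a0) $ i *\<^sub>R v i)" using memL repr by blast
    also have "\<dots> = (\<Sum>i\<in>D. y $ i *\<^sub>R v i)" using a0D by (intro sum.cong) auto
    finally have "y = a0 + (\<Sum>i\<in>D. y $ i *\<^sub>R v i)" by (simp add: algebra_simps)
    then have eq: "y $ j = (a0 + (\<Sum>i\<in>D. y $ i *\<^sub>R v i)) $ j" for j by (rule arg_cong)
    have "y $ j = A None j + (\<Sum>i\<in>D. A (Some i) j * y $ i)" for j
      by (subst eq) (simp add: A_def mult.commute)
    then show "y \<in> chart_subspace D A" unfolding chart_subspace_def by blast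
  next
    fix y assume y: "y \<in> chart_subspace D A"
    have "y = a0 + (\<Sum>i\<in>D. y $ i *\<^sub>R v i)"
      unfolding vec_eq_iff
    proof
      fix j show "y $ j = (a0 + (\<Sum>i\<in>D. y $ i *\<^sub>R v i)) $ j"
      proof (cases "j \<in> D")
        case True then show ?thesis using sum_nth[OF True, of y] a0D[OF True] by simp
      next
        case False then show ?thesis using y by (simp add: chart_subspace_def A_def mult.commute)
      qed
    qed
    then have "y - a0 = (\<Sum>i\<in>D. y $ i *\<^sub>R v i)" by (simp add: algebra_simps)
    then show "y \<in> L" using memL sum_in by simp
  qed
  then show ?thesis using cardD by blast
qed

lemma homogenization_chart_subspace: "homogenization (chart_subspace D A) = chart_cone D A"
proof
  show "homogenization (chart_subspace D A) \<subseteq> chart_cone D A"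
    unfolding homogenization_def
    by (rule span_minimal[OF _ subspace_chart_cone]) (auto simp: chart_subspace_def chart_cone_def)
  show "chart_cone D A \<subseteq> homogenization (chart_subspace D A)"
  proof clarify
    fix t y assume ty: "(t, y) \<in> chart_cone D A"
    let ?H = "homogenization (chart_subspace D A)"
    have base: "(1, z) \<in> ?H" if "z \<in> chart_subspace D A" for z
      using that by (auto simp: homogenization_def intro: span_base)
    have sub: "subspace ?H" by (simp add: homogenization_def)
    have "y - t *\<^sub>R chart_base D A + chart_base D A \<in> chart_subspace D A"
      using ty by (auto simp: chart_subspace_def chart_cone_def chart_base_def algebra_simps)
    then have "(1, y - t *\<^sub>R chart_base D A + chart_base D A) - (1, chart_base D A)
        + t *\<^sub>R (1, chart_base D A) \<in> ?H"
      using base chart_base_mem sub by (metis subspace_add subspace_diff subspace_scale)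
    then show "(t, y) \<in> ?H" by simp
  qed
qed

section \<open>Comparison of the Grassmannian metric with the chart coordinates\<close>

lemma closest_point_subspace:
  fixes V :: "'a::euclidean_space set"
  assumes V: "subspace V"
  shows "closest_point V x \<in> V" and "w \<in> V \<Longrightarrow> inner (x - closest_point V x) w = 0"
proof -
  have ne: "V \<noteq> {}" "closed V" "convex V"
    using V subspace_0[OF V] by (auto simp: closed_subspace subspace_imp_convex)
  show in_V: "closest_point V x \<in> V" using ne closest_point_in_set by blast
  show "inner (x - closest_point V x) w = 0" if w: "w \<in> V"
  proof -
    have "inner (x - closest_point V x) (y - closest_point V x) \<le> 0" if "y \<in> V" for y
      using ne that by (intro closest_point_dot) auto
    from this[of "closest_point V x + w"] this[of "closest_point V x - w"] show ?thesis
      using in_V w V by (simp add: subspace_add subspace_diff)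
  qed
qed

lemma norm_closest_point_subspace_le:
  fixes V :: "'a::euclidean_space set"
  assumes V: "subspace V"
  shows "norm (closest_point V x) \<le> norm x" and "norm (x - closest_point V x) \<le> norm x"
proof -
  let ?p = "closest_point V x"
  have "orthogonal (x - ?p) ?p"
    using closest_point_subspace[OF V] by (simp add: orthogonal_def)
  then have "(norm x)\<^sup>2 = (norm (x - ?p))\<^sup>2 + (norm ?p)\<^sup>2"
    using norm_add_Pythagorean[of "x - ?p" ?p] by simp
  then have "(norm ?p)\<^sup>2 \<le> (norm x)\<^sup>2" "(norm (x - ?p))\<^sup>2 \<le> (norm x)\<^sup>2" by auto
  then show "norm ?p \<le> norm x" "norm (x - ?p) \<le> norm x"
    by (meson norm_ge_zero power2_le_imp_le)+
qed

text \<open>With \<open>P\<close> and \<open>Q\<close> the two projections,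
  \<open>P - Q = (1 - Q) P - Q (1 - P)\<close>. The first term is bounded by \<open>VW\<close>. For
  the second, \<open>norm (Q z) ^ 2 = inner z (Q z)\<close> with \<open>z\<close> orthogonal to
  \<open>V\<close>, and \<open>WV\<close> allows \<open>Q z\<close> to be replaced by its small
  difference from a vector of \<open>V\<close>.\<close>

lemma norm_orthogonal_projection_diff_le:
  fixes V W :: "'a::euclidean_space set"
  assumes V: "subspace V" and W: "subspace W" and \<epsilon>: "0 \<le> \<epsilon>"
    and VW: "\<And>v. v \<in> V \<Longrightarrow> \<exists>w\<in>W. norm (v - w) \<le> \<epsilon> * norm v"
    and WV: "\<And>w. w \<in> W \<Longrightarrow> \<exists>v\<in>V. norm (w - v) \<le> \<epsilon> * norm w"
  shows "norm (orthogonal_projection V - orthogonal_projection W) \<le> 2 * \<epsilon>"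
proof (rule norm_blinfun_bound)
  show "0 \<le> 2 * \<epsilon>" using \<epsilon> by simp
  fix x
  let ?P = "closest_point V" and ?Q = "closest_point W"
  define z where "z = x - ?P x"
  have z: "norm z \<le> norm x" "\<And>v. v \<in> V \<Longrightarrow> inner z v = 0"
    using norm_closest_point_subspace_le[OF V] closest_point_subspace[OF V] by (auto simp: z_def)
  have Q_lin: "linear ?Q" using bounded_linear_closest_point[OF W] by (rule bounded_linear.linear)
  have 1: "norm (?P x - ?Q (?P x)) \<le> \<epsilon> * norm x"
  proof -
    obtain w where w: "w \<in> W" "norm (?P x - w) \<le> \<epsilon> * norm (?P x)"
      using VW closest_point_subspace(1)[OF V] by blast
    have "dist (?P x) (?Q (?P x)) \<le> dist (?P x) w"
      using w W by (intro closest_point_le) (auto simp: closed_subspace)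
    then have "norm (?P x - ?Q (?P x)) \<le> \<epsilon> * norm (?P x)" using w by (simp add: dist_norm)
    also have "\<dots> \<le> \<epsilon> * norm x"
      using \<epsilon> norm_closest_point_subspace_le(1)[OF V] by (intro mult_left_mono) auto
    finally show ?thesis .
  qed
  have 2: "norm (?Q z) \<le> \<epsilon> * norm x"
  proof (cases "?Q z = 0")
    case False
    obtain v where v: "v \<in> V" "norm (?Q z - v) \<le> \<epsilon> * norm (?Q z)"
      using WV closest_point_subspace(1)[OF W] by blast
    have "inner (z - ?Q z) (?Q z) = 0" using closest_point_subspace[OF W] by blast
    then have "(norm (?Q z))\<^sup>2 = inner z (?Q z)"
      by (simp add: inner_diff_left power2_norm_eq_inner)
    also have "\<dots> = inner z (?Q z - v)" using z(2)[OF v(1)] by (simp add: inner_diff_right)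
    also have "\<dots> \<le> norm z * norm (?Q z - v)" by (rule norm_cauchy_schwarz)
    also have "\<dots> \<le> norm z * (\<epsilon> * norm (?Q z))" using v by (intro mult_left_mono) auto
    finally have "norm (?Q z) * norm (?Q z) \<le> (\<epsilon> * norm z) * norm (?Q z)"
      by (simp add: power2_eq_square mult_ac)
    then have "norm (?Q z) \<le> \<epsilon> * norm z" using False by simp
    also have "\<dots> \<le> \<epsilon> * norm x" using z \<epsilon> by (intro mult_left_mono) auto
    finally show ?thesis .
  qed (use \<epsilon> in auto)
  have "?P x - ?Q x = (?P x - ?Q (?P x)) - ?Q z"
    using linear_diff[OF Q_lin] by (simp add: z_def)
  then have "norm (?P x - ?Q x) \<le> norm (?P x - ?Q (?P x)) + norm (?Q z)"
    using norm_triangle_ineq4 by metis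
  then have "norm (?P x - ?Q x) \<le> \<epsilon> * norm x + \<epsilon> * norm x"
    using 1 2 by linarith
  then show "norm (blinfun_apply (orthogonal_projection V - orthogonal_projection W) x) \<le> 2 * \<epsilon> * norm x"
    by (simp add: blinfun.diff_left orthogonal_projection_apply V W)
qed

text \<open>The vector \<open>w\<close> keeps \<open>t\<close> and the coordinates in
  \<open>D\<close>, which are free, and recomputes the other coordinates with
  \<open>B\<close>.\<close>

lemma chart_cone_approx:
  fixes A B :: "'n::finite option \<Rightarrow> 'n \<Rightarrow> real"
  assumes r: "0 \<le> r" and close: "\<And>i j. i \<in> chart_index D \<Longrightarrow> j \<notin> D \<Longrightarrow> \<bar>A i j - B i j\<bar> \<le> r"
    and v: "v \<in> chart_cone D A"
  shows "\<exists>w\<in>chart_cone D B. norm (v - w) \<le> real CARD('n) * (real CARD('n) + 1) * r * norm v"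
proof -
  obtain t y where ty: "v = (t, y)" by (meson surj_pair)
  define y' :: "real ^ 'n" where
    "y' = (\<chi> j. if j \<in> D then y $ j else t * B None j + (\<Sum>i\<in>D. B (Some i) j * y $ i))"
  have "(t, y') \<in> chart_cone D B" by (auto simp: chart_cone_def y'_def)
  moreover have "norm (v - (t, y')) \<le> real CARD('n) * (real CARD('n) + 1) * r * norm v"
  proof -
    have comp: "\<bar>(y - y') $ j\<bar> \<le> (real CARD('n) + 1) * r * norm v" for j
    proof (cases "j \<in> D")
      case False
      have t: "\<bar>t\<bar> \<le> norm v" using norm_fst_le[of t y] by (simp add: ty)
      have y: "\<bar>y $ i\<bar> \<le> norm v" for i
        using norm_snd_le[of y t] component_le_norm_cart[of y i] by (simp add: ty)
      have "(y - y') $ j = t * (A None j - B None j) + (\<Sum>i\<in>D. (A (Some i) j - B (Some i) j) * y $ i)"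
        using v False by (simp add: ty chart_cone_def y'_def algebra_simps sum_subtractf)
      also have "\<bar>\<dots>\<bar> \<le> \<bar>t * (A None j - B None j)\<bar> + (\<Sum>i\<in>D. \<bar>(A (Some i) j - B (Some i) j) * y $ i\<bar>)"
        by (rule order_trans[OF abs_triangle_ineq add_left_mono[OF sum_abs]])
      also have "\<dots> \<le> norm v * r + (\<Sum>i\<in>D. r * norm v)"
        unfolding abs_mult using r t y False
        by (intro add_mono mult_mono sum_mono close) (auto simp: chart_index_def)
      also have "\<dots> = (real (card D) + 1) * (r * norm v)" by (simp add: algebra_simps)
      also have "\<dots> \<le> (real CARD('n) + 1) * (r * norm v)"
        using r by (intro mult_right_mono) (auto intro!: card_mono)
      finally show ?thesis by (simp add: mult_ac)
    qed (use r in \<open>simp add: y'_def\<close>)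
    have "norm (v - (t, y')) = norm (y - y')" by (simp add: ty norm_Pair)
    also have "\<dots> \<le> (\<Sum>j\<in>UNIV. \<bar>(y - y') $ j\<bar>)" by (rule norm_le_l1_cart)
    also have "\<dots> \<le> (\<Sum>j\<in>(UNIV :: 'n set). (real CARD('n) + 1) * r * norm v)"
      by (rule sum_mono[OF comp])
    finally show ?thesis by (simp add: mult_ac)
  qed
  ultimately show ?thesis by blast
qed

lemma dist_grassmann_chart_le:
  fixes A B :: "'n::finite option \<Rightarrow> 'n \<Rightarrow> real"
  assumes r: "0 \<le> r" and close: "\<And>i j. i \<in> chart_index D \<Longrightarrow> j \<notin> D \<Longrightarrow> \<bar>A i j - B i j\<bar> \<le> r"
  shows "dist (grassmann_point (chart_subspace D A)) (grassmann_point (chart_subspace D B))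
    \<le> 2 * (real CARD('n) * (real CARD('n) + 1)) * r"
proof -
  have "\<bar>B i j - A i j\<bar> \<le> r" if "i \<in> chart_index D" "j \<notin> D" for i j
    using close[OF that] by (simp add: abs_minus_commute)
  note BA = chart_cone_approx[OF r this]
  have "norm (orthogonal_projection (chart_cone D A) - orthogonal_projection (chart_cone D B))
      \<le> 2 * (real CARD('n) * (real CARD('n) + 1) * r)"
    using r by (intro norm_orthogonal_projection_diff_le subspace_chart_cone chart_cone_approx[OF r close] BA) auto
  then show ?thesis
    by (simp add: grassmann_point_def homogenization_chart_subspace dist_norm mult_ac)
qed

text \<open>The converse Lipschitz estimate, on bounded matrices only. Both projections are applied
  to the vector of \<open>chart_cone D A\<close> whose free parameters form the unit vector of index
  \<open>i\<close>. Its coordinate \<open>j\<close> is the entry \<open>A i j\<close>, and its norm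
  is controlled because the entries are bounded.\<close>

lemma chart_coordinate_diff_le:
  fixes A B :: "'n::finite option \<Rightarrow> 'n \<Rightarrow> real"
  assumes A1: "\<And>i j. i \<in> chart_index D \<Longrightarrow> j \<notin> D \<Longrightarrow> \<bar>A i j\<bar> \<le> 1"
    and B1: "\<And>i j. i \<in> chart_index D \<Longrightarrow> j \<notin> D \<Longrightarrow> \<bar>B i j\<bar> \<le> 1"
    and ij: "i \<in> chart_index D" "j \<notin> D"
  shows "\<bar>A i j - B i j\<bar> \<le> (real CARD('n) + 2)\<^sup>2 *
    dist (grassmann_point (chart_subspace D A)) (grassmann_point (chart_subspace D B))"
proof -
  define n where "n = real CARD('n)"
  define \<epsilon> where "\<epsilon> = dist (grassmann_point (chart_subspace D A)) (grassmann_point (chart_subspace D B))"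
  define h where "h k = (if k = i then 1 else 0 :: real)" for k
  define y :: "real ^ 'n" where "y = (\<chi> k. if k \<in> D then h (Some k) else A i k)"
  define w where "w = (h None, y)"
  have sumh: "h None * C None k + (\<Sum>l\<in>D. C (Some l) k * h (Some l)) = C i k" for C :: "'n option \<Rightarrow> 'n \<Rightarrow> real" and k
  proof -
    have "(\<Sum>l\<in>chart_index D. C l k * h l) = C i k"
      using ij by (simp add: h_def finite_chart_index if_distrib cong: if_cong)
    then show ?thesis by (simp add: sum_chart_index mult.commute)
  qed
  have sumy: "(\<Sum>l\<in>D. C (Some l) k * y $ l) = (\<Sum>l\<in>D. C (Some l) k * h (Some l))"
    for C :: "'n option \<Rightarrow> 'n \<Rightarrow> real" and k
    by (intro sum.cong) (auto simp: y_def)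
  have w: "w \<in> chart_cone D A"
    unfolding w_def chart_cone_def using sumh[of A] by (auto simp: sumy) (simp add: y_def)
  have "\<bar>y $ k\<bar> \<le> 1" for k using A1[OF ij(1)] by (auto simp: y_def h_def)
  then have "norm y \<le> n"
    using order_trans[OF norm_le_l1_cart[of y] sum_mono[of UNIV "\<lambda>k. \<bar>y $ k\<bar>" "\<lambda>_. 1"]] by (simp add: n_def)
  then have normw: "norm w \<le> n + 1"
    using norm_Pair_le[of "h None" y] by (auto simp: w_def h_def)
  define u where "u = closest_point (chart_cone D B) w"
  have u: "u \<in> chart_cone D B"
    unfolding u_def by (rule closest_point_subspace(1)[OF subspace_chart_cone])
  obtain s x where sx: "u = (s, x)" by (meson surj_pair)
  have "w = blinfun_apply (grassmann_point (chart_subspace D A)) w"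
    using w by (simp add: grassmann_point_def homogenization_chart_subspace
        orthogonal_projection_apply subspace_chart_cone closest_point_self)
  then have "w - u = blinfun_apply (grassmann_point (chart_subspace D A) - grassmann_point (chart_subspace D B)) w"
    by (simp add: blinfun.diff_left grassmann_point_def homogenization_chart_subspace
        orthogonal_projection_apply subspace_chart_cone u_def)
  then have "norm (w - u) \<le> \<epsilon> * norm w"
    unfolding \<epsilon>_def dist_norm by (metis norm_blinfun)
  also have "\<dots> \<le> \<epsilon> * (n + 1)" using normw by (intro mult_left_mono) (auto simp: \<epsilon>_def)
  finally have wu: "norm (w - u) \<le> \<epsilon> * (n + 1)" .
  have d0: "\<bar>s - h None\<bar> \<le> \<epsilon> * (n + 1)"
    using norm_fst_le[of "h None - s" "y - x"] wu by (simp add: w_def sx)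
  have dk: "\<bar>x $ k - y $ k\<bar> \<le> \<epsilon> * (n + 1)" for k
    using norm_snd_le[of "y - x" "h None - s"] component_le_norm_cart[of "y - x" k] wu
    by (simp add: w_def sx)
  have "A i j - B i j = (y $ j - x $ j) + (x $ j - B i j)" using ij by (simp add: y_def)
  also have "x $ j - B i j = (s - h None) * B None j + (\<Sum>l\<in>D. B (Some l) j * (x $ l - y $ l))"
    using u ij(2) sumh[of B j] sumy[of B j] by (simp add: sx chart_cone_def algebra_simps sum_subtractf)
  finally have "\<bar>A i j - B i j\<bar> \<le> \<bar>x $ j - y $ j\<bar> + (\<bar>(s - h None) * B None j\<bar> + (\<Sum>l\<in>D. \<bar>B (Some l) j * (x $ l - y $ l)\<bar>))"
    using sum_abs[of "\<lambda>l. B (Some l) j * (x $ l - y $ l)" D] by linarith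
  also have "\<dots> \<le> \<epsilon> * (n + 1) + (\<epsilon> * (n + 1) * 1 + (\<Sum>l\<in>D. 1 * (\<epsilon> * (n + 1))))"
    unfolding abs_mult using d0 dk ij(2)
    by (intro add_mono sum_mono mult_mono B1) (auto simp: chart_index_def \<epsilon>_def n_def)
  also have "\<dots> = (2 + real (card D)) * (\<epsilon> * (n + 1))" by (simp add: algebra_simps)
  also have "\<dots> \<le> (n + 2) * (\<epsilon> * (n + 2))"
    by (intro mult_mono mult_left_mono) (auto simp: \<epsilon>_def n_def intro!: card_mono)
  finally show ?thesis by (simp add: \<epsilon>_def n_def power2_eq_square mult_ac)
qed

section \<open>Sufficient condition for extremality\<close>

lemma dist_to_int_less_iff:
  fixes z :: "real ^ 'n"
  shows "dist_to_int z < c \<longleftrightarrow> (\<exists>p. (\<forall>i. p $ i \<in> \<int>) \<and> infnorm (z - p) < c)"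
  unfolding dist_to_int_def
  by (subst cINF_less_iff) (auto intro!: bdd_belowI2[of _ 0] infnorm_pos_le exI[of _ 0])

lemma dist_to_int_nonneg: "0 \<le> dist_to_int (z :: real ^ 'n)"
  unfolding dist_to_int_def
  by (rule cINF_greatest) (auto intro: infnorm_pos_le exI[of _ 0])

lemma approximable_set_antimono:
  assumes "\<tau>' \<le> \<tau>"
  shows "(approximable_set \<tau> :: (real ^ 'n) set) \<subseteq> approximable_set \<tau>'"
proof
  fix y :: "real ^ 'n" assume y: "y \<in> approximable_set \<tau>"
  have "dist_to_int (real q *\<^sub>R y) < real q powr - \<tau>'"
    if "dist_to_int (real q *\<^sub>R y) < real q powr - \<tau>" for q
  proof -
    \<comment> \<open>\<open>0 powr - \<tau> = 0\<close>, so \<open>q = 0\<close> never satisfies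
      the strict inequality.\<close>
    have "q \<noteq> 0" using that dist_to_int_nonneg[of "real q *\<^sub>R y"] by (cases "q = 0") auto
    then have "real q powr - \<tau> \<le> real q powr - \<tau>'" using assms by (intro powr_mono) auto
    then show ?thesis using that by simp
  qed
  then show "y \<in> approximable_set \<tau>'"
    using y unfolding approximable_set_def
    by (auto elim!: infinite_super[rotated])
qed

section \<open>Lebesgue measure on affine subspaces in orthonormal coordinates\<close>

lemma sets_affine_lborel: "sets (affine_lborel L) = sets borel"
  by (simp add: affine_lborel_def Let_def)

lemma affine_lborel_parametrisation:
  fixes L :: "'a::euclidean_space set"
  assumes "affine L" "L \<noteq> {}"
  obtains a B where "a \<in> L" "finite B" "int (card B) = aff_dim L" "orthonormal B"
    "span B = {x - y | x y. x \<in> L \<and> y \<in> L}"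
    "affine_lborel L = distr (\<Pi>\<^sub>M b\<in>B. (lborel :: real measure)) borel (\<lambda>f. a + (\<Sum>b\<in>B. f b *\<^sub>R b))"
proof -
  define a where "a = (SOME a. a \<in> L)"
  define B where "B = (SOME B. orthonormal B \<and> span B = {x - y | x y. x \<in> L \<and> y \<in> L})"
  have a: "a \<in> L" unfolding a_def using assms(2) some_in_eq by blast
  have B: "orthonormal B" "span B = {x - y | x y. x \<in> L \<and> y \<in> L}"
    using someI_ex[OF direction_orthonormal_basis_exists[OF assms]] by (simp_all add: B_def)
  have indep: "independent B"
    using B(1) by (intro pairwise_orthogonal_independent) (auto simp: orthonormal_def)
  then have fin: "finite B" using independent_bound by blast
  have "(\<lambda>x. x - a) ` L = span B"
  proof (intro equalityI subsetI)
    fix z assume "z \<in> (\<lambda>x. x - a) ` L"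
    then show "z \<in> span B" using a B(2) by blast
  next
    fix z assume "z \<in> span B"
    then obtain x y where xy: "x \<in> L" "y \<in> L" "z = x - y" using B(2) by auto
    have "z = (x - a) - (y - a)" using xy by simp
    then show "z \<in> (\<lambda>x. x - a) ` L"
      using subspace_diff[OF affine_diffs_subspace_subtract[OF assms(1) a]] xy by blast
  qed
  then have "aff_dim L = int (dim (span B))"
    using aff_dim_eq_dim_subtract[of a L] hull_inc[OF a] by simp
  then have "int (card B) = aff_dim L"
    using dim_span_eq_card_independent[OF indep] by simp
  then show ?thesis
    using that[of a B] a fin B by (simp add: affine_lborel_def Let_def a_def B_def)
qed

lemma orthonormal_inner_sum:
  assumes "orthonormal B" "finite B" "b \<in> B"
  shows "(\<Sum>b'\<in>B. f b' *\<^sub>R b') \<bullet> b = f b"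
proof -
  have "(\<Sum>b'\<in>B. f b' *\<^sub>R b') \<bullet> b = (\<Sum>b'\<in>B. f b' * (b' \<bullet> b))"
    by (simp add: inner_sum_left)
  also have "\<dots> = (\<Sum>b'\<in>B. if b' = b then f b' else 0)"
  proof (rule sum.cong[OF refl])
    fix b' assume "b' \<in> B"
    then show "f b' * (b' \<bullet> b) = (if b' = b then f b' else 0)"
      using assms by (auto simp: orthonormal_def pairwise_def orthogonal_def norm_eq_1)
  qed
  also have "\<dots> = f b" using assms by simp
  finally show ?thesis .
qed

text \<open>\<open>Y\<close> need not be measurable, so it is enclosed in a Borel set: the points
  whose orthonormal coordinates differ by at most \<open>r\<close> from those of one point of
  \<open>Y\<close>.\<close>

lemma affine_lborel_small_set:
  fixes L :: "'a::euclidean_space set"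
  assumes L: "affine L" "aff_dim L = int d" and Y: "Y \<subseteq> L" and r: "0 \<le> r"
    and small: "\<And>y y'. y \<in> Y \<Longrightarrow> y' \<in> Y \<Longrightarrow> norm (y - y') \<le> r"
  shows "\<exists>Z\<in>sets borel. Y \<subseteq> Z \<and> emeasure (affine_lborel L) Z \<le> ennreal ((2 * r) ^ d)"
proof (cases "Y = {}")
  case False
  then obtain y0 where y0: "y0 \<in> Y" by blast
  have "L \<noteq> {}" using False Y by auto
  then obtain a B where aB: "a \<in> L" "finite B" "int (card B) = aff_dim L" "orthonormal B"
    and eq: "affine_lborel L = distr (\<Pi>\<^sub>M b\<in>B. (lborel :: real measure)) borel (\<lambda>f. a + (\<Sum>b\<in>B. f b *\<^sub>R b))"
    by (rule affine_lborel_parametrisation[OF L(1)]) blast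
  interpret product_sigma_finite "\<lambda>_::'a. lborel :: real measure" by standard
  define Z where "Z = {z. \<forall>b\<in>B. \<bar>(z - y0) \<bullet> b\<bar> \<le> r}"
  have "closed Z"
    unfolding Z_def Ball_def
    by (intro closed_Collect_all closed_Collect_imp open_Collect_const closed_Collect_le continuous_intros)
  then have Z: "Z \<in> sets borel" by simp
  have YZ: "Y \<subseteq> Z"
  proof
    fix y assume y: "y \<in> Y"
    have "\<bar>(y - y0) \<bullet> b\<bar> \<le> r" if "b \<in> B" for b
    proof -
      have "\<bar>(y - y0) \<bullet> b\<bar> \<le> norm (y - y0) * norm b" by (rule Cauchy_Schwarz_ineq2)
      also have "\<dots> \<le> r" using small[OF y y0] aB(4) that by (simp add: orthonormal_def)
      finally show ?thesis .
    qed
    then show "y \<in> Z" by (simp add: Z_def)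
  qed
  define c where "c b = (y0 - a) \<bullet> b" for b
  have vimage: "(\<lambda>f. a + (\<Sum>b\<in>B. f b *\<^sub>R b)) -` Z \<inter> space (\<Pi>\<^sub>M b\<in>B. (lborel :: real measure))
      = (\<Pi>\<^sub>E b\<in>B. {c b - r..c b + r})"
  proof -
    have "\<bar>(a + (\<Sum>b\<in>B. f b *\<^sub>R b) - y0) \<bullet> b\<bar> \<le> r \<longleftrightarrow> f b \<in> {c b - r..c b + r}" if "b \<in> B" for f b
    proof -
      have "(a + (\<Sum>b\<in>B. f b *\<^sub>R b) - y0) \<bullet> b = f b - c b"
        using orthonormal_inner_sum[OF aB(4,2) that, of f]
        by (simp add: c_def inner_diff_left inner_add_left)
      then show ?thesis by auto
    qed
    then show ?thesis unfolding Z_def space_PiM by (auto simp: PiE_iff)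
  qed
  have "emeasure (affine_lborel L) Z = emeasure (\<Pi>\<^sub>M b\<in>B. (lborel :: real measure)) (\<Pi>\<^sub>E b\<in>B. {c b - r..c b + r})"
    unfolding eq by (subst emeasure_distr[OF affine_parametrisation_measurable Z]) (simp add: vimage)
  also have "\<dots> = (\<Prod>b\<in>B. emeasure lborel {c b - r..c b + r})"
    using aB by (intro emeasure_PiM) auto
  also have "\<dots> = ennreal ((2 * r) ^ d)"
    using r aB(3) L(2) by (simp add: ennreal_power)
  finally show ?thesis using Z YZ by auto
qed (auto intro!: bexI[of _ "{}"])

lemma emeasure_affine_lborel_self_neq_0:
  fixes L :: "'a::euclidean_space set"
  assumes L: "affine L" "L \<noteq> {}"
  shows "emeasure (affine_lborel L) L \<noteq> 0"
proof -
  obtain a B where aB: "a \<in> L" "finite B" "span B = {x - y | x y. x \<in> L \<and> y \<in> L}"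
    and eq: "affine_lborel L = distr (\<Pi>\<^sub>M b\<in>B. (lborel :: real measure)) borel (\<lambda>f. a + (\<Sum>b\<in>B. f b *\<^sub>R b))"
    by (rule affine_lborel_parametrisation[OF L]) blast
  interpret product_sigma_finite "\<lambda>_::'a. lborel :: real measure" by standard
  have "a + (\<Sum>b\<in>B. f b *\<^sub>R b) \<in> L" for f
  proof -
    have "(\<Sum>b\<in>B. f b *\<^sub>R b) \<in> span B" by (intro span_sum span_scale span_base)
    then obtain x y where xy: "x \<in> L" "y \<in> L" "(\<Sum>b\<in>B. f b *\<^sub>R b) = x - y" using aB(3) by auto
    have "1 *\<^sub>R a + (1 *\<^sub>R (x - y)) \<in> L"
      using mem_affine_3_minus[OF L(1) aB(1) xy(1,2), of 1] by simp
    then show ?thesis using xy by simp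
  qed
  then have vimage: "(\<lambda>f. a + (\<Sum>b\<in>B. f b *\<^sub>R b)) -` L \<inter> space (\<Pi>\<^sub>M b\<in>B. (lborel :: real measure))
      = space (\<Pi>\<^sub>M b\<in>B. (lborel :: real measure))"
    by auto
  have Lb: "L \<in> sets borel" using affine_closed[OF L(1)] by simp
  have "1 = (\<Prod>b\<in>B. emeasure lborel {0..1::real})" by simp
  also have "\<dots> = emeasure (\<Pi>\<^sub>M b\<in>B. (lborel :: real measure)) (\<Pi>\<^sub>E b\<in>B. {0..1})"
    using aB by (intro emeasure_PiM[symmetric]) auto
  also have "\<dots> \<le> emeasure (\<Pi>\<^sub>M b\<in>B. (lborel :: real measure)) (space (\<Pi>\<^sub>M b\<in>B. (lborel :: real measure)))"
    by (intro emeasure_mono sets.top) (auto simp: space_PiM PiE_iff)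
  also have "\<dots> = emeasure (affine_lborel L) L"
    unfolding eq by (subst emeasure_distr[OF affine_parametrisation_measurable Lb]) (simp add: vimage)
  finally show ?thesis by auto
qed

text \<open>In the application every point of the subspace is approximable, not merely a set of
  positive measure, so it is enough that the subspace itself is not a null set.\<close>

lemma not_extremalI:
  fixes L :: "(real ^ 'n) set"
  assumes "affine L" "L \<noteq> {}" "1 / real CARD('n) < \<tau>" "L \<subseteq> approximable_set \<tau>"
  shows "\<not> extremal L"
  using assms emeasure_affine_lborel_self_neq_0[of L]
  by (auto simp: extremal_def Int_absorb1)

text \<open>Rational points with denominator \<open>q\<close> in
  \<open>{2 ^ k..<2 ^ (k + 1)}\<close> give integer vectors \<open>v = (q, p)\<close> with
  \<open>v A\<close> within order \<open>\<theta> ^ k\<close> of integers, where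
  \<open>\<theta> = 2 powr - \<tau>\<close>. The large sieve leaves about
  \<open>2 ^ (k * (d + 1)) * \<theta> ^ (k * m)\<close> of them. Each accounts for a piece of
  \<open>L\<close> inside a set of measure of order \<open>(\<theta> ^ k / 2 ^ k) ^ d\<close>, and
  the product \<open>2 ^ k * \<theta> ^ (k * n)\<close> is summable because
  \<open>\<tau> > 1 / n\<close>.\<close>

lemma extremal_chart_subspace:
  fixes D :: "'n::finite set" and A :: "'n option \<Rightarrow> 'n \<Rightarrow> real"
  assumes \<omega>: "0 < \<omega>" "\<omega> < real CARD('n)"
    and fin: "\<not> (\<exists>\<^sub>\<infinity>N. well_approx (chart_index D) (- D) A \<omega> N)"
  shows "extremal (chart_subspace D A)"
  unfolding extremal_def
proof (intro allI impI)
  fix \<tau>0 :: real assume \<tau>0: "1 / real CARD('n) < \<tau>0"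
  define n where "n = CARD('n)"
  define I where "I = chart_index D"
  define J where "J = - D"
  define a where "a = card I"
  define d where "d = card D"
  define m where "m = card J"
  define L where "L = chart_subspace D A"
  define \<mu> where "\<mu> = affine_lborel L"
  \<comment> \<open>Lowering \<open>\<tau>0\<close> is harmless since the approximable set only
    grows. It ensures \<open>\<tau> * \<omega> \<le> 1\<close>, by which vectors \<open>b\<close> of
    height at most \<open>2 powr (k * \<tau>)\<close> are separated at scale
    \<open>1 / 2 ^ k\<close> up to a constant.\<close>
  define \<tau> where "\<tau> = min \<tau>0 (1 / \<omega>)"
  have n: "n > 0" by (simp add: n_def)
  have finIJ: "finite I" "finite J" by (simp_all add: I_def J_def finite_chart_index)
  have a: "a = d + 1" by (simp add: a_def d_def I_def card_chart_index)
  have nd: "n = d + m"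
    unfolding n_def d_def m_def J_def Compl_eq_Diff_UNIV
    by (simp add: card_Diff_subset card_mono)
  have \<tau>: "1 / real n < \<tau>" "\<tau> \<le> 1 / \<omega>" "\<tau> \<le> \<tau>0"
    using \<tau>0 \<omega> n by (auto simp: \<tau>_def n_def field_simps)
  have \<tau>pos: "\<tau> > 0" using \<tau>(1) n by (meson divide_pos_pos less_trans of_nat_0_less_iff zero_less_one)
  have \<tau>\<omega>: "\<tau> * \<omega> \<le> 1" using \<tau>(2) \<omega> by (simp add: field_simps)
  have L: "affine L" "aff_dim L = int d"
    by (simp_all add: L_def d_def affine_chart_subspace aff_dim_chart_subspace)
  have sets_\<mu>: "sets \<mu> = sets borel" by (simp add: \<mu>_def sets_affine_lborel)
  obtain c where c: "c > 0" "\<And>N b. N \<ge> 1 \<Longrightarrow> has_height J b N \<Longrightarrow>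
      \<exists>i\<in>I. \<not> near_int (c * real N powr - \<omega>) (lin_forms J A b i)"
    using not_near_int_if_finite_well_approx[OF \<omega>(1) fin] unfolding I_def J_def by metis
  define M where "M = (\<Sum>i\<in>I. \<Sum>j\<in>J. \<bar>A i j\<bar>)"
  have M: "\<bar>A i j\<bar> \<le> M" if "i \<in> I" "j \<in> J" for i j
    unfolding M_def using finIJ that by (rule abs_entry_le_sum)
  have M0: "M \<ge> 0" unfolding M_def by (intro sum_nonneg) auto
  define c2 where "c2 = real n * M + 1"
  have c2: "c2 \<ge> 1" using M0 by (simp add: c2_def)
  define \<theta> where "\<theta> = 2 powr - \<tau>"
  have \<theta>: "0 < \<theta>" "\<theta> < 1" using \<tau>pos powr_less_mono[of "- \<tau>" 0 2] by (simp_all add: \<theta>_def)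
  have \<theta>k: "\<theta> ^ k = (2 ^ k) powr - \<tau>" for k :: nat
    by (simp add: \<theta>_def powr_powr mult.commute flip: powr_realpow)

  have bounded_part: "emeasure \<mu> (approximable_set \<tau> \<inter> L \<inter> {y. \<forall>i. \<bar>y $ i\<bar> \<le> real R}) = 0" for R :: nat
  proof -
    \<comment> \<open>\<open>R + 1\<close> makes room for the numerators of points bounded by
      \<open>R\<close>; \<open>1 / c\<close> absorbs the constant in the lower bound for the linear
      forms.\<close>
    define R' where "R' = R + 1 + nat \<lceil>1 / c\<rceil>"
    have R': "real R + 1 \<le> real R'" "1 / c \<le> real R'" "R' \<ge> 1"
      unfolding R'_def using real_nat_ceiling_ge[of "1 / c"] by auto
    define Q where "Q k = 2 ^ (k + 1) * R'" for k :: nat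
    have Q: "Q k \<ge> 1" for k using R' by (simp add: Q_def)
    define Y where "Y k v = {y \<in> L. (\<forall>i. \<bar>y $ i\<bar> \<le> real R) \<and> (\<exists>q. 2 ^ k \<le> q \<and> q < 2 ^ (k + 1) \<and>
        v None = int q \<and> (\<forall>i\<in>D. \<bar>real q * y $ i - of_int (v (Some i))\<bar> \<le> \<theta> ^ k) \<and>
        (\<forall>j\<in>J. \<exists>p::int. \<bar>real q * y $ j - of_int p\<bar> \<le> \<theta> ^ k))}" for k :: nat and v :: "'n option \<Rightarrow> int"
    define S where "S k = {v \<in> (\<Pi>\<^sub>E i\<in>I. {- int (Q k)..int (Q k)}). Y k v \<noteq> {}}" for k
    have finS: "finite (S k)" for k
      unfolding S_def using finIJ by (auto intro!: finite_Collect_conjI finite_PiE)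
    \<comment> \<open>For \<open>m > 0\<close>, \<open>1 / x k\<close> is the largest height
      \<open>T\<close> for which the large sieve accepts vectors \<open>v\<close> with error
      \<open>c2 * \<theta> ^ k\<close>.\<close>
    define x where "x k = 8 * real m * c2 * \<theta> ^ k" for k :: nat
    have x0: "x k \<ge> 0" for k using c2 \<theta> by (simp add: x_def)
    define T where "T k = nat \<lfloor>1 / x k\<rfloor>" for k
    have T_le: "real (T k) \<le> 1 / x k" for k
      unfolding T_def using x0[of k] by (simp add: of_nat_nat)
    have T_ge: "1 / x k \<le> real (T k + 1)" for k
      unfolding T_def using x0[of k] by linarith
    have cardS: "real (card (S k)) \<le> 4 * 36 ^ a * real (Q k) ^ a * x k ^ m" for k
    proof -
      have "real (card (S k)) * real (T k + 1) ^ card J \<le> 4 * 36 ^ card I * real (Q k) ^ card I"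
      proof (rule card_almost_integer_vectors[OF finIJ Q[of k], of "T k" A])
        show "S k \<subseteq> (\<Pi>\<^sub>E i\<in>I. {- int (Q k)..int (Q k)})" by (auto simp: S_def)
      next
        fix b :: "'n \<Rightarrow> int"
        assume "\<exists>j\<in>J. b j \<noteq> 0" and bT: "\<forall>j\<in>J. \<bar>b j\<bar> \<le> int (T k)"
        then obtain j where j: "j \<in> J" "b j \<noteq> 0" by blast
        obtain N where N: "1 \<le> N" "N \<le> T k" "has_height J b N"
          using has_height_le[of J j b "T k", OF finIJ(2) j] bT by metis
        obtain i where i: "i \<in> I" "\<not> near_int (c * real N powr - \<omega>) (lin_forms J A b i)"
          using c(2)[OF N(1,3)] by blast
        have m1: "m \<ge> 1" using j finIJ unfolding m_def by (metis One_nat_def Suc_leI card_gt_0_iff empty_iff)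
        have "1 * \<theta> ^ k \<le> x k"
          unfolding x_def using m1 c2 \<theta> by (intro mult_right_mono mult_ge1_I) (auto simp: mult_ge1_I)
        then have "1 / x k \<le> 1 / \<theta> ^ k" using \<theta> by (intro divide_left_mono mult_pos_pos) (auto intro: less_le_trans[of 0 "\<theta> ^ k"])
        then have "real N \<le> 1 / \<theta> ^ k" using N T_le[of k] by linarith
        also have "\<dots> = (2 ^ k) powr \<tau>" by (simp add: \<theta>k powr_minus_divide)
        finally have "real N powr \<omega> \<le> ((2 ^ k) powr \<tau>) powr \<omega>"
          using N \<omega> by (intro powr_mono2) auto
        also have "\<dots> = (2 ^ k) powr (\<tau> * \<omega>)" by (simp add: powr_powr)
        also have "\<dots> \<le> (2 ^ k) powr 1" using \<tau>\<omega> by (intro powr_mono) auto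
        finally have N\<omega>: "real N powr \<omega> \<le> 2 ^ k" by simp
        have "1 / real (Q k) \<le> c * (1 / 2 ^ k)"
        proof -
          have "1 \<le> c * real R'" using R'(2) c(1) by (simp add: field_simps)
          then have "1 \<le> c * real R' * 2" by simp
          then show ?thesis using R'(3) by (simp add: Q_def field_simps)
        qed
        also have "\<dots> \<le> c * (1 / real N powr \<omega>)"
          using N\<omega> c(1) N by (intro mult_left_mono divide_left_mono) auto
        also have "\<dots> = c * real N powr - \<omega>" by (simp add: powr_minus_divide)
        finally show "\<exists>i\<in>I. \<not> near_int (1 / real (Q k)) (lin_forms J A b i)"
          using i near_int_mono by blast
      next
        fix v j assume v: "v \<in> S k" and j: "j \<in> J"
        then obtain y q where y: "y \<in> L" and q: "v None = int q"
          "\<forall>i\<in>D. \<bar>real q * y $ i - of_int (v (Some i))\<bar> \<le> \<theta> ^ k"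
          "\<forall>j\<in>J. \<exists>p::int. \<bar>real q * y $ j - of_int p\<bar> \<le> \<theta> ^ k"
          by (auto simp: S_def Y_def)
        obtain p :: int where p: "\<bar>real q * y $ j - of_int p\<bar> \<le> \<theta> ^ k" using q(3) j by blast
        have "y $ j = A None j + (\<Sum>i\<in>D. A (Some i) j * y $ i)"
          using y j by (simp add: L_def chart_subspace_def J_def)
        \<comment> \<open>The entry \<open>v None = q\<close> is exact, so only the errors of the
          coordinates in \<open>D\<close> appear.\<close>
        then have "(\<Sum>i\<in>I. of_int (v i) * A i j) - real q * y $ j
            = (\<Sum>i\<in>D. (of_int (v (Some i)) - real q * y $ i) * A (Some i) j)"
          by (simp add: I_def sum_chart_index q(1) algebra_simps sum_subtractf sum_distrib_left)
        also have "\<bar>\<dots>\<bar> \<le> (\<Sum>i\<in>D. \<bar>(of_int (v (Some i)) - real q * y $ i) * A (Some i) j\<bar>)"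
          by (rule sum_abs)
        also have "\<dots> \<le> (\<Sum>i\<in>D. \<theta> ^ k * M)"
          unfolding abs_mult using q(2) j \<theta>
          by (intro sum_mono mult_mono M) (auto simp: I_def chart_index_def abs_minus_commute)
        also have "\<dots> \<le> real n * (\<theta> ^ k * M)"
          using nd M0 \<theta> by (simp add: d_def mult_right_mono)
        finally have "\<bar>(\<Sum>i\<in>I. of_int (v i) * A i j) - of_int p\<bar> \<le> c2 * \<theta> ^ k"
          using p by (simp add: c2_def algebra_simps)
        then have "8 * real m * real (T k) * \<bar>(\<Sum>i\<in>I. of_int (v i) * A i j) - of_int p\<bar>
            \<le> 8 * real m * real (T k) * (c2 * \<theta> ^ k)"
          by (intro mult_left_mono) auto
        also have "\<dots> = real (T k) * x k" by (simp add: x_def)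
        also have "\<dots> \<le> 1" using T_le[of k] x0[of k] by (cases "x k = 0") (auto simp: field_simps)
        finally show "\<exists>p::int. 8 * real (card J) * real (T k) * \<bar>(\<Sum>i\<in>I. of_int (v i) * A i j) - of_int p\<bar> \<le> 1"
          unfolding m_def by blast
      qed
      then have 1: "real (card (S k)) * real (T k + 1) ^ m \<le> 4 * 36 ^ a * real (Q k) ^ a"
        by (simp add: m_def a_def)
      have 2: "1 \<le> (real (T k + 1) * x k) ^ m"
      proof (cases "m = 0")
        case False
        then have "x k > 0" using c2 \<theta> by (simp add: x_def)
        then have "1 \<le> real (T k + 1) * x k" using T_ge[of k] by (simp add: field_simps)
        then show ?thesis by (rule one_le_power)
      qed simp
      have "real (card (S k)) * 1 \<le> real (card (S k)) * (real (T k + 1) * x k) ^ m"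
        using 2 by (intro mult_left_mono) auto
      also have "\<dots> = real (card (S k)) * real (T k + 1) ^ m * x k ^ m" by (simp add: power_mult_distrib)
      also have "\<dots> \<le> 4 * 36 ^ a * real (Q k) ^ a * x k ^ m"
        using 1 x0[of k] by (intro mult_right_mono) auto
      finally show ?thesis by simp
    qed
    define r where "r k = real n * c2 * 2 * (\<theta> ^ k / 2 ^ k)" for k :: nat
    have r0: "r k \<ge> 0" for k using c2 \<theta> by (simp add: r_def)
    have Ysmall: "norm (y - y') \<le> r k" if y: "y \<in> Y k v" "y' \<in> Y k v" for y y' k v
    proof -
      obtain q where q: "2 ^ k \<le> q" "v None = int q"
          "\<forall>i\<in>D. \<bar>real q * y $ i - of_int (v (Some i))\<bar> \<le> \<theta> ^ k"
          "\<forall>i\<in>D. \<bar>real q * y' $ i - of_int (v (Some i))\<bar> \<le> \<theta> ^ k"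
        using y by (auto simp: Y_def)
      define e where "e = 2 * (\<theta> ^ k / 2 ^ k)"
      have e0: "e \<ge> 0" using \<theta> by (simp add: e_def)
      have qk: "2 ^ k \<le> real q" using q(1) by (metis of_nat_le_iff of_nat_numeral of_nat_power)
      have D: "\<bar>y $ i - y' $ i\<bar> \<le> e" if "i \<in> D" for i
      proof -
        have "real q * \<bar>y $ i - y' $ i\<bar> = \<bar>real q * y $ i - real q * y' $ i\<bar>"
          by (simp add: abs_mult flip: right_diff_distrib)
        also have "\<dots> \<le> 2 * \<theta> ^ k" using q(3,4) that by (smt (verit))
        finally have "real q * \<bar>y $ i - y' $ i\<bar> \<le> 2 * \<theta> ^ k" .
        moreover have "2 ^ k * \<bar>y $ i - y' $ i\<bar> \<le> real q * \<bar>y $ i - y' $ i\<bar>"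
          using qk by (intro mult_right_mono) auto
        ultimately have "2 ^ k * \<bar>y $ i - y' $ i\<bar> \<le> 2 * \<theta> ^ k" by linarith
        then show ?thesis by (simp add: e_def field_simps)
      qed
      have "\<bar>(y - y') $ i\<bar> \<le> c2 * e" for i
      proof (cases "i \<in> D")
        case True
        have "1 * e \<le> c2 * e" using c2 e0 by (intro mult_right_mono) auto
        then show ?thesis using D[OF True] by simp
      next
        case False
        have "(y - y') $ i = (\<Sum>l\<in>D. A (Some l) i * (y $ l - y' $ l))"
          using y False by (simp add: Y_def L_def chart_subspace_def algebra_simps sum_subtractf)
        also have "\<bar>\<dots>\<bar> \<le> (\<Sum>l\<in>D. \<bar>A (Some l) i * (y $ l - y' $ l)\<bar>)" by (rule sum_abs)
        also have "\<dots> \<le> (\<Sum>l\<in>D. M * e)"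
          unfolding abs_mult using D M0 False
          by (intro sum_mono mult_mono M) (auto simp: I_def J_def chart_index_def)
        also have "\<dots> \<le> real n * (M * e)" using nd M0 e0 by (simp add: d_def mult_right_mono)
        also have "\<dots> \<le> c2 * e" using e0 by (simp add: c2_def algebra_simps)
        finally show ?thesis .
      qed
      then have "(\<Sum>i\<in>UNIV. \<bar>(y - y') $ i\<bar>) \<le> (\<Sum>i\<in>(UNIV :: 'n set). c2 * e)" by (rule sum_mono)
      then show ?thesis using norm_le_l1_cart[of "y - y'"] by (simp add: r_def e_def n_def mult_ac)
    qed
    have "\<exists>Z\<in>sets borel. Y k v \<subseteq> Z \<and> emeasure \<mu> Z \<le> ennreal ((2 * r k) ^ d)" for k v
      unfolding \<mu>_def
    proof (rule affine_lborel_small_set[OF L _ r0 Ysmall])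
      show "Y k v \<subseteq> L" by (auto simp: Y_def)
    qed
    then obtain Z where Z: "\<And>k v. Z k v \<in> sets borel" "\<And>k v. Y k v \<subseteq> Z k v"
        "\<And>k v. emeasure \<mu> (Z k v) \<le> ennreal ((2 * r k) ^ d)"
      by metis
    define W where "W k = (\<Union>v\<in>S k. Z k v)" for k
    have W: "W k \<in> sets \<mu>" for k
      unfolding W_def sets_\<mu> using finS Z(1) by (intro sets.finite_UN) auto
    define C where "C = 4 * 36 ^ a * real (2 * R') ^ a * (8 * real m * c2) ^ m * (4 * real n * c2) ^ d"
    \<comment> \<open>The ratio of the geometric series of measures; it equals
      \<open>2 powr (1 - \<tau> * n)\<close>.\<close>
    define \<rho> where "\<rho> = 2 * \<theta> ^ n"
    have \<rho>: "0 < \<rho>" "\<rho> < 1"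
    proof -
      have "1 - \<tau> * real n < 0" using \<tau>(1) n by (simp add: field_simps)
      then have "2 powr (1 - \<tau> * real n) < 2 powr 0" by (intro powr_less_mono) auto
      moreover have "\<theta> ^ n = 2 powr (- \<tau> * real n)"
        unfolding \<theta>_def by (simp add: powr_powr flip: powr_realpow)
      then have "\<rho> = 2 powr (1 - \<tau> * real n)"
        unfolding \<rho>_def by (simp add: powr_diff powr_minus_divide)
      ultimately show "\<rho> < 1" by simp
    qed (use \<theta> in \<open>simp add: \<rho>_def\<close>)
    have C0: "C \<ge> 0" using c2 by (simp add: C_def)
    have eW: "emeasure \<mu> (W k) \<le> ennreal (C * \<rho> ^ k)" for k
    proof -
      have "emeasure \<mu> (W k) \<le> (\<Sum>v\<in>S k. emeasure \<mu> (Z k v))"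
        unfolding W_def using finS Z(1) sets_\<mu> by (intro emeasure_subadditive_finite) auto
      also have "\<dots> \<le> (\<Sum>v\<in>S k. ennreal ((2 * r k) ^ d))" by (intro sum_mono Z)
      also have "\<dots> = ennreal (real (card (S k)) * (2 * r k) ^ d)"
        using r0 by (simp add: ennreal_mult ennreal_of_nat_eq_real_of_nat)
      also have "\<dots> \<le> ennreal (4 * 36 ^ a * real (Q k) ^ a * x k ^ m * (2 * r k) ^ d)"
        using cardS[of k] r0[of k] by (intro ennreal_leI mult_right_mono) auto
      also have "4 * 36 ^ a * real (Q k) ^ a * x k ^ m * (2 * r k) ^ d = C * \<rho> ^ k"
      proof -
        have "real (Q k) ^ a = real (2 * R') ^ a * 2 ^ k * (2 ^ k) ^ d"
          by (simp add: Q_def a power_mult_distrib)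
        moreover have "x k ^ m = (8 * real m * c2) ^ m * (\<theta> ^ k) ^ m" by (simp add: x_def power_mult_distrib)
        moreover have "(2 * r k) ^ d = (4 * real n * c2) ^ d * (\<theta> ^ k) ^ d / (2 ^ k) ^ d"
          by (simp add: r_def power_mult_distrib power_divide flip: power_mult_distrib[of 2 2])
        moreover have "\<rho> ^ k = 2 ^ k * ((\<theta> ^ k) ^ m * (\<theta> ^ k) ^ d)"
          by (simp add: \<rho>_def power_mult_distrib nd flip: power_mult power_add) (simp add: algebra_simps)
        ultimately show ?thesis by (simp add: C_def)
      qed
      finally show ?thesis .
    qed
    have fW: "emeasure \<mu> (W k) < \<infinity>" for k
      using eW[of k] by (auto simp: less_top[symmetric] top_unique)
    have "summable (\<lambda>k. C * \<rho> ^ k)" using \<rho> by (intro summable_mult summable_geometric) auto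
    then have "summable (\<lambda>k. measure \<mu> (W k))"
    proof (rule summable_comparison_test'[where N = 0])
      fix k :: nat
      have "ennreal (measure \<mu> (W k)) \<le> ennreal (C * \<rho> ^ k)"
        using eW[of k] fW[of k] by (simp add: emeasure_eq_ennreal_measure less_top)
      then show "norm (measure \<mu> (W k)) \<le> C * \<rho> ^ k" using C0 \<rho> by (simp add: ennreal_le_iff)
    qed
    then have null: "limsup W \<in> null_sets \<mu>" by (intro borel_cantelli_limsup1 W fW)
    have "approximable_set \<tau> \<inter> L \<inter> {y. \<forall>i. \<bar>y $ i\<bar> \<le> real R} \<subseteq> limsup W"
    proof
      fix y assume y: "y \<in> approximable_set \<tau> \<inter> L \<inter> {y. \<forall>i. \<bar>y $ i\<bar> \<le> real R}"
      have "\<exists>k\<ge>K. y \<in> W k" for K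
      proof -
        have "infinite {q::nat. dist_to_int (real q *\<^sub>R y) < real q powr - \<tau>}"
          using y by (simp add: approximable_set_def)
        then obtain q where q: "q \<ge> 2 ^ K" "dist_to_int (real q *\<^sub>R y) < real q powr - \<tau>"
          unfolding infinite_nat_iff_unbounded_le by blast
        have q1: "q \<ge> 1" using q(1) by (meson le_trans one_le_numeral one_le_power)
        obtain k where k: "2 ^ k \<le> q" "q < 2 ^ (k + 1)"
          using ex_power_ivl1[of 2 q] q1 by auto
        have "(2::nat) ^ K < 2 ^ (k + 1)" using q(1) k(2) by linarith
        then have "K < k + 1" by (meson one_less_numeral_iff power_less_imp_less_exp semiring_norm(76))
        have "real q powr - \<tau> \<le> (2 ^ k) powr - \<tau>"
          using k(1) \<tau>pos by (intro powr_mono2') (auto simp flip: of_nat_le_iff[of "2 ^ k" q])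
        then obtain p where p: "\<And>i. p $ i \<in> \<int>" "infnorm (real q *\<^sub>R y - p) < \<theta> ^ k"
          using q(2) unfolding \<theta>k dist_to_int_less_iff by (meson less_le_trans)
        have pc: "\<bar>real q * y $ i - p $ i\<bar> \<le> \<theta> ^ k" for i
          using component_le_infnorm_cart[of "real q *\<^sub>R y - p" i] p(2) by simp
        have "\<forall>i. \<exists>z::int. p $ i = of_int z" using p(1) by (auto elim: Ints_cases)
        then obtain p' :: "'n \<Rightarrow> int" where p': "\<And>i. p $ i = of_int (p' i)" by metis
        define v where "v = (\<lambda>i\<in>I. case i of None \<Rightarrow> int q | Some l \<Rightarrow> p' l)"
        have vI: "v None = int q" "\<And>l. l \<in> D \<Longrightarrow> v (Some l) = p' l"
          by (auto simp: v_def I_def chart_index_def)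
        have yY: "y \<in> Y k v"
          unfolding Y_def using y k pc p' by (auto simp: vI)
        have "\<bar>v i\<bar> \<le> int (Q k)" if i: "i \<in> I" for i
        proof -
          have "real q \<le> real (2 ^ (k + 1))" using k(2) by (simp only: of_nat_le_iff less_imp_le)
          then have *: "real q * (real R + 1) \<le> real (Q k)"
            using R'(1) unfolding Q_def of_nat_mult by (intro mult_mono) auto
          show ?thesis
          proof (cases i)
            case None
            have "real q * 1 \<le> real q * (real R + 1)" by (intro mult_left_mono) auto
            then show ?thesis using * None vI(1) by simp
          next
            case (Some l)
            then have l: "l \<in> D" using i by (auto simp: I_def chart_index_def)
            have "\<theta> ^ k \<le> 1" using \<theta> by (simp add: power_le_one)
            then have "\<bar>real_of_int (p' l)\<bar> \<le> \<bar>real q * y $ l\<bar> + 1" using pc[of l] p'[of l] by linarith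
            also have "\<bar>real q * y $ l\<bar> \<le> real q * real R"
              unfolding abs_mult using y by (intro mult_mono) auto
            also have "real q * real R + 1 \<le> real q * (real R + 1)" using q1 by (simp add: algebra_simps)
            finally have "\<bar>real_of_int (p' l)\<bar> \<le> real (Q k)" using * by linarith
            then have "\<bar>p' l\<bar> \<le> int (Q k)" by linarith
            then show ?thesis using Some vI(2)[OF l] by simp
          qed
        qed
        then have "v \<in> (\<Pi>\<^sub>E i\<in>I. {- int (Q k)..int (Q k)})"
          by (auto simp: PiE_iff v_def abs_le_iff minus_le_iff)
        then have "v \<in> S k" using yY by (auto simp: S_def)
        then have "y \<in> W k" unfolding W_def using Z(2) yY by blast
        then show ?thesis using \<open>K < k + 1\<close> by (intro exI[of _ k]) auto
      qed
      then show "y \<in> limsup W" by (auto simp: limsup_INF_SUP)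
    qed
    from emeasure_mono[OF this null_setsD2[OF null]] show ?thesis
      by (simp add: null_setsD1[OF null])
  qed
  have Lb: "L \<in> sets borel" using affine_closed[OF L(1)] by simp
  have "emeasure \<mu> (\<Union>R::nat. approximable_set \<tau> \<inter> L \<inter> {y. \<forall>i. \<bar>y $ i\<bar> \<le> real R}) = 0"
  proof (rule emeasure_UN_eq_0)
    have "closed {y :: real ^ 'n. \<forall>i. \<bar>y $ i\<bar> \<le> real R}" for R
      by (intro closed_Collect_all closed_Collect_le continuous_intros)
    then show "range (\<lambda>R::nat. approximable_set \<tau> \<inter> L \<inter> {y. \<forall>i. \<bar>y $ i\<bar> \<le> real R}) \<subseteq> sets \<mu>"
      unfolding sets_\<mu> using Lb approximable_set_borel by (auto intro!: sets.Int)
  qed (rule bounded_part)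
  also have "(\<Union>R::nat. approximable_set \<tau> \<inter> L \<inter> {y. \<forall>i. \<bar>y $ i\<bar> \<le> real R}) = approximable_set \<tau> \<inter> L"
  proof -
    have "\<exists>R::nat. \<forall>i. \<bar>y $ i\<bar> \<le> real R" for y :: "real ^ 'n"
      using real_arch_simple[of "norm y"] component_le_norm_cart[of y] by (meson order_trans)
    then show ?thesis by auto
  qed
  finally have "emeasure \<mu> (approximable_set \<tau> \<inter> L) = 0" .
  moreover have "emeasure \<mu> (approximable_set \<tau>0 \<inter> L) \<le> emeasure \<mu> (approximable_set \<tau> \<inter> L)"
    using approximable_set_antimono[OF \<tau>(3)] Lb approximable_set_borel
    by (intro emeasure_mono) (auto simp: sets_\<mu>)
  ultimately show "emeasure (affine_lborel (chart_subspace D A)) (approximable_set \<tau>0 \<inter> chart_subspace D A) = 0"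
    by (simp add: \<mu>_def L_def)
qed

section \<open>Sufficient condition for non-extremality\<close>

lemma infnorm_le_if_components_le:
  fixes x :: "real ^ 'n"
  assumes "\<And>i. \<bar>x $ i\<bar> \<le> c"
  shows "infnorm x \<le> c"
  unfolding infnorm_cart using assms by (intro cSup_least) auto

lemma dist_to_int_scale_le:
  fixes z :: "real ^ 'n"
  shows "dist_to_int (real k *\<^sub>R z) \<le> real k * dist_to_int z"
proof (rule ccontr)
  assume *: "\<not> ?thesis"
  then have "k \<noteq> 0"
    using dist_to_int_less_iff[of "0 :: real ^ 'n" "dist_to_int (0 :: real ^ 'n)"]
    by (cases "k = 0") (auto simp: not_le infnorm_0 dest: spec[of _ 0])
  then have "dist_to_int z < dist_to_int (real k *\<^sub>R z) / real k" using * by (simp add: field_simps)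
  then obtain p where p: "\<forall>i. p $ i \<in> \<int>" "infnorm (z - p) < dist_to_int (real k *\<^sub>R z) / real k"
    unfolding dist_to_int_less_iff by blast
  have "real k *\<^sub>R z - real k *\<^sub>R p = real k *\<^sub>R (z - p)" by (simp add: algebra_simps)
  then have "infnorm (real k *\<^sub>R z - real k *\<^sub>R p) = real k * infnorm (z - p)" by (simp add: infnorm_mul)
  also have "\<dots> < dist_to_int (real k *\<^sub>R z)" using p(2) \<open>k \<noteq> 0\<close> by (simp add: field_simps)
  finally have "dist_to_int (real k *\<^sub>R z) < dist_to_int (real k *\<^sub>R z)"
    using p(1) unfolding dist_to_int_less_iff[of "real k *\<^sub>R z"]
    by (intro exI[of _ "real k *\<^sub>R p"]) auto
  then show False by simp
qed

text \<open>If some distance is \<open>0\<close>, all multiples of that \<open>q\<close> belong to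
  the set of solutions. Otherwise finitely many solutions would leave a positive least distance,
  which is contradicted by taking it as \<open>\<eta>\<close>.\<close>

lemma approximable_setI:
  fixes y :: "real ^ 'n"
  assumes "\<And>\<eta>. 0 < \<eta> \<Longrightarrow> \<exists>q\<ge>1. dist_to_int (real q *\<^sub>R y) < \<eta> \<and> dist_to_int (real q *\<^sub>R y) < real q powr - \<tau>"
  shows "y \<in> approximable_set \<tau>"
proof (rule ccontr)
  define F where "F = {q::nat. dist_to_int (real q *\<^sub>R y) < real q powr - \<tau>}"
  assume "y \<notin> approximable_set \<tau>"
  then have fin: "finite F" by (simp add: approximable_set_def F_def)
  show False
  proof (cases "\<exists>q\<ge>1. dist_to_int (real q *\<^sub>R y) = 0")
    case True
    then obtain q where q: "q \<ge> 1" "dist_to_int (real q *\<^sub>R y) = 0" by blast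
    have "(\<lambda>k. Suc k * q) ` UNIV \<subseteq> F"
    proof clarify
      fix k
      have "dist_to_int (real (Suc k) *\<^sub>R (real q *\<^sub>R y)) \<le> real (Suc k) * dist_to_int (real q *\<^sub>R y)"
        by (rule dist_to_int_scale_le)
      also have "real (Suc k) *\<^sub>R (real q *\<^sub>R y) = real (Suc k * q) *\<^sub>R y"
        unfolding of_nat_mult by (rule scaleR_scaleR)
      finally have "dist_to_int (real (Suc k * q) *\<^sub>R y) \<le> 0" using q(2) by simp
      also have "Suc k * q > 0" using q(1) by simp
      then have "0 < real (Suc k * q) powr - \<tau>" by (metis less_irrefl of_nat_0_less_iff powr_gt_zero)
      finally show "Suc k * q \<in> F" unfolding F_def by blast
    qed
    moreover have "inj (\<lambda>k. Suc k * q)" using q by (intro injI) auto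
    ultimately show False using fin by (meson finite_imageD finite_subset infinite_UNIV_nat)
  next
    case False
    define \<eta> where "\<eta> = Min (insert 1 ((\<lambda>q. dist_to_int (real q *\<^sub>R y)) ` (F \<inter> {1..})))"
    have "dist_to_int (real q *\<^sub>R y) > 0" if "q \<ge> 1" for q
      using False that dist_to_int_nonneg[of "real q *\<^sub>R y"] by (metis less_eq_real_def)
    then have "\<eta> > 0" unfolding \<eta>_def using fin by (subst Min_gr_iff) auto
    then obtain q where q: "q \<ge> 1" "dist_to_int (real q *\<^sub>R y) < \<eta>" "dist_to_int (real q *\<^sub>R y) < real q powr - \<tau>"
      using assms by blast
    then have "\<eta> \<le> dist_to_int (real q *\<^sub>R y)"
      unfolding \<eta>_def using fin by (intro Min_le) (auto simp: F_def)
    then show False using q by simp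
  qed
qed

text \<open>Pigeonhole for \<open>q\<close> in \<open>{0..Q}\<close>, with cells of size
  \<open>1 / M\<close> for the fractional parts of all coordinates but \<open>j0\<close>. Near the
  hyperplane the form \<open>l\<close> of the fractional parts is within \<open>1\<close> of the
  integer \<open>u q\<close>, which takes only \<open>O(N)\<close> values. Equality of
  \<open>u\<close> replaces a cell for the coordinate \<open>j0\<close>, which is recovered through
  its coefficient of size \<open>N\<close>. So this coordinate costs a factor of order
  \<open>N\<close> where the ordinary Dirichlet argument would pay \<open>M\<close>.\<close>

lemma approximation_in_nearby_rational_hyperplane:
  fixes y :: "real ^ 'n" and w :: "'n \<Rightarrow> int" and p0 :: int
  assumes N: "N \<ge> 1" and c3: "c3 \<ge> 1" and w: "\<And>k. \<bar>real_of_int (w k)\<bar> \<le> c3 * real N"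
    and j0: "\<bar>w j0\<bar> = int N"
    and near: "\<bar>(\<Sum>k\<in>UNIV. of_int (w k) * y $ k) - of_int p0\<bar> \<le> \<epsilon>"
    and c4: "real CARD('n) * c3 + 1 \<le> real c4" and M: "M \<ge> 1"
    and Q: "Q = (2 * (c4 * N) + 1) * M ^ (CARD('n) - 1)" and Q\<epsilon>: "real Q * \<epsilon> \<le> 1"
  shows "\<exists>q\<ge>1. q \<le> Q \<and> (\<exists>p. (\<forall>i. p $ i \<in> \<int>) \<and>
    infnorm (real q *\<^sub>R y - p) \<le> 2 * real Q * \<epsilon> / real N + real CARD('n) * c3 / real M)"
proof -
  define n where "n = real CARD('n)"
  define l where "l z = (\<Sum>k\<in>UNIV. of_int (w k) * z k)" for z :: "'n \<Rightarrow> real"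
  define f where "f q k = frac (real q * y $ k)" for q :: nat and k
  define u where "u q = int q * p0 - (\<Sum>k\<in>UNIV. w k * \<lfloor>real q * y $ k\<rfloor>)" for q :: nat
  define g where "g q = (\<lambda>k\<in>UNIV - {j0}. nat \<lfloor>real M * f q k\<rfloor>)" for q
  have \<epsilon>0: "\<epsilon> \<ge> 0" using near by linarith
  have lu: "l (f q) - of_int (u q) = real q * (l (($) y) - of_int p0)" for q
    by (simp add: l_def f_def u_def frac_def algebra_simps sum_subtractf sum_distrib_left)
  have lu_le: "\<bar>l (f q) - of_int (u q)\<bar> \<le> real Q * \<epsilon>" if "q \<le> Q" for q
    unfolding lu abs_mult using near that by (intro mult_mono) (auto simp: l_def)
  have u_le: "\<bar>u q\<bar> \<le> int (c4 * N)" if q: "q \<le> Q" for q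
  proof -
    have "\<bar>l (f q)\<bar> \<le> (\<Sum>k\<in>UNIV. \<bar>of_int (w k) * f q k\<bar>)" unfolding l_def by (rule sum_abs)
    also have "\<dots> \<le> (\<Sum>k\<in>(UNIV::'n set). c3 * real N * 1)"
      unfolding abs_mult using w c3
      by (intro sum_mono mult_mono) (auto simp: f_def frac_lt_1 less_imp_le)
    also have "\<dots> = n * c3 * real N" by (simp add: n_def)
    finally have "\<bar>real_of_int (u q)\<bar> \<le> n * c3 * real N + 1"
      using lu_le[OF q] Q\<epsilon> by linarith
    also have "\<dots> \<le> (n * c3 + 1) * real N" using N by (simp add: algebra_simps)
    also have "\<dots> \<le> real c4 * real N" using c4 by (intro mult_right_mono) (auto simp: n_def)
    finally show ?thesis by (metis of_int_abs of_int_le_iff of_int_of_nat_eq of_nat_mult)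
  qed
  define T where "T = {- int (c4 * N)..int (c4 * N)} \<times> (\<Pi>\<^sub>E k\<in>UNIV - {j0}. {..<M})"
  have finT: "finite T" unfolding T_def by (intro finite_cartesian_product finite_PiE) auto
  have cardT: "card T = Q"
    unfolding T_def Q card_cartesian_product
    by (subst card_PiE) (auto simp: nat_add_distrib nat_mult_distrib card_Diff_singleton)
  have "(\<lambda>q. (u q, g q)) ` {..Q} \<subseteq> T"
  proof clarify
    fix q assume "q \<le> Q"
    have "nat \<lfloor>real M * f q k\<rfloor> < M" for k
    proof -
      have "real M * f q k < real M * 1" using M by (intro mult_strict_left_mono) (auto simp: f_def frac_lt_1)
      then show ?thesis using M by linarith
    qed
    then show "(u q, g q) \<in> T"
      unfolding T_def using u_le[OF \<open>q \<le> Q\<close>] by (auto simp: g_def abs_le_iff)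
  qed
  then have "card ((\<lambda>q. (u q, g q)) ` {..Q}) \<le> Q" using finT card_mono cardT by metis
  then have "\<not> inj_on (\<lambda>q. (u q, g q)) {..Q}" by (intro pigeonhole) simp
  then obtain q1 q2 where "q1 \<le> Q" "q2 \<le> Q" "q1 \<noteq> q2" "u q1 = u q2" "g q1 = g q2"
    unfolding inj_on_def by auto
  then have "\<exists>q1 q2. q1 < q2 \<and> q2 \<le> Q \<and> u q1 = u q2 \<and> g q1 = g q2"
    by (metis linorder_neqE_nat)
  then obtain q1 q2 where q: "q1 < q2" "q2 \<le> Q" "u q1 = u q2" "g q1 = g q2" by blast
  define z where "z k = f q2 k - f q1 k" for k
  have zk: "\<bar>z k\<bar> \<le> 1 / real M" if "k \<noteq> j0" for k
  proof -
    have "nat \<lfloor>real M * f q1 k\<rfloor> = nat \<lfloor>real M * f q2 k\<rfloor>"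
      using fun_cong[OF q(4), of k] that by (simp add: g_def)
    moreover have "0 \<le> real M * f q k" for q by (simp add: f_def)
    ultimately have "\<lfloor>real M * f q1 k\<rfloor> = \<lfloor>real M * f q2 k\<rfloor>" by (subst (asm) eq_nat_nat_iff) auto
    then have "\<bar>real M * f q2 k - real M * f q1 k\<bar> \<le> 1" by linarith
    then have "real M * \<bar>z k\<bar> \<le> 1" by (simp add: z_def abs_mult flip: right_diff_distrib)
    then show ?thesis using M by (simp add: field_simps)
  qed
  have "l z = l (f q2) - l (f q1)" by (simp add: l_def z_def algebra_simps sum_subtractf)
  then have lz: "\<bar>l z\<bar> \<le> 2 * (real Q * \<epsilon>)"
    using lu_le[of q1] lu_le[of q2] q by (smt (verit) less_imp_le le_trans)
  have zj0: "\<bar>z j0\<bar> \<le> 2 * real Q * \<epsilon> / real N + n * c3 / real M"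
  proof -
    have "l z = of_int (w j0) * z j0 + (\<Sum>k\<in>UNIV - {j0}. of_int (w k) * z k)"
      unfolding l_def by (rule sum.remove) auto
    moreover have "\<bar>\<Sum>k\<in>UNIV - {j0}. of_int (w k) * z k\<bar> \<le> n * (c3 * real N * (1 / real M))"
    proof -
      have "\<bar>\<Sum>k\<in>UNIV - {j0}. of_int (w k) * z k\<bar> \<le> (\<Sum>k\<in>UNIV - {j0}. \<bar>of_int (w k) * z k\<bar>)" by (rule sum_abs)
      also have "\<dots> \<le> (\<Sum>k\<in>UNIV - {j0}. c3 * real N * (1 / real M))"
        unfolding abs_mult using w zk c3 by (intro sum_mono mult_mono) auto
      also have "\<dots> = real (card (UNIV - {j0})) * (c3 * real N * (1 / real M))" by simp
      also have "\<dots> \<le> n * (c3 * real N * (1 / real M))"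
        unfolding n_def using c3 by (intro mult_right_mono of_nat_mono card_mono) auto
      finally show ?thesis .
    qed
    ultimately have "\<bar>of_int (w j0) * z j0\<bar> \<le> 2 * (real Q * \<epsilon>) + n * (c3 * real N * (1 / real M))"
      using lz by linarith
    moreover have "\<bar>real_of_int (w j0)\<bar> = real N" using j0 by (metis of_int_abs of_int_of_nat_eq)
    ultimately have "real N * \<bar>z j0\<bar> \<le> 2 * (real Q * \<epsilon>) + n * (c3 * real N * (1 / real M))"
      by (simp add: abs_mult)
    then show ?thesis using N M by (simp add: field_simps)
  qed
  define p :: "real ^ 'n" where "p = (\<chi> k. of_int (\<lfloor>real q2 * y $ k\<rfloor> - \<lfloor>real q1 * y $ k\<rfloor>))"
  have comp: "(real (q2 - q1) *\<^sub>R y - p) $ k = z k" for k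
    using q(1) by (simp add: p_def z_def f_def frac_def of_nat_diff algebra_simps)
  have "1 / real M \<le> 2 * real Q * \<epsilon> / real N + n * c3 / real M"
  proof -
    have "n \<ge> 1" by (simp add: n_def Suc_leI)
    then have "1 * 1 \<le> n * c3" using c3 by (intro mult_mono) auto
    then have "1 / real M \<le> n * c3 / real M" by (intro divide_right_mono) auto
    moreover have "0 \<le> 2 * real Q * \<epsilon> / real N" using \<epsilon>0 by simp
    ultimately show ?thesis by linarith
  qed
  then have "infnorm (real (q2 - q1) *\<^sub>R y - p) \<le> 2 * real Q * \<epsilon> / real N + n * c3 / real M"
    using zk zj0 by (intro infnorm_le_if_components_le) (metis comp order_trans)
  moreover have "\<forall>i. p $ i \<in> \<int>" by (simp add: p_def)
  ultimately show ?thesis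
    using q unfolding n_def by (intro exI[of _ "q2 - q1"]) auto
qed

text \<open>The hyperplane lemma is applied with \<open>H\<close>, about
  \<open>N powr (1 + \<kappa>)\<close>, cells per coordinate. This gives \<open>q \<le> Q\<close>,
  with \<open>Q\<close> of order \<open>N powr e\<close>, and an error of order
  \<open>N powr - (1 + \<kappa>)\<close>. The resulting exponent \<open>(1 + \<kappa>) / e\<close>
  exceeds \<open>1 / n\<close>, and \<open>\<tau>\<close> is put between them. The choice of
  \<open>\<kappa>\<close> keeps \<open>e - \<omega>\<close> negative, so that the hyperplane is
  still close after multiplication by \<open>Q\<close>.\<close>

lemma not_extremal_chart_subspace:
  fixes D :: "'n::finite set" and A :: "'n option \<Rightarrow> 'n \<Rightarrow> real"
  assumes \<omega>: "real CARD('n) < \<omega>"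
    and inf: "\<exists>\<^sub>\<infinity>N. well_approx (chart_index D) (- D) A \<omega> N"
  shows "\<not> extremal (chart_subspace D A)"
proof -
  define n where "n = real CARD('n)"
  define I where "I = chart_index D"
  define J where "J = - D"
  define L where "L = chart_subspace D A"
  have n1: "n \<ge> 1" by (simp add: n_def Suc_leI)
  have finIJ: "finite I" "finite J" by (simp_all add: I_def J_def finite_chart_index)
  define \<kappa> where "\<kappa> = (\<omega> - n) / (2 * n)"
  have \<kappa>: "\<kappa> > 0" using \<omega> n1 by (simp add: \<kappa>_def n_def)
  have \<omega>\<kappa>: "n + \<kappa> * n \<le> \<omega>" using \<omega> n1 by (simp add: \<kappa>_def n_def field_simps)
  define e where "e = n + \<kappa> * (n - 1)"
  have e1: "e > 0" using \<kappa> n1 by (simp add: e_def add_pos_nonneg)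
  have e\<omega>: "e - \<omega> \<le> - \<kappa>" using \<omega>\<kappa> by (simp add: e_def algebra_simps)
  define \<tau> where "\<tau> = (1 / n + (1 + \<kappa>) / e) / 2"
  have "1 / n < (1 + \<kappa>) / e" using e1 n1 \<kappa> by (simp add: field_simps e_def)
  moreover have "x < (x + z) / 2 \<and> (x + z) / 2 < z" if "x < z" for x z :: real
    using that by simp
  ultimately have \<tau>: "1 / n < \<tau>" "\<tau> < (1 + \<kappa>) / e" unfolding \<tau>_def by blast+
  have \<tau>0: "\<tau> > 0" using \<tau>(1) n1 by (smt (verit) divide_pos_pos)
  have \<tau>e: "\<tau> * e < 1 + \<kappa>" using \<tau>(2) e1 by (simp add: field_simps)
  define M where "M = (\<Sum>i\<in>I. \<Sum>j\<in>J. \<bar>A i j\<bar>)"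
  have M: "\<bar>A i j\<bar> \<le> M" if "i \<in> I" "j \<in> J" for i j
    unfolding M_def using finIJ that by (rule abs_entry_le_sum)
  have M0: "M \<ge> 0" unfolding M_def by (intro sum_nonneg) auto
  define c3 where "c3 = n * M + 1"
  have c3: "c3 \<ge> 1" using M0 n1 by (simp add: c3_def)
  define c4 where "c4 = nat \<lceil>n * c3 + 1\<rceil>"
  have c4: "n * c3 + 1 \<le> real c4" unfolding c4_def by (rule real_nat_ceiling_ge)
  have c4': "1 \<le> real c4" using c4 n1 c3 by (smt (verit) mult_nonneg_nonneg)
  define c5 where "c5 = 3 * real c4 * 2 ^ (CARD('n) - 1)"
  have c5: "c5 > 0" using c4' by (simp add: c5_def)
  have "y \<in> approximable_set \<tau>" if y: "y \<in> L" for y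
  proof (rule approximable_setI)
    fix \<eta> :: real assume \<eta>: "0 < \<eta>"
    \<comment> \<open>The subspace may be unbounded, so the constants depend on the point
      \<open>y\<close>, and \<open>N\<close> is chosen after it.\<close>
    define cy where "cy = 1 + (\<Sum>i\<in>D. \<bar>y $ i\<bar>)"
    have cy: "cy \<ge> 1" by (simp add: cy_def sum_nonneg)
    define c6 where "c6 = 2 * c5 * cy + n * c3"
    have c6: "c6 > 0" using c5 cy n1 c3 by (simp add: c6_def add_pos_pos)
    have "eventually (\<lambda>N. c5 * cy * real N powr - \<kappa> < 1) sequentially"
      using \<kappa> by real_asymp
    moreover have "eventually (\<lambda>N. c6 * real N powr - (1 + \<kappa>) < \<eta>) sequentially"
      using \<kappa> \<eta> by real_asymp
    moreover have "eventually (\<lambda>N. c6 * real N powr - (1 + \<kappa>) < (c5 * real N powr e) powr - \<tau>) sequentially"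
    proof -
      have "eventually (\<lambda>N. c6 * real N powr - (1 + \<kappa> - \<tau> * e) < c5 powr - \<tau>) sequentially"
        using \<tau>e c5 by real_asymp
      then show ?thesis
        using eventually_gt_at_top[of 0]
      proof eventually_elim
        case (elim N)
        have "c6 * real N powr - (1 + \<kappa>) = (c6 * real N powr - (1 + \<kappa> - \<tau> * e)) * real N powr (- \<tau> * e)"
          by (simp add: powr_add[symmetric])
        also have "\<dots> < c5 powr - \<tau> * real N powr (- \<tau> * e)"
          using elim by (intro mult_strict_right_mono) auto
        also have "\<dots> = (c5 * real N powr e) powr - \<tau>"
          using c5 by (simp add: powr_mult powr_powr mult.commute)
        finally show ?case .
      qed
    qed
    moreover have "eventually (\<lambda>N::nat. N \<ge> 1) sequentially" by (rule eventually_ge_at_top)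
    ultimately have "eventually (\<lambda>N. N \<ge> 1 \<and> c5 * cy * real N powr - \<kappa> < 1 \<and>
        c6 * real N powr - (1 + \<kappa>) < \<eta> \<and> c6 * real N powr - (1 + \<kappa>) < (c5 * real N powr e) powr - \<tau>) sequentially"
      by eventually_elim blast
    from frequently_ex[OF frequently_eventually_conj[OF inf[unfolded cofinite_eq_sequentially] this]]
    obtain N where wa: "well_approx I J A \<omega> N" and N: "N \<ge> 1"
      and N1: "c5 * cy * real N powr - \<kappa> < 1" and N2: "c6 * real N powr - (1 + \<kappa>) < \<eta>"
      and N3: "c6 * real N powr - (1 + \<kappa>) < (c5 * real N powr e) powr - \<tau>"
      unfolding I_def J_def by blast
    obtain b where b: "has_height J b N" and near: "\<forall>i\<in>I. near_int (real N powr - \<omega>) (lin_forms J A b i)"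
      using wa by (auto simp: well_approx_def)
    from near obtain p where p: "\<And>i. i \<in> I \<Longrightarrow> \<bar>lin_forms J A b i - of_int (p i)\<bar> < real N powr - \<omega>"
      unfolding near_int_def by metis
    obtain j0 where j0: "j0 \<in> J" "\<bar>b j0\<bar> = int N" and ble: "\<And>j. j \<in> J \<Longrightarrow> \<bar>b j\<bar> \<le> int N"
      using b by (auto simp: has_height_def)
    have ble': "\<bar>real_of_int (b j)\<bar> \<le> real N" if "j \<in> J" for j
      using ble[OF that] by (metis of_int_abs of_int_le_iff of_int_of_nat_eq)
    \<comment> \<open>Substituting the equations of the subspace turns the form \<open>w\<close>
      minus \<open>p None\<close> into the pairing of \<open>A b - p\<close> with the vector formed
      by \<open>1\<close> and the coordinates of \<open>y\<close> in \<open>D\<close>, which is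
      small.\<close>
    define w where "w k = (if k \<in> D then - p (Some k) else b k)" for k
    have "\<omega> > 0" using \<omega> by (smt (verit) of_nat_0_le_iff)
    have N\<omega>1: "real N powr - \<omega> \<le> 1"
      using N \<open>\<omega> > 0\<close> by (simp add: powr_minus_divide ge_one_powr_ge_zero)
    have w_le: "\<bar>real_of_int (w k)\<bar> \<le> c3 * real N" for k
    proof (cases "k \<in> D")
      case False
      then have "\<bar>real_of_int (w k)\<bar> \<le> 1 * real N" using ble'[of k] by (simp add: w_def J_def)
      also have "\<dots> \<le> c3 * real N" using c3 by (intro mult_right_mono) auto
      finally show ?thesis .
    next
      case True
      then have i: "Some k \<in> I" by (simp add: I_def chart_index_def)
      have "\<bar>lin_forms J A b (Some k)\<bar> \<le> (\<Sum>j\<in>J. \<bar>A (Some k) j * of_int (b j)\<bar>)"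
        unfolding lin_forms_def by (rule sum_abs)
      also have "\<dots> \<le> (\<Sum>j\<in>J. M * real N)"
        unfolding abs_mult using ble' M[OF i] M0 by (intro sum_mono mult_mono) auto
      also have "\<dots> \<le> n * (M * real N)"
        unfolding n_def sum_constant using M0 by (intro mult_right_mono of_nat_mono card_mono) auto
      finally have "\<bar>real_of_int (p (Some k))\<bar> \<le> n * M * real N + 1"
        using p[OF i] N\<omega>1 by linarith
      also have "\<dots> \<le> c3 * real N" using N by (simp add: c3_def algebra_simps)
      finally show ?thesis using True by (simp add: w_def)
    qed
    define \<epsilon> where "\<epsilon> = cy * real N powr - \<omega>"
    have \<epsilon>: "\<bar>(\<Sum>k\<in>UNIV. of_int (w k) * y $ k) - of_int (p None)\<bar> \<le> \<epsilon>"
    proof -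
      have yj: "y $ j = A None j + (\<Sum>i\<in>D. A (Some i) j * y $ i)" if "j \<in> J" for j
        using y that by (simp add: L_def chart_subspace_def J_def)
      have "(\<Sum>k\<in>UNIV. of_int (w k) * y $ k) = (\<Sum>k\<in>D. of_int (w k) * y $ k) + (\<Sum>k\<in>J. of_int (w k) * y $ k)"
        unfolding J_def Compl_eq_Diff_UNIV
        by (subst sum.subset_diff[of D UNIV]) (auto simp: add.commute)
      also have "(\<Sum>k\<in>D. of_int (w k) * y $ k) = - (\<Sum>i\<in>D. of_int (p (Some i)) * y $ i)"
        by (simp add: w_def sum_negf)
      also have "(\<Sum>k\<in>J. of_int (w k) * y $ k)
          = (\<Sum>j\<in>J. A None j * of_int (b j) + (\<Sum>i\<in>D. A (Some i) j * of_int (b j) * y $ i))"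
        by (intro sum.cong refl)
          (auto simp: w_def J_def yj[unfolded J_def] algebra_simps sum_distrib_left)
      also have "\<dots> = lin_forms J A b None + (\<Sum>i\<in>D. lin_forms J A b (Some i) * y $ i)"
        unfolding lin_forms_def sum.distrib sum_distrib_right
        by (subst sum.swap[of _ D J]) simp
      finally have "(\<Sum>k\<in>UNIV. of_int (w k) * y $ k) - of_int (p None)
          = (lin_forms J A b None - of_int (p None)) + (\<Sum>i\<in>D. (lin_forms J A b (Some i) - of_int (p (Some i))) * y $ i)"
        by (simp add: algebra_simps sum_subtractf)
      also have "\<bar>\<dots>\<bar> \<le> \<bar>lin_forms J A b None - of_int (p None)\<bar>
          + (\<Sum>i\<in>D. \<bar>(lin_forms J A b (Some i) - of_int (p (Some i))) * y $ i\<bar>)"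
        by (rule order_trans[OF abs_triangle_ineq add_left_mono[OF sum_abs]])
      also have "\<dots> \<le> real N powr - \<omega> + (\<Sum>i\<in>D. real N powr - \<omega> * \<bar>y $ i\<bar>)"
        unfolding abs_mult
        by (intro add_mono sum_mono mult_right_mono less_imp_le[OF p]) (auto simp: I_def chart_index_def)
      also have "(\<Sum>i\<in>D. real N powr - \<omega> * \<bar>y $ i\<bar>) = real N powr - \<omega> * (cy - 1)"
        unfolding cy_def by (simp add: sum_distrib_left)
      also have "real N powr - \<omega> + real N powr - \<omega> * (cy - 1) = \<epsilon>"
        by (simp add: \<epsilon>_def algebra_simps)
      finally show ?thesis .
    qed
    define H where "H = nat \<lceil>real N powr (1 + \<kappa>)\<rceil>"
    have N\<kappa>: "real N powr (1 + \<kappa>) \<ge> 1" using N \<kappa> by (simp add: ge_one_powr_ge_zero)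
    have H: "real N powr (1 + \<kappa>) \<le> real H" "real H \<le> 2 * real N powr (1 + \<kappa>)"
      using N\<kappa> unfolding H_def by (auto simp: of_nat_nat) linarith
    have H1: "H \<ge> 1" using H(1) N\<kappa> by linarith
    define Q where "Q = (2 * (c4 * N) + 1) * H ^ (CARD('n) - 1)"
    have Q_le: "real Q \<le> c5 * real N powr e"
    proof -
      have "real Q = (2 * (real c4 * real N) + 1) * real H ^ (CARD('n) - 1)"
        unfolding Q_def of_nat_mult of_nat_power of_nat_add by simp
      also have "\<dots> \<le> (3 * real c4 * real N) * (2 * real N powr (1 + \<kappa>)) ^ (CARD('n) - 1)"
      proof (intro mult_mono power_mono H)
        have "1 * 1 \<le> real c4 * real N" using c4' N by (intro mult_mono) auto
        then show "2 * (real c4 * real N) + 1 \<le> 3 * real c4 * real N" by linarith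
      qed auto
      also have "\<dots> = c5 * (real N powr 1 * (real N powr (1 + \<kappa>)) ^ (CARD('n) - 1))"
        using N by (simp add: c5_def power_mult_distrib)
      also have "(real N powr (1 + \<kappa>)) ^ (CARD('n) - 1) = real N powr ((1 + \<kappa>) * (n - 1))"
        using N n1 by (subst powr_realpow[symmetric]) (auto simp: powr_powr n_def of_nat_diff Suc_leI)
      also have "real N powr 1 * real N powr ((1 + \<kappa>) * (n - 1)) = real N powr e"
        unfolding powr_add[symmetric] by (simp add: e_def algebra_simps)
      finally show ?thesis .
    qed
    have Q\<epsilon>: "real Q * \<epsilon> \<le> c5 * cy * real N powr - \<kappa>"
    proof -
      have "real Q * \<epsilon> \<le> c5 * real N powr e * \<epsilon>" using Q_le cy by (intro mult_right_mono) (auto simp: \<epsilon>_def)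
      also have "\<dots> = c5 * cy * real N powr (e - \<omega>)" by (simp add: \<epsilon>_def powr_diff powr_minus_divide)
      also have "\<dots> \<le> c5 * cy * real N powr - \<kappa>"
        using e\<omega> N c5 cy by (intro mult_left_mono powr_mono) auto
      finally show ?thesis .
    qed
    have "\<bar>w j0\<bar> = int N" using j0 by (simp add: w_def J_def)
    then obtain q P where q: "q \<ge> 1" "q \<le> Q" "\<forall>i. P $ i \<in> \<int>"
      "infnorm (real q *\<^sub>R y - P) \<le> 2 * real Q * \<epsilon> / real N + n * c3 / real H"
      using approximation_in_nearby_rational_hyperplane[OF N c3 w_le _ \<epsilon> _ H1 Q_def, of j0] c4 Q\<epsilon> N1
      unfolding n_def by fastforce
    have "2 * real Q * \<epsilon> / real N + n * c3 / real H \<le> c6 * real N powr - (1 + \<kappa>)"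
    proof -
      have "2 * real Q * \<epsilon> / real N \<le> 2 * (c5 * cy * real N powr - \<kappa>) / real N"
        using Q\<epsilon> by (intro divide_right_mono) auto
      also have "\<dots> = 2 * c5 * cy * real N powr - (1 + \<kappa>)"
        using N by (simp add: powr_diff powr_minus_divide mult.commute)
      finally have 1: "2 * real Q * \<epsilon> / real N \<le> 2 * c5 * cy * real N powr - (1 + \<kappa>)" .
      have "n * c3 / real H \<le> n * c3 / real N powr (1 + \<kappa>)"
        using H H1 N n1 c3 by (intro divide_left_mono mult_pos_pos) auto
      also have "\<dots> = n * c3 * real N powr - (1 + \<kappa>)" by (subst powr_minus_divide) simp
      finally show ?thesis using 1 by (simp add: c6_def algebra_simps)
    qed
    then have le: "infnorm (real q *\<^sub>R y - P) \<le> c6 * real N powr - (1 + \<kappa>)" using q(4) by linarith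
    have "(c5 * real N powr e) powr - \<tau> \<le> real q powr - \<tau>"
      using q Q_le \<tau>0 by (intro powr_mono2') auto
    then have "infnorm (real q *\<^sub>R y - P) < \<eta>" "infnorm (real q *\<^sub>R y - P) < real q powr - \<tau>"
      using le N2 N3 by linarith+
    then show "\<exists>q\<ge>1. dist_to_int (real q *\<^sub>R y) < \<eta> \<and> dist_to_int (real q *\<^sub>R y) < real q powr - \<tau>"
      unfolding dist_to_int_less_iff using q by blast
  qed
  then show ?thesis
    using \<tau>(1) chart_base_mem[of D A]
    by (intro not_extremalI[of _ \<tau>] affine_chart_subspace) (auto simp: L_def n_def)
qed

section \<open>Well approximable columns outside a thin family of boxes\<close>

lemma maximal_separated_subset:
  assumes "finite Z" and sym: "\<And>x y. C x y \<Longrightarrow> C y x" and refl: "\<And>x. C x x"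
  shows "\<exists>X\<subseteq>Z. (\<forall>x\<in>X. \<forall>y\<in>X. x \<noteq> y \<longrightarrow> \<not> C x y) \<and> (\<forall>z\<in>Z. \<exists>x\<in>X. C z x)"
  using assms(1)
proof (induction Z rule: finite_induct)
  case (insert z Z)
  then obtain X where X: "X \<subseteq> Z" "\<forall>x\<in>X. \<forall>y\<in>X. x \<noteq> y \<longrightarrow> \<not> C x y" "\<forall>z\<in>Z. \<exists>x\<in>X. C z x"
    by blast
  show ?case
  proof (cases "\<exists>x\<in>X. C z x")
    case True
    then show ?thesis using X by (intro exI[of _ X]) auto
  next
    case False
    then show ?thesis
      using X refl by (intro exI[of _ "insert z X"] conjI) (auto dest: sym)
  qed
qed auto

text \<open>Subadditivity of Lebesgue measure; it will turn a covering by boxes around resonant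
  points into a lower bound for the number of these points.\<close>

lemma box_cover_volume:
  fixes c :: "'i \<Rightarrow> real" and x :: "'k \<Rightarrow> 'i \<Rightarrow> real"
  assumes I: "finite I" and K: "finite K" and r: "0 \<le> r" "\<And>k. k \<in> K \<Longrightarrow> 0 \<le> s k"
    and cover: "\<And>\<alpha>. (\<And>i. i \<in> I \<Longrightarrow> \<bar>\<alpha> i - c i\<bar> \<le> r) \<Longrightarrow> \<exists>k\<in>K. \<forall>i\<in>I. \<bar>\<alpha> i - x k i\<bar> \<le> s k"
  shows "(2 * r) ^ card I \<le> (\<Sum>k\<in>K. (2 * s k) ^ card I)"
proof -
  interpret product_sigma_finite "\<lambda>_::'i. lborel :: real measure" by standard
  define M where "M = (\<Pi>\<^sub>M i\<in>I. (lborel :: real measure))"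
  define B where "B y u = (\<Pi>\<^sub>E i\<in>I. {y i - u..y i + u})" for y :: "'i \<Rightarrow> real" and u
  have sets: "B y u \<in> sets M" for y u
    unfolding B_def M_def using I by (intro sets_PiM_I_finite) auto
  have vol: "emeasure M (B y u) = ennreal ((2 * u) ^ card I)" if "u \<ge> 0" for y u
  proof -
    have "emeasure M (B y u) = (\<Prod>i\<in>I. emeasure lborel {y i - u..y i + u})"
      unfolding B_def M_def using I by (intro emeasure_PiM) auto
    also have "\<dots> = ennreal ((2 * u) ^ card I)" using that by (simp add: ennreal_power)
    finally show ?thesis .
  qed
  have "B c r \<subseteq> (\<Union>k\<in>K. B (x k) (s k))"
  proof
    fix \<alpha> assume \<alpha>: "\<alpha> \<in> B c r"
    have "\<bar>\<alpha> i - c i\<bar> \<le> r" if "i \<in> I" for i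
      using PiE_mem[OF \<alpha>[unfolded B_def] that] by auto
    from cover[OF this] obtain k where k: "k \<in> K" "\<forall>i\<in>I. \<bar>\<alpha> i - x k i\<bar> \<le> s k" by blast
    have "\<alpha> i \<in> {x k i - s k..x k i + s k}" if "i \<in> I" for i
      using k(2) that by (auto simp: abs_le_iff dest!: bspec)
    then have "\<alpha> \<in> B (x k) (s k)"
      using \<alpha> unfolding B_def by (auto simp: PiE_iff)
    then show "\<alpha> \<in> (\<Union>k\<in>K. B (x k) (s k))" using k(1) by blast
  qed
  then have "emeasure M (B c r) \<le> emeasure M (\<Union>k\<in>K. B (x k) (s k))"
    using sets K by (intro emeasure_mono) auto
  also have "\<dots> \<le> (\<Sum>k\<in>K. emeasure M (B (x k) (s k)))"
    using sets K by (intro emeasure_subadditive_finite) auto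
  also have "\<dots> = (\<Sum>k\<in>K. ennreal ((2 * s k) ^ card I))"
    using r(2) by (intro sum.cong refl vol) auto
  also have "\<dots> = ennreal (\<Sum>k\<in>K. (2 * s k) ^ card I)"
    using r(2) by (intro sum_ennreal) auto
  finally have "ennreal ((2 * r) ^ card I) \<le> ennreal (\<Sum>k\<in>K. (2 * s k) ^ card I)"
    using vol[OF r(1)] by simp
  then show ?thesis using r by (subst (asm) ennreal_le_iff) (auto intro!: sum_nonneg)
qed

lemma card_separated_in_box:
  assumes I: "finite I" and \<Delta>: "0 < \<Delta>" and s: "0 \<le> s"
    and sep: "\<And>x y. x \<in> X \<Longrightarrow> y \<in> X \<Longrightarrow> x \<noteq> y \<Longrightarrow> \<exists>i\<in>I. \<Delta> < \<bar>x i - y i\<bar>"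
    and box: "\<And>x i. x \<in> X \<Longrightarrow> i \<in> I \<Longrightarrow> \<bar>x i - u i\<bar> \<le> s"
  shows "real (card X) \<le> (2 * s / \<Delta> + 1) ^ card I"
proof -
  define G where "G = nat \<lfloor>2 * s / \<Delta>\<rfloor>"
  define f where "f x = (\<lambda>i\<in>I. nat \<lfloor>(x i - (u i - s)) / \<Delta>\<rfloor>)" for x
  have nonneg: "0 \<le> (x i - (u i - s)) / \<Delta>" if "x \<in> X" "i \<in> I" for x i
    using box[OF that] \<Delta> by (intro divide_nonneg_pos) linarith+
  have "inj_on f X"
  proof (rule inj_onI, rule ccontr)
    fix x y assume xy: "x \<in> X" "y \<in> X" "f x = f y" "x \<noteq> y"
    obtain i where i: "i \<in> I" "\<Delta> < \<bar>x i - y i\<bar>" using sep xy by blast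
    have "nat \<lfloor>(x i - (u i - s)) / \<Delta>\<rfloor> = nat \<lfloor>(y i - (u i - s)) / \<Delta>\<rfloor>"
      using fun_cong[OF xy(3), of i] i by (simp add: f_def)
    then have "\<lfloor>(x i - (u i - s)) / \<Delta>\<rfloor> = \<lfloor>(y i - (u i - s)) / \<Delta>\<rfloor>"
      using nonneg[OF xy(1) i(1)] nonneg[OF xy(2) i(1)] by (subst (asm) eq_nat_nat_iff) auto
    then have "\<bar>(x i - (u i - s)) / \<Delta> - (y i - (u i - s)) / \<Delta>\<bar> \<le> 1" by linarith
    moreover have "(x i - (u i - s)) / \<Delta> - (y i - (u i - s)) / \<Delta> = (x i - y i) / \<Delta>"
      by (simp add: diff_divide_distrib)
    ultimately have "\<bar>x i - y i\<bar> \<le> \<Delta>" using \<Delta> by (simp add: abs_divide)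
    then show False using i by simp
  qed
  moreover have "f ` X \<subseteq> (\<Pi>\<^sub>E i\<in>I. {..G})"
  proof clarify
    fix x assume x: "x \<in> X"
    have "nat \<lfloor>(x i - (u i - s)) / \<Delta>\<rfloor> \<le> G" if i: "i \<in> I" for i
    proof -
      have "(x i - (u i - s)) / \<Delta> \<le> 2 * s / \<Delta>"
        using box[OF x i] \<Delta> by (intro divide_right_mono) linarith+
      then show ?thesis unfolding G_def by (intro nat_mono floor_mono)
    qed
    then show "f x \<in> (\<Pi>\<^sub>E i\<in>I. {..G})" by (auto simp: f_def)
  qed
  ultimately have "card X \<le> card (\<Pi>\<^sub>E i\<in>I. {..G})"
    using I by (intro card_inj_on_le finite_PiE) auto
  also have "\<dots> = (G + 1) ^ card I" using I by (simp add: card_PiE)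
  finally have "real (card X) \<le> real (G + 1) ^ card I" by (metis of_nat_le_iff of_nat_power)
  also have "\<dots> \<le> (2 * s / \<Delta> + 1) ^ card I"
    unfolding G_def using s \<Delta> by (intro power_mono) (auto simp: of_nat_nat)
  finally show ?thesis .
qed

section \<open>Thin families of boxes\<close>

definition meets :: "'i set \<Rightarrow> ('i \<Rightarrow> real) \<Rightarrow> real \<Rightarrow> ('i \<Rightarrow> real) \<Rightarrow> real \<Rightarrow> bool" where
  "meets I u r c \<rho> \<longleftrightarrow> (\<forall>i\<in>I. \<bar>u i - c i\<bar> \<le> r + \<rho>)"

text \<open>The invariant of the nested construction. It scales like a \<open>t\<close>-dimensional
  content, so the same \<open>\<kappa>\<close> can be kept at every scale. Quantifying over finite
  subfamilies expresses the bound for an infinite family without a convergence hypothesis.\<close>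

definition thin_in_box ::
  "'i set \<Rightarrow> 'l set \<Rightarrow> ('l \<Rightarrow> 'i \<Rightarrow> real) \<Rightarrow> ('l \<Rightarrow> real) \<Rightarrow> real \<Rightarrow> real \<Rightarrow> ('i \<Rightarrow> real) \<Rightarrow> real \<Rightarrow> bool" where
  "thin_in_box I \<Lambda> u r t \<kappa> c \<rho> \<longleftrightarrow>
    (\<forall>F. finite F \<and> F \<subseteq> {l \<in> \<Lambda>. meets I (u l) (r l) c \<rho>} \<longrightarrow> (\<Sum>l\<in>F. r l powr t) \<le> \<kappa> * \<rho> powr t)"

text \<open>
  Suppose every box \<open>(x, \<rho>')\<close> meets a family \<open>F x\<close> of total weight more than \<open>\<kappa> * \<rho>' powr t\<close>. The
  members of radius less than \<open>\<rho>'\<close> belong to one \<open>F x\<close> only, since the points \<open>x\<close> are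
  \<open>\<Delta>\<close>-separated, so few \<open>x\<close> have only such members. A member of radius \<open>r l \<ge> \<rho>'\<close> meets
  \<open>O(1 + (r l / \<Delta>)^a)\<close> of the boxes, where \<open>a = card I\<close>, and \<open>r l ^ a\<close> is controlled by
  \<open>r l powr t * \<rho> powr (a - t)\<close>.
\<close>

lemma thin_sub_box_exists:
  fixes u :: "'l \<Rightarrow> 'i \<Rightarrow> real"
  assumes I: "finite I" "I \<noteq> {}" and t: "0 < t" "t \<le> 1"
    and r: "\<And>l. l \<in> \<Lambda> \<Longrightarrow> 0 < r l" and \<rho>: "0 < \<rho>" "0 < \<rho>'" "\<rho>' \<le> \<rho> / 4"
    and \<Delta>: "4 * \<rho>' \<le> \<Delta>"
    and X: "finite X" "\<And>x i. x \<in> X \<Longrightarrow> i \<in> I \<Longrightarrow> \<bar>x i - c i\<bar> \<le> 3 * \<rho> / 4"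
    and sep: "\<And>x y. x \<in> X \<Longrightarrow> y \<in> X \<Longrightarrow> x \<noteq> y \<Longrightarrow> \<exists>i\<in>I. \<Delta> < \<bar>x i - y i\<bar>"
    and \<kappa>: "\<kappa> = 1 / (8 * 32 ^ card I)"
    and cardX: "\<rho> ^ card I / (2 * 4 ^ card I * \<Delta> ^ card I) \<le> real (card X)"
    and large: "2 ^ (card I + 1) * (\<rho> powr t / \<rho>' powr t) < \<rho> ^ card I / (4 * 4 ^ card I * \<Delta> ^ card I)"
    and thin: "thin_in_box I \<Lambda> u r t \<kappa> c \<rho>"
  shows "\<exists>x\<in>X. thin_in_box I \<Lambda> u r t \<kappa> x \<rho>'"
proof (rule ccontr)
  assume "\<not> ?thesis"
  then have "\<forall>x\<in>X. \<exists>F. finite F \<and> F \<subseteq> {l \<in> \<Lambda>. meets I (u l) (r l) x \<rho>'} \<and>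
      \<kappa> * \<rho>' powr t < (\<Sum>l\<in>F. r l powr t)"
    unfolding thin_in_box_def by (auto simp: not_le)
  from bchoice[OF this] obtain F where F: "\<And>x. x \<in> X \<Longrightarrow> finite (F x)"
    "\<And>x. x \<in> X \<Longrightarrow> F x \<subseteq> {l \<in> \<Lambda>. meets I (u l) (r l) x \<rho>'}"
    "\<And>x. x \<in> X \<Longrightarrow> \<kappa> * \<rho>' powr t < (\<Sum>l\<in>F x. r l powr t)"
    by blast
  define a where "a = card I"
  have a1: "a \<ge> 1" using I by (simp add: a_def Suc_leI card_gt_0_iff)
  have \<Delta>0: "\<Delta> > 0" using \<Delta> \<rho> by simp
  have \<kappa>0: "0 < \<kappa>" "\<kappa> < 1" proof -
    have "(1::real) \<le> 32 ^ card I" by (rule one_le_power) simp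
    then have "(1::real) < 8 * 32 ^ card I" by linarith
    then show "0 < \<kappa>" "\<kappa> < 1" by (simp_all add: \<kappa> divide_less_eq)
  qed
  define G where "G = (\<Union>x\<in>X. F x)"
  have finG: "finite G" using F(1) X(1) by (simp add: G_def)
  have G_sub: "G \<subseteq> {l \<in> \<Lambda>. meets I (u l) (r l) c \<rho>}"
  proof
    fix l assume "l \<in> G"
    then obtain x where x: "x \<in> X" "l \<in> F x" by (auto simp: G_def)
    then have l: "l \<in> \<Lambda>" "\<And>i. i \<in> I \<Longrightarrow> \<bar>u l i - x i\<bar> \<le> r l + \<rho>'"
      using F(2) by (auto simp: meets_def)
    have "\<bar>u l i - c i\<bar> \<le> r l + \<rho>" if i: "i \<in> I" for i
      using l(2)[OF i] X(2)[OF x(1) i] \<rho>(3) by linarith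
    then show "l \<in> {l \<in> \<Lambda>. meets I (u l) (r l) c \<rho>}" using l(1) by (simp add: meets_def)
  qed
  then have sumG: "(\<Sum>l\<in>G. r l powr t) \<le> \<kappa> * \<rho> powr t"
    using thin finG unfolding thin_in_box_def by blast
  have rG: "0 < r l" if "l \<in> G" for l using that G_sub r by blast
  have r_less: "r l \<le> \<rho>" if l: "l \<in> G" for l
  proof (rule ccontr)
    assume "\<not> r l \<le> \<rho>"
    then have "\<rho> powr t \<le> r l powr t" using \<rho> t by (intro powr_mono2) auto
    also have "\<dots> \<le> (\<Sum>l\<in>G. r l powr t)" using l finG by (intro member_le_sum) auto
    finally have "1 * \<rho> powr t \<le> \<kappa> * \<rho> powr t" using sumG by simp
    then show False using \<kappa>0 \<rho> by (simp add: mult_le_cancel_right)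
  qed
  define Gl where "Gl = {l \<in> G. \<rho>' \<le> r l}"
  define X1 where "X1 = {x \<in> X. \<exists>l\<in>F x. \<rho>' \<le> r l}"
  define X2 where "X2 = X - X1"
  have X12: "X = X1 \<union> X2" "X1 \<inter> X2 = {}" by (auto simp: X1_def X2_def)
  have finX12: "finite X1" "finite X2" using X(1) by (auto simp: X1_def X2_def)
  have X2: "r l < \<rho>'" if "x \<in> X2" "l \<in> F x" for x l
    using that by (auto simp: X1_def X2_def not_le[symmetric])
  have disj: "F x \<inter> F y = {}" if "x \<in> X2" "y \<in> X2" "x \<noteq> y" for x y
  proof (rule ccontr)
    assume "F x \<inter> F y \<noteq> {}"
    then obtain l where l: "l \<in> F x" "l \<in> F y" by blast
    have xy: "x \<in> X" "y \<in> X" and rl: "r l < \<rho>'" using that X2 l by (auto simp: X2_def)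
    from sep[OF xy that(3)] obtain i where i: "i \<in> I" "\<Delta> < \<bar>x i - y i\<bar>" by blast
    have "\<bar>u l i - x i\<bar> \<le> r l + \<rho>'" "\<bar>u l i - y i\<bar> \<le> r l + \<rho>'"
      using F(2) xy l i(1) by (auto simp: meets_def)
    then show False using i(2) rl \<Delta> by linarith
  qed
  have "real (card X2) * (\<kappa> * \<rho>' powr t) = (\<Sum>x\<in>X2. \<kappa> * \<rho>' powr t)" by simp
  also have "\<dots> \<le> (\<Sum>x\<in>X2. \<Sum>l\<in>F x. r l powr t)"
    using F(3) by (intro sum_mono) (auto simp: X2_def less_imp_le)
  also have "\<dots> = (\<Sum>l\<in>(\<Union>x\<in>X2. F x). r l powr t)"
    using finX12 F(1) disj by (subst sum.UNION_disjoint) (auto simp: X2_def)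
  also have "\<dots> \<le> (\<Sum>l\<in>G. r l powr t)"
    using finG by (intro sum_mono2) (auto simp: G_def X2_def)
  also have "\<dots> \<le> \<kappa> * \<rho> powr t" by (rule sumG)
  finally have card2: "real (card X2) \<le> \<rho> powr t / \<rho>' powr t"
    using \<kappa>0 \<rho> by (simp add: field_simps)
  have card_l: "real (card {x \<in> X. meets I (u l) (r l) x \<rho>'}) \<le> 2 ^ a * ((4 * r l / \<Delta>) ^ a + 1)"
    if l: "l \<in> Gl" for l
  proof -
    have rl: "\<rho>' \<le> r l" "0 < r l" using l rG by (auto simp: Gl_def)
    have "real (card {x \<in> X. meets I (u l) (r l) x \<rho>'}) \<le> (2 * (2 * r l) / \<Delta> + 1) ^ card I"
    proof (rule card_separated_in_box[OF I(1) \<Delta>0, of "2 * r l" _ "u l"])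
      fix x i assume "x \<in> {x \<in> X. meets I (u l) (r l) x \<rho>'}" "i \<in> I"
      then have "\<bar>u l i - x i\<bar> \<le> r l + \<rho>'" by (auto simp: meets_def)
      then show "\<bar>x i - u l i\<bar> \<le> 2 * r l" using rl by linarith
    qed (use sep rl in auto)
    also have "\<dots> \<le> (2 * max (4 * r l / \<Delta>) 1) ^ a"
      unfolding a_def using rl \<Delta>0 by (intro power_mono) (auto simp: add_nonneg_nonneg)
    also have "\<dots> = 2 ^ a * max (4 * r l / \<Delta>) 1 ^ a" by (simp add: power_mult_distrib)
    also have "\<dots> \<le> 2 ^ a * ((4 * r l / \<Delta>) ^ a + 1)"
      using rl \<Delta>0 by (intro mult_left_mono) (auto simp: max_def)
    finally show ?thesis .
  qed
  have finGl: "finite Gl" using finG by (simp add: Gl_def)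
  have "X1 \<subseteq> (\<Union>l\<in>Gl. {x \<in> X. meets I (u l) (r l) x \<rho>'})"
    using F(2) by (fastforce simp: X1_def Gl_def G_def)
  then have "card X1 \<le> card (\<Union>l\<in>Gl. {x \<in> X. meets I (u l) (r l) x \<rho>'})"
    using X(1) finGl by (intro card_mono) auto
  also have "\<dots> \<le> (\<Sum>l\<in>Gl. card {x \<in> X. meets I (u l) (r l) x \<rho>'})"
    using finGl by (rule card_UN_le)
  finally have "real (card X1) \<le> (\<Sum>l\<in>Gl. real (card {x \<in> X. meets I (u l) (r l) x \<rho>'}))"
    by (simp flip: of_nat_sum)
  also have "\<dots> \<le> (\<Sum>l\<in>Gl. 2 ^ a * ((4 * r l / \<Delta>) ^ a + 1))" by (intro sum_mono card_l)
  also have "\<dots> = 8 ^ a / \<Delta> ^ a * (\<Sum>l\<in>Gl. r l ^ a) + 2 ^ a * real (card Gl)"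
    by (simp add: sum.distrib sum_distrib_left sum_distrib_right sum_divide_distrib power_divide power_mult_distrib algebra_simps
        flip: power_mult_distrib[of 2 4])
  also have "\<dots> \<le> 8 ^ a / \<Delta> ^ a * (\<kappa> * \<rho> ^ a) + 2 ^ a * (\<rho> powr t / \<rho>' powr t)"
  proof (intro add_mono mult_left_mono)
    have "(\<Sum>l\<in>Gl. r l ^ a) \<le> (\<Sum>l\<in>G. r l ^ a)"
      using finG rG by (intro sum_mono2) (auto simp: Gl_def less_imp_le)
    also have "\<dots> \<le> (\<Sum>l\<in>G. r l powr t * \<rho> powr (real a - t))"
    proof (rule sum_mono)
      fix l assume l: "l \<in> G"
      have "r l ^ a = r l powr t * r l powr (real a - t)"
        using rG[OF l] by (simp add: powr_realpow flip: powr_add)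
      also have "\<dots> \<le> r l powr t * \<rho> powr (real a - t)"
        using rG[OF l] r_less[OF l] a1 t by (intro mult_left_mono powr_mono2) auto
      finally show "r l ^ a \<le> r l powr t * \<rho> powr (real a - t)" .
    qed
    also have "\<dots> = (\<Sum>l\<in>G. r l powr t) * \<rho> powr (real a - t)" by (simp add: sum_distrib_right)
    also have "\<dots> \<le> \<kappa> * \<rho> powr t * \<rho> powr (real a - t)" by (intro mult_right_mono sumG) auto
    also have "\<dots> = \<kappa> * \<rho> ^ a" using \<rho> by (simp add: powr_realpow flip: powr_add)
    finally show "(\<Sum>l\<in>Gl. r l ^ a) \<le> \<kappa> * \<rho> ^ a" .
    have "real (card Gl) * \<rho>' powr t = (\<Sum>l\<in>Gl. \<rho>' powr t)" by simp
    also have "\<dots> \<le> (\<Sum>l\<in>Gl. r l powr t)"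
      using \<rho> t by (intro sum_mono powr_mono2) (auto simp: Gl_def)
    also have "\<dots> \<le> (\<Sum>l\<in>G. r l powr t)" using finG by (intro sum_mono2) (auto simp: Gl_def)
    also have "\<dots> \<le> 1 * \<rho> powr t"
      using \<kappa>0 by (intro order_trans[OF sumG] mult_right_mono) auto
    finally show "real (card Gl) \<le> \<rho> powr t / \<rho>' powr t" using \<rho> by (simp add: field_simps)
  qed (use \<Delta>0 in auto)
  finally have card1: "real (card X1) \<le> 8 ^ a / \<Delta> ^ a * (\<kappa> * \<rho> ^ a) + 2 ^ a * (\<rho> powr t / \<rho>' powr t)" .
  have "real (card X) = real (card X1) + real (card X2)"
    using card_Un_disjoint[OF finX12 X12(2)] X12(1) by simp
  also have "\<dots> \<le> 8 ^ a / \<Delta> ^ a * (\<kappa> * \<rho> ^ a) + 2 ^ a * (\<rho> powr t / \<rho>' powr t) + 1 * (\<rho> powr t / \<rho>' powr t)"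
    using card1 card2 by simp
  also have "\<dots> \<le> 8 ^ a / \<Delta> ^ a * (\<kappa> * \<rho> ^ a) + 2 ^ a * (\<rho> powr t / \<rho>' powr t) + 2 ^ a * (\<rho> powr t / \<rho>' powr t)"
    by (intro add_left_mono mult_right_mono) auto
  also have "\<dots> = 8 ^ a / \<Delta> ^ a * (\<kappa> * \<rho> ^ a) + 2 ^ (a + 1) * (\<rho> powr t / \<rho>' powr t)" by simp
  also have "\<dots> < 8 ^ a / \<Delta> ^ a * (\<kappa> * \<rho> ^ a) + \<rho> ^ a / (4 * 4 ^ a * \<Delta> ^ a)"
    using large by (simp add: a_def)
  \<comment> \<open>The value of \<open>\<kappa>\<close> makes this term one quarter of the lower
    bound in \<open>cardX\<close>; \<open>large\<close> keeps the remaining terms below one half of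
    it.\<close>
  also have "8 ^ a / \<Delta> ^ a * (\<kappa> * \<rho> ^ a) = \<rho> ^ a / (8 * 4 ^ a * \<Delta> ^ a)"
  proof -
    have "(32::real) ^ a = 8 ^ a * 4 ^ a" by (simp flip: power_mult_distrib)
    then show ?thesis using \<Delta>0 by (simp add: \<kappa> a_def[symmetric])
  qed
  also have "\<rho> ^ a / (8 * 4 ^ a * \<Delta> ^ a) + \<rho> ^ a / (4 * 4 ^ a * \<Delta> ^ a) \<le> \<rho> ^ a / (2 * 4 ^ a * \<Delta> ^ a)"
  proof -
    have "\<rho> ^ a / (4 ^ a * \<Delta> ^ a) \<ge> 0" using \<rho> \<Delta>0 by simp
    then show ?thesis by (simp add: field_simps)
  qed
  also have "\<dots> \<le> real (card X)" using cardX by (simp add: a_def)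
  finally show False by simp
qed

section \<open>Dirichlet's theorem and the distribution of resonant points\<close>

lemma dirichlet_linear_forms:
  fixes A :: "'i \<Rightarrow> 'j \<Rightarrow> real"
  assumes I: "finite I" "I \<noteq> {}" and J: "finite J" "J \<noteq> {}" and H: "H \<ge> 1"
  shows "\<exists>b. (\<exists>j\<in>J. b j \<noteq> 0) \<and> (\<forall>j\<in>J. \<bar>b j\<bar> \<le> int H) \<and>
    (\<forall>i\<in>I. near_int (2 * real H powr - (real (card J) / real (card I))) (lin_forms J A b i))"
proof -
  define a where "a = card I"
  define m where "m = card J"
  have a1: "a \<ge> 1" and m1: "m \<ge> 1" using I J by (auto simp: a_def m_def Suc_leI card_gt_0_iff)
  define x where "x = real H powr (real m / real a)"
  have x1: "x \<ge> 1" unfolding x_def using H by (intro ge_one_powr_ge_zero) auto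
  \<comment> \<open>The number of cells per form has to be an integer; rounding \<open>x\<close>
    down costs the factor \<open>2\<close> in the conclusion.\<close>
  define g where "g = nat \<lfloor>x\<rfloor>"
  have g: "real g \<le> x" "x \<le> 2 * real g" "g \<ge> 1"
  proof -
    have "real g = of_int \<lfloor>x\<rfloor>" "\<lfloor>x\<rfloor> \<ge> 1" using x1 by (simp_all add: g_def)
    then show "real g \<le> x" "x \<le> 2 * real g" "g \<ge> 1" by linarith+
  qed
  have "real g ^ a \<le> x ^ a" using g by (intro power_mono) auto
  also have "\<dots> = real H ^ m"
    unfolding x_def using H a1 by (simp add: powr_powr powr_realpow flip: powr_realpow[of "_ powr _"])
  also have "\<dots> < real (H + 1) ^ m" using m1 by (intro power_strict_mono) auto
  finally have gH: "g ^ a < (H + 1) ^ m" by (metis of_nat_less_iff of_nat_power)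
  define Y where "Y = (\<Pi>\<^sub>E j\<in>J. {0..int H})"
  define f where "f b = (\<lambda>i\<in>I. nat \<lfloor>real g * frac (lin_forms J A b i)\<rfloor>)" for b
  have "card Y = (H + 1) ^ m"
    using J by (simp add: Y_def card_PiE m_def nat_add_distrib)
  moreover have "f ` Y \<subseteq> (\<Pi>\<^sub>E i\<in>I. {..<g})"
  proof clarify
    fix b
    have "nat \<lfloor>real g * frac z\<rfloor> < g" for z
    proof -
      have "real g * frac z < real g * 1"
        using g(3) by (intro mult_strict_left_mono) (auto simp: frac_lt_1)
      then show ?thesis using g(3) by linarith
    qed
    then show "f b \<in> (\<Pi>\<^sub>E i\<in>I. {..<g})" by (auto simp: f_def)
  qed
  then have "card (f ` Y) \<le> g ^ a"
    using card_mono[of "\<Pi>\<^sub>E i\<in>I. {..<g}" "f ` Y"] I by (simp add: finite_PiE card_PiE a_def)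
  ultimately have "\<not> inj_on f Y" using gH by (intro pigeonhole) simp
  then obtain b b' where b: "b \<in> Y" "b' \<in> Y" "f b = f b'" "b \<noteq> b'" by (auto simp: inj_on_def)
  have "\<exists>j\<in>J. b j \<noteq> b' j" using b unfolding Y_def by (metis PiE_ext)
  moreover have "\<bar>b j - b' j\<bar> \<le> int H" if "j \<in> J" for j
    using PiE_mem[OF b(1)[unfolded Y_def] that] PiE_mem[OF b(2)[unfolded Y_def] that] by auto
  moreover have "near_int (2 * real H powr - (real m / real a)) (lin_forms J A (\<lambda>j. b j - b' j) i)"
    if i: "i \<in> I" for i
  proof -
    have "near_int (1 / real g) (lin_forms J A b i - lin_forms J A b' i)"
      using fun_cong[OF b(3), of i] i g(3) by (intro near_int_if_same_cell) (auto simp: f_def)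
    moreover have "1 / real g \<le> 2 * real H powr - (real m / real a)"
      using g x1 by (simp add: powr_minus_divide x_def[symmetric] field_simps)
    ultimately show ?thesis unfolding lin_forms_diff by (rule near_int_mono)
  qed
  ultimately show ?thesis
    unfolding a_def m_def by (intro exI[of _ "\<lambda>j. b j - b' j"]) auto
qed

lemma card_int_near_le:
  fixes z :: real
  shows "finite {p::int. \<bar>z - of_int p\<bar> \<le> s}" "0 \<le> s \<Longrightarrow> real (card {p::int. \<bar>z - of_int p\<bar> \<le> s}) \<le> 2 * s + 1"
proof -
  have eq: "{p::int. \<bar>z - of_int p\<bar> \<le> s} = {\<lceil>z - s\<rceil>..\<lfloor>z + s\<rfloor>}"
    by (auto simp: abs_le_iff ceiling_le_iff le_floor_iff)
  show "finite {p::int. \<bar>z - of_int p\<bar> \<le> s}" unfolding eq by simp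
  show "real (card {p::int. \<bar>z - of_int p\<bar> \<le> s}) \<le> 2 * s + 1" if "0 \<le> s"
  proof -
    have "of_int (\<lfloor>z + s\<rfloor> - \<lceil>z - s\<rceil> + 1) \<le> 2 * s + 1" by linarith
    then show ?thesis unfolding eq using that by simp
  qed
qed

text \<open>Dirichlet's theorem for \<open>A\<close> enlarged by a column \<open>\<alpha>\<close>
  gives \<open>(q, b, p)\<close>, where \<open>q\<close> is the coefficient of the new column, and
  \<open>sep\<close> excludes \<open>q = 0\<close>. Hence every \<open>\<alpha>\<close> is within
  \<open>\<delta> / q\<close> of a point \<open>(p - A b) / q\<close>. By volume, the points with
  \<open>q \<le> \<epsilon> * H\<close> account for at most half of the box of radius
  \<open>\<rho> / 2\<close>. The others must cover the rest within \<open>\<Delta>\<close>, so a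
  maximal \<open>\<Delta>\<close>-separated set of them is large.\<close>

lemma resonant_points_ubiquity:
  fixes A :: "'i \<Rightarrow> 'j \<Rightarrow> real"
  assumes I: "finite I" "I \<noteq> {}" and J: "finite J" "j0 \<notin> J" and H: "H \<ge> 1"
    and \<delta>: "\<delta> = 2 * real H powr - ((real (card J) + 1) / real (card I))" "\<delta> \<le> 1 / 2"
    and sep: "\<And>b. (\<exists>j\<in>J. b j \<noteq> 0) \<Longrightarrow> (\<forall>j\<in>J. \<bar>b j\<bar> \<le> int H) \<Longrightarrow> \<exists>i\<in>I. \<not> near_int \<delta> (lin_forms J A b i)"
    and \<rho>: "0 < \<rho>" "\<rho> \<le> 1"
    and \<epsilon>: "\<epsilon> = 1 / (4 * 3 ^ card J * 8 ^ card I)"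
    and \<Delta>: "\<Delta> = \<delta> / (\<epsilon> * real H)" "\<Delta> \<le> \<rho> / 4"
    and large: "3 ^ card J * 12 ^ card I * (real (nat \<lceil>2 / \<rho>\<rceil>) / real H) \<le> \<rho> ^ card I / 4"
  shows "\<exists>X. finite X \<and> (\<forall>x\<in>X. \<forall>i\<in>I. \<bar>x i - c i\<bar> \<le> 3 * \<rho> / 4) \<and>
    (\<forall>x\<in>X. \<forall>y\<in>X. x \<noteq> y \<longrightarrow> (\<exists>i\<in>I. \<Delta> < \<bar>x i - y i\<bar>)) \<and>
    \<rho> ^ card I / (2 * 4 ^ card I * \<Delta> ^ card I) \<le> real (card X) \<and>
    (\<forall>x\<in>X. \<exists>q b p. q \<le> H \<and> \<epsilon> * real H < real q \<and> (\<forall>j\<in>J. \<bar>b j\<bar> \<le> int H) \<and>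
      (\<forall>i\<in>I. x i = (of_int (p i) - lin_forms J A b i) / real q))"
proof -
  define a where "a = card I"
  define m where "m = card J"
  have a1: "a \<ge> 1" using I by (simp add: a_def Suc_leI card_gt_0_iff)
  have \<epsilon>0: "\<epsilon> > 0" by (simp add: \<epsilon>)
  have \<delta>0: "\<delta> > 0" using H by (simp add: \<delta>)
  have \<Delta>0: "\<Delta> > 0" unfolding \<Delta>(1) using \<delta>0 \<epsilon>0 H by simp
  define Bs where "Bs = (\<Pi>\<^sub>E j\<in>J. {- int H..int H})"
  define pt where "pt = (\<lambda>(q::nat, b, p). \<lambda>i\<in>I. (real_of_int (p i) - lin_forms J A b i) / real q)"
  have finBs: "finite Bs" unfolding Bs_def using J by (intro finite_PiE) auto
  have cardBs: "real (card Bs) \<le> 3 ^ m * real H ^ m"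
  proof -
    have "real (card Bs) = real (2 * H + 1) ^ m"
      unfolding Bs_def using J by (subst card_PiE) (simp_all add: card_int_symmetric m_def del: card_atLeastAtMost_int)
    also have "\<dots> \<le> (3 * real H) ^ m" using H by (intro power_mono) auto
    finally show ?thesis by (simp add: power_mult_distrib)
  qed
  have approx: "\<exists>q b p. 1 \<le> q \<and> q \<le> H \<and> b \<in> Bs \<and>
      (\<forall>i\<in>I. \<bar>real q * \<alpha> i + lin_forms J A b i - real_of_int (p i)\<bar> < \<delta>)" for \<alpha> :: "'i \<Rightarrow> real"
  proof -
    define A' where "A' i j = (if j = j0 then \<alpha> i else A i j)" for i j
    have A': "lin_forms (insert j0 J) A' b i = \<alpha> i * of_int (b j0) + lin_forms J A b i" for b i
    proof -
      have "(\<Sum>j\<in>J. A' i j * of_int (b j)) = (\<Sum>j\<in>J. A i j * of_int (b j))"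
        using J by (intro sum.cong) (auto simp: A'_def)
      then show ?thesis using J by (simp add: lin_forms_def A'_def)
    qed
    obtain b where b: "\<exists>j\<in>insert j0 J. b j \<noteq> 0" "\<forall>j\<in>insert j0 J. \<bar>b j\<bar> \<le> int H"
      "\<forall>i\<in>I. near_int \<delta> (lin_forms (insert j0 J) A' b i)"
      using dirichlet_linear_forms[OF I, of "insert j0 J" H A'] J H unfolding \<delta>(1)
      by (auto simp: card_insert_disjoint add.commute)
    have bj0: "b j0 \<noteq> 0"
    proof
      assume 0: "b j0 = 0"
      then have "\<exists>j\<in>J. b j \<noteq> 0" "\<forall>j\<in>J. \<bar>b j\<bar> \<le> int H" using b by auto
      then obtain i where "i \<in> I" "\<not> near_int \<delta> (lin_forms J A b i)" using sep by blast
      then show False using b(3) A' 0 by simp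
    qed
    \<comment> \<open>The sign is normalised so that the coefficient of the new column becomes a
      positive denominator.\<close>
    define b' where "b' j = sgn (b j0) * b j" for j
    have b': "b' j0 \<ge> 1" "\<And>j. j \<in> insert j0 J \<Longrightarrow> \<bar>b' j\<bar> \<le> int H"
      using bj0 b(2) by (auto simp: b'_def abs_mult sgn_if)
    have near: "near_int \<delta> (lin_forms (insert j0 J) A' b' i)" if "i \<in> I" for i
    proof -
      have "lin_forms (insert j0 J) A' b' i = of_int (sgn (b j0)) * lin_forms (insert j0 J) A' b i"
        unfolding b'_def by (rule lin_forms_scale)
      then show ?thesis using b(3) that bj0 by (auto simp: sgn_if near_int_uminus)
    qed
    obtain p where p: "\<And>i. i \<in> I \<Longrightarrow> \<bar>lin_forms (insert j0 J) A' b' i - of_int (p i)\<bar> < \<delta>"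
      using near unfolding near_int_def by metis
    define q where "q = nat (b' j0)"
    have q: "real q = of_int (b' j0)" "1 \<le> q" "q \<le> H"
      using b'(1) b'(2)[of j0] by (auto simp: q_def nat_le_iff)
    have lf: "lin_forms J A (restrict b' J) i = lin_forms J A b' i" for i
      by (simp add: lin_forms_def)
    have "restrict b' J \<in> Bs"
      unfolding Bs_def using b'(2) by (auto simp: abs_le_iff minus_le_iff)
    moreover have "\<bar>real q * \<alpha> i + lin_forms J A (restrict b' J) i - real_of_int (p i)\<bar> < \<delta>" if "i \<in> I" for i
      using p[OF that] unfolding lf A' q(1) by (simp add: mult.commute)
    ultimately show ?thesis using q by blast
  qed
  define P where "P s = (\<lambda>(q::nat, b). \<Pi>\<^sub>E i\<in>I. {p::int. \<bar>real q * c i + lin_forms J A b i - of_int p\<bar> \<le> s q})" for s :: "nat \<Rightarrow> real"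
  have finP: "finite (P s qb)" for s qb
    unfolding P_def using I card_int_near_le(1) by (auto split: prod.split intro!: finite_PiE)
  have cardP: "real (card (P s qb)) \<le> (2 * s (fst qb) + 1) ^ a" if "0 \<le> s (fst qb)" for s qb
  proof -
    obtain q b where qb: "qb = (q, b)" by (meson surj_pair)
    have "real (card (P s qb)) = (\<Prod>i\<in>I. real (card {p::int. \<bar>real q * c i + lin_forms J A b i - of_int p\<bar> \<le> s q}))"
      using I by (simp add: P_def qb card_PiE)
    also have "\<dots> \<le> (\<Prod>i\<in>I. 2 * s q + 1)"
      using that by (intro prod_mono conjI card_int_near_le) (auto simp: qb)
    finally show ?thesis by (simp add: qb a_def)
  qed
  define small where "small = {q. 1 \<le> q \<and> real q \<le> \<epsilon> * real H}"
  define big where "big = {q. q \<le> H \<and> \<epsilon> * real H < real q}"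
  have "small \<subseteq> {1..nat \<lfloor>\<epsilon> * real H\<rfloor>}" by (auto simp: small_def le_nat_iff le_floor_iff)
  then have fin_small: "finite small" and card_small: "real (card small) \<le> \<epsilon> * real H"
  proof -
    assume sub: "small \<subseteq> {1..nat \<lfloor>\<epsilon> * real H\<rfloor>}"
    show "finite small" using sub by (rule finite_subset) simp
    have "card small \<le> nat \<lfloor>\<epsilon> * real H\<rfloor>" using card_mono[OF _ sub] by simp
    then have "real (card small) \<le> real (nat \<lfloor>\<epsilon> * real H\<rfloor>)" by simp
    also have "\<dots> \<le> \<epsilon> * real H" using \<epsilon>0 by simp
    finally show "real (card small) \<le> \<epsilon> * real H" .
  qed
  have fin_big: "finite big" by (rule finite_subset[of _ "{..H}"]) (auto simp: big_def)
  define Ks where "Ks = (SIGMA q:small. SIGMA b:Bs. P (\<lambda>q. real q * (\<rho> / 2) + \<delta>) (q, b))"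
  have finKs: "finite Ks" unfolding Ks_def using fin_small finBs finP by (intro finite_SigmaI) auto
  define Z where "Z = pt ` (SIGMA q:big. SIGMA b:Bs. P (\<lambda>q. real q * (3 * \<rho> / 4)) (q, b))"
  have finZ: "finite Z" unfolding Z_def using fin_big finBs finP by (intro finite_imageI finite_SigmaI) auto
  obtain X where X: "X \<subseteq> Z" "\<forall>x\<in>X. \<forall>y\<in>X. x \<noteq> y \<longrightarrow> \<not> (\<forall>i\<in>I. \<bar>x i - y i\<bar> \<le> \<Delta>)"
    "\<forall>z\<in>Z. \<exists>x\<in>X. \<forall>i\<in>I. \<bar>z i - x i\<bar> \<le> \<Delta>"
    using maximal_separated_subset[OF finZ, of "\<lambda>x y. \<forall>i\<in>I. \<bar>x i - y i\<bar> \<le> \<Delta>"] \<Delta>0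
    by (force simp: abs_minus_commute)
  have finX: "finite X" using X(1) finZ finite_subset by blast
  have Zprops: "(\<forall>i\<in>I. \<bar>z i - c i\<bar> \<le> 3 * \<rho> / 4) \<and> (\<exists>q b p. q \<le> H \<and> \<epsilon> * real H < real q \<and>
      (\<forall>j\<in>J. \<bar>b j\<bar> \<le> int H) \<and> (\<forall>i\<in>I. z i = (of_int (p i) - lin_forms J A b i) / real q))"
    if zZ: "z \<in> Z" for z
  proof -
    obtain q b p where z: "z = pt (q, b, p)" and q: "q \<in> big" and b: "b \<in> Bs"
      and p: "p \<in> P (\<lambda>q. real q * (3 * \<rho> / 4)) (q, b)"
      using zZ unfolding Z_def image_def Sigma_def by blast
    have "0 \<le> \<epsilon> * real H" using \<epsilon>0 by simp
    then have q0: "real q > 0" using q unfolding big_def mem_Collect_eq by linarith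
    have zi: "z i = (of_int (p i) - lin_forms J A b i) / real q" if "i \<in> I" for i
      using that by (simp add: z pt_def)
    have "\<bar>z i - c i\<bar> \<le> 3 * \<rho> / 4" if i: "i \<in> I" for i
    proof -
      have "\<bar>real q * c i + lin_forms J A b i - of_int (p i)\<bar> \<le> real q * (3 * \<rho> / 4)"
        using p i by (auto simp: P_def PiE_iff)
      moreover have "real q * c i + lin_forms J A b i - of_int (p i) = real q * (c i - z i)"
        using q0 by (simp add: zi[OF i] field_simps)
      ultimately have "real q * \<bar>z i - c i\<bar> \<le> real q * (3 * \<rho> / 4)"
        by (simp add: abs_mult abs_minus_commute)
      then show ?thesis using q0 by simp
    qed
    moreover have "\<bar>b j\<bar> \<le> int H" if "j \<in> J" for j
      using PiE_mem[OF b[unfolded Bs_def] that] by auto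
    ultimately show ?thesis using zi q by (auto simp: big_def)
  qed
  define ctr where "ctr k = (case k of Inl t \<Rightarrow> pt t | Inr x \<Rightarrow> x)" for k
  define rad where "rad k = (case k of Inl (q, b, p) \<Rightarrow> \<delta> / real q | Inr x \<Rightarrow> 2 * \<Delta>)"
    for k :: "(nat \<times> ('j \<Rightarrow> int) \<times> ('i \<Rightarrow> int)) + ('i \<Rightarrow> real)"
  \<comment> \<open>Only the box of radius \<open>\<rho> / 2\<close> is covered: the margin
    \<open>\<Delta> \<le> \<rho> / 4\<close> then keeps the points used from \<open>Z\<close> within
    \<open>3 * \<rho> / 4\<close>. The radius \<open>2 * \<Delta>\<close> adds the distance from
    \<open>\<alpha>\<close> to \<open>Z\<close> and that from \<open>Z\<close> to
    \<open>X\<close>.\<close>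
  have "(2 * (\<rho> / 2)) ^ card I \<le> (\<Sum>k\<in>Ks <+> X. (2 * rad k) ^ card I)"
  proof (rule box_cover_volume[OF I(1), of _ _ _ c ctr])
    show "finite (Ks <+> X)" using finKs finX by simp
    show "0 \<le> \<rho> / 2" using \<rho> by simp
    show "0 \<le> rad k" for k using \<delta>0 \<Delta>0 by (auto simp: rad_def split: sum.split prod.split)
    fix \<alpha> assume \<alpha>: "\<And>i. i \<in> I \<Longrightarrow> \<bar>\<alpha> i - c i\<bar> \<le> \<rho> / 2"
    obtain q b p0 where q: "1 \<le> q" "q \<le> H" and b: "b \<in> Bs"
      and p0: "\<forall>i\<in>I. \<bar>real q * \<alpha> i + lin_forms J A b i - real_of_int (p0 i)\<bar> < \<delta>"
      using approx by blast
    define p where "p = restrict p0 I"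
    have p: "\<bar>real q * \<alpha> i + lin_forms J A b i - real_of_int (p i)\<bar> < \<delta>" if "i \<in> I" for i
      using p0 that by (simp add: p_def)
    have \<alpha>pt: "\<bar>\<alpha> i - pt (q, b, p) i\<bar> \<le> \<delta> / real q" if i: "i \<in> I" for i
    proof -
      have "real q * \<bar>\<alpha> i - pt (q, b, p) i\<bar> = \<bar>real q * (\<alpha> i - pt (q, b, p) i)\<bar>" by (simp add: abs_mult)
      also have "real q * (\<alpha> i - pt (q, b, p) i) = real q * \<alpha> i + lin_forms J A b i - of_int (p i)"
        using q(1) i by (simp add: pt_def field_simps)
      finally show ?thesis using p[OF i] q(1) by (simp add: field_simps)
    qed
    have qc: "\<bar>real q * c i + lin_forms J A b i - of_int (p i)\<bar> \<le> real q * (\<rho> / 2) + \<delta>" if i: "i \<in> I" for i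
    proof -
      have "\<bar>real q * c i - real q * \<alpha> i\<bar> = real q * \<bar>\<alpha> i - c i\<bar>"
        by (simp add: abs_mult abs_minus_commute flip: right_diff_distrib)
      also have "\<dots> \<le> real q * (\<rho> / 2)" using \<alpha>[OF i] by (intro mult_left_mono) auto
      finally show ?thesis using p[OF i] by linarith
    qed
    show "\<exists>k\<in>Ks <+> X. \<forall>i\<in>I. \<bar>\<alpha> i - ctr k i\<bar> \<le> rad k"
    proof (cases "q \<in> small")
      case True
      have "p \<in> P (\<lambda>q. real q * (\<rho> / 2) + \<delta>) (q, b)"
        unfolding P_def using qc by (auto simp: p_def)
      then have "(q, b, p) \<in> Ks" unfolding Ks_def using True b by blast
      then show ?thesis
        using \<alpha>pt by (intro bexI[of _ "Inl (q, b, p)"]) (auto simp: ctr_def rad_def)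
    next
      case False
      then have qb: "q \<in> big" using q by (auto simp: small_def big_def)
      have "\<delta> / real q \<le> \<Delta>"
        unfolding \<Delta>(1) using qb \<delta>0 \<epsilon>0 H q by (intro divide_left_mono) (auto simp: big_def)
      then have "\<delta> \<le> real q * \<Delta>" using q by (simp add: field_simps)
      also have "\<dots> \<le> real q * (\<rho> / 4)" using \<Delta>(2) by (intro mult_left_mono) auto
      finally have "real q * (\<rho> / 2) + \<delta> \<le> real q * (3 * \<rho> / 4)" by (simp add: field_simps)
      then have "\<bar>real q * c i + lin_forms J A b i - of_int (p i)\<bar> \<le> real q * (3 * \<rho> / 4)" if "i \<in> I" for i
        using qc[OF that] by linarith
      then have "p \<in> P (\<lambda>q. real q * (3 * \<rho> / 4)) (q, b)"
        unfolding P_def prod.case by (intro PiE_I) (simp_all add: p_def)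
      then have "pt (q, b, p) \<in> Z" unfolding Z_def using qb b by blast
      then obtain x where x: "x \<in> X" "\<forall>i\<in>I. \<bar>pt (q, b, p) i - x i\<bar> \<le> \<Delta>" using X(3) by blast
      have "\<bar>\<alpha> i - x i\<bar> \<le> 2 * \<Delta>" if i: "i \<in> I" for i
        using \<alpha>pt[OF i] x(2) i \<open>\<delta> / real q \<le> \<Delta>\<close> by (smt (verit))
      then show ?thesis
        using x(1) by (intro bexI[of _ "Inr x"]) (auto simp: ctr_def rad_def)
    qed
  qed
  also have "(\<Sum>k\<in>Ks <+> X. (2 * rad k) ^ card I)
      = (\<Sum>(q, b, p)\<in>Ks. (2 * (\<delta> / real q)) ^ a) + real (card X) * (4 * \<Delta>) ^ a"
  proof -
    have "(\<Sum>k\<in>Ks <+> X. (2 * rad k) ^ card I)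
        = (\<Sum>k\<in>Ks. (2 * rad (Inl k)) ^ card I) + (\<Sum>x\<in>X. (2 * rad (Inr x)) ^ card I)"
      using sum.Plus[OF finKs finX, of "\<lambda>k. (2 * rad k) ^ card I"] by (simp only: o_def)
    moreover have "(\<Sum>k\<in>Ks. (2 * rad (Inl k)) ^ card I) = (\<Sum>(q, b, p)\<in>Ks. (2 * (\<delta> / real q)) ^ a)"
    proof (rule sum.cong[OF refl])
      fix k assume "k \<in> Ks"
      obtain q b p where k: "k = (q, b, p)" by (metis prod_cases3)
      show "(2 * rad (Inl k)) ^ card I = (case k of (q, b, p) \<Rightarrow> (2 * (\<delta> / real q)) ^ a)"
        by (simp only: k rad_def sum.case prod.case a_def)
    qed
    moreover have "2 * rad (Inr x) = 4 * \<Delta>" for x by (simp add: rad_def)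
    ultimately show ?thesis by (simp only: sum_constant a_def)
  qed
  also have "(\<Sum>(q, b, p)\<in>Ks. (2 * (\<delta> / real q)) ^ a)
      = (\<Sum>q\<in>small. \<Sum>b\<in>Bs. real (card (P (\<lambda>q. real q * (\<rho> / 2) + \<delta>) (q, b))) * (2 * (\<delta> / real q)) ^ a)"
  proof -
    have "(\<Sum>(q, b, p)\<in>Ks. (2 * (\<delta> / real q)) ^ a)
      = (\<Sum>q\<in>small. \<Sum>(b, p)\<in>(SIGMA b:Bs. P (\<lambda>q. real q * (\<rho> / 2) + \<delta>) (q, b)). (2 * (\<delta> / real q)) ^ a)"
      unfolding Ks_def using fin_small finBs finP by (subst sum.Sigma) auto
    also have "\<dots> = (\<Sum>q\<in>small. \<Sum>b\<in>Bs. \<Sum>p\<in>P (\<lambda>q. real q * (\<rho> / 2) + \<delta>) (q, b). (2 * (\<delta> / real q)) ^ a)"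
      using finBs finP by (intro sum.cong refl) (subst sum.Sigma, auto)
    finally show ?thesis by simp
  qed
  \<comment> \<open>For small \<open>q\<close> a box of side \<open>q * \<rho>\<close> may contain
    integer points although its volume is tiny. The range of \<open>q\<close> below
    \<open>2 / \<rho>\<close>, bounded independently of \<open>H\<close>, is therefore estimated
    separately and absorbed by \<open>large\<close>.\<close>
  also have "\<dots> \<le> (\<Sum>q\<in>small. \<Sum>b\<in>Bs. (2 * \<delta>) ^ a * ((2 * \<rho>) ^ a + (if q < nat \<lceil>2 / \<rho>\<rceil> then 3 ^ a else 0)))"
  proof (intro sum_mono)
    fix q b assume q: "q \<in> small" and b: "b \<in> Bs"
    have q1: "real q \<ge> 1" using q by (simp add: small_def)
    have "real (card (P (\<lambda>q. real q * (\<rho> / 2) + \<delta>) (q, b))) \<le> (2 * (real q * (\<rho> / 2) + \<delta>) + 1) ^ a"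
      using cardP[of "\<lambda>q. real q * (\<rho> / 2) + \<delta>" "(q, b)"] \<rho> \<delta>0 by simp
    also have "\<dots> \<le> (real q * \<rho> + 2) ^ a"
      using \<delta>(2) \<rho> \<delta>0 by (intro power_mono) (auto intro: add_nonneg_nonneg)
    finally have "real (card (P (\<lambda>q. real q * (\<rho> / 2) + \<delta>) (q, b))) * (2 * (\<delta> / real q)) ^ a
        \<le> (real q * \<rho> + 2) ^ a * (2 * (\<delta> / real q)) ^ a"
      using \<delta>0 by (intro mult_right_mono) auto
    also have "\<dots> = (2 * \<delta>) ^ a * (\<rho> + 2 / real q) ^ a"
    proof -
      have "(real q * \<rho> + 2) * (2 * (\<delta> / real q)) = (2 * \<delta>) * (\<rho> + 2 / real q)"
        using q1 by (simp add: field_simps)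
      then show ?thesis by (metis power_mult_distrib)
    qed
    also have "\<dots> \<le> (2 * \<delta>) ^ a * ((2 * \<rho>) ^ a + (if q < nat \<lceil>2 / \<rho>\<rceil> then 3 ^ a else 0))"
    proof (intro mult_left_mono)
      show "(\<rho> + 2 / real q) ^ a \<le> (2 * \<rho>) ^ a + (if q < nat \<lceil>2 / \<rho>\<rceil> then 3 ^ a else 0)"
      proof (cases "q < nat \<lceil>2 / \<rho>\<rceil>")
        case True
        have "2 / real q \<le> 2" using q1 by (simp add: field_simps)
        then have "(\<rho> + 2 / real q) ^ a \<le> 3 ^ a" using \<rho> q1 by (intro power_mono) auto
        moreover have "(0::real) \<le> (2 * \<rho>) ^ a" using \<rho> by simp
        ultimately show ?thesis using True by simp
      next
        case False
        then have "2 / \<rho> \<le> real q" by linarith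
        then have "2 / real q \<le> \<rho>" using \<rho> q1 by (simp add: field_simps)
        then have "(\<rho> + 2 / real q) ^ a \<le> (2 * \<rho>) ^ a" using \<rho> q1 by (intro power_mono) auto
        then show ?thesis using False by simp
      qed
    qed (use \<delta>0 in auto)
    finally show "real (card (P (\<lambda>q. real q * (\<rho> / 2) + \<delta>) (q, b))) * (2 * (\<delta> / real q)) ^ a
        \<le> (2 * \<delta>) ^ a * ((2 * \<rho>) ^ a + (if q < nat \<lceil>2 / \<rho>\<rceil> then 3 ^ a else 0))" .
  qed
  also have "\<dots> = real (card Bs) * (2 * \<delta>) ^ a *
      (\<Sum>q\<in>small. (2 * \<rho>) ^ a + (if q < nat \<lceil>2 / \<rho>\<rceil> then 3 ^ a else 0))"
    by (simp add: sum_distrib_left mult_ac)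
  also have "\<dots> \<le> (3 ^ m * real H ^ m) * (2 * \<delta>) ^ a *
      (\<epsilon> * real H * (2 * \<rho>) ^ a + real (nat \<lceil>2 / \<rho>\<rceil>) * 3 ^ a)"
  proof (intro mult_mono cardBs order_refl)
    have "(\<Sum>q\<in>small. (if q < nat \<lceil>2 / \<rho>\<rceil> then 3 ^ a else 0)) = (\<Sum>q\<in>small \<inter> {..<nat \<lceil>2 / \<rho>\<rceil>}. (3::real) ^ a)"
      using fin_small by (subst sum.inter_restrict) auto
    also have "\<dots> \<le> (\<Sum>q\<in>{..<nat \<lceil>2 / \<rho>\<rceil>}. 3 ^ a)" by (intro sum_mono2) auto
    finally have "(\<Sum>q\<in>small. (if q < nat \<lceil>2 / \<rho>\<rceil> then 3 ^ a else 0)) \<le> real (nat \<lceil>2 / \<rho>\<rceil>) * (3::real) ^ a" by simp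
    moreover have "(\<Sum>q\<in>small. (2 * \<rho>) ^ a) \<le> \<epsilon> * real H * (2 * \<rho>) ^ a"
      using card_small \<rho> by (simp add: mult_right_mono)
    ultimately show "(\<Sum>q\<in>small. (2 * \<rho>) ^ a + (if q < nat \<lceil>2 / \<rho>\<rceil> then 3 ^ a else 0))
        \<le> \<epsilon> * real H * (2 * \<rho>) ^ a + real (nat \<lceil>2 / \<rho>\<rceil>) * 3 ^ a"
      unfolding sum.distrib by linarith
  qed (use \<delta>0 \<rho> in \<open>auto intro!: sum_nonneg add_nonneg_nonneg\<close>)
  \<comment> \<open>This explains \<open>\<epsilon>\<close>: the powers of \<open>H\<close> cancel,
    and the main term \<open>3 ^ m * 8 ^ a * \<epsilon> * \<rho> ^ a\<close> becomes
    \<open>\<rho> ^ a / 4\<close>.\<close>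
  also have "(3 ^ m * real H ^ m) * (2 * \<delta>) ^ a *
      (\<epsilon> * real H * (2 * \<rho>) ^ a + real (nat \<lceil>2 / \<rho>\<rceil>) * 3 ^ a)
      = \<rho> ^ a / 4 + 3 ^ m * 12 ^ a * (real (nat \<lceil>2 / \<rho>\<rceil>) / real H)"
  proof -
    have \<delta>a: "(2 * \<delta>) ^ a = 4 ^ a / (real H ^ m * real H)"
    proof -
      have "(real H powr - ((real m + 1) / real a)) ^ a = real H powr (- ((real m + 1) / real a) * real a)"
        using H by (simp add: powr_realpow[symmetric] powr_powr)
      also have "\<dots> = 1 / real H powr (real m + 1)" using a1 by (simp add: powr_minus_divide[symmetric])
      also have "\<dots> = 1 / (real H ^ m * real H)" using H by (simp add: powr_add powr_realpow)
      finally have "(real H powr - ((real m + 1) / real a)) ^ a = 1 / (real H ^ m * real H)" .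
      then show ?thesis by (simp add: \<delta>(1) m_def[symmetric] a_def[symmetric] power_mult_distrib flip: power_mult_distrib[of 2 2])
    qed
    have 12: "(12::real) ^ a = 4 ^ a * 3 ^ a" "(8::real) ^ a = 4 ^ a * 2 ^ a" by (simp_all flip: power_mult_distrib)
    show ?thesis
      unfolding \<delta>a \<epsilon> m_def[symmetric] a_def[symmetric] 12 using H by (simp add: field_simps power_mult_distrib)
  qed
  also have "\<dots> \<le> \<rho> ^ a / 4 + \<rho> ^ a / 4" using large unfolding m_def a_def by linarith
  finally have "\<rho> ^ a \<le> \<rho> ^ a / 4 + \<rho> ^ a / 4 + real (card X) * (4 * \<Delta>) ^ a" by (simp add: a_def)
  then have "\<rho> ^ a / 2 \<le> real (card X) * (4 ^ a * \<Delta> ^ a)" by (simp add: power_mult_distrib)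
  then have "\<rho> ^ card I / (2 * 4 ^ card I * \<Delta> ^ card I) \<le> real (card X)"
    using \<Delta>0 by (simp add: a_def field_simps)
  moreover have "\<exists>i\<in>I. \<Delta> < \<bar>x i - y i\<bar>" if "x \<in> X" "y \<in> X" "x \<noteq> y" for x y
    using X(2)[rule_format, OF that] by (auto simp: not_le)
  moreover have "\<forall>x\<in>X. \<forall>i\<in>I. \<bar>x i - c i\<bar> \<le> 3 * \<rho> / 4"
    using X(1) Zprops by blast
  moreover have "\<forall>x\<in>X. \<exists>q b p. q \<le> H \<and> \<epsilon> * real H < real q \<and>
      (\<forall>j\<in>J. \<bar>b j\<bar> \<le> int H) \<and> (\<forall>i\<in>I. x i = (of_int (p i) - lin_forms J A b i) / real q)"
    using X(1) Zprops by blast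
  ultimately show ?thesis using finX by blast
qed

text \<open>For large \<open>H\<close> the separated resonant points number at least a constant
  times \<open>H powr (card J + 1 + card I)\<close>. Beyond a fixed proportion of them, thinness can
  spoil only about \<open>H powr ((\<omega> + 1) * t)\<close>, so the last condition on
  \<open>t\<close> leaves a good one. Since \<open>\<mu>\<close> is below the Dirichlet exponent,
  \<open>\<delta> H\<close> eventually drops below the lower bound for the forms of
  \<open>A\<close>, which is the separation that the resonant points need.\<close>

lemma thin_resonant_sub_box_exists:
  fixes A :: "'i \<Rightarrow> 'j \<Rightarrow> real" and u :: "'l \<Rightarrow> 'i \<Rightarrow> real"
  assumes I: "finite I" "I \<noteq> {}" and J: "finite J" "j0 \<notin> J"
    and \<mu>: "0 < \<mu>" "\<mu> < (real (card J) + 1) / real (card I)" and good: "\<not> (\<exists>\<^sub>\<infinity>N. well_approx I J A \<mu> N)"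
    and \<omega>: "(real (card J) + 1) / real (card I) < \<omega>"
    and t: "0 < t" "t \<le> 1" "(\<omega> + 1) * t < real (card J) + 1 + real (card I)"
    and r: "\<And>l. l \<in> \<Lambda> \<Longrightarrow> 0 < r l" and \<kappa>: "\<kappa> = 1 / (8 * 32 ^ card I)"
    and \<rho>: "0 < \<rho>" "\<rho> \<le> 1" and thin: "thin_in_box I \<Lambda> u r t \<kappa> c \<rho>"
  shows "\<exists>c' \<rho>'. 0 < \<rho>' \<and> \<rho>' \<le> \<rho> / 4 \<and> (\<forall>i\<in>I. \<bar>c' i - c i\<bar> \<le> 3 * \<rho> / 4) \<and>
    thin_in_box I \<Lambda> u r t \<kappa> c' \<rho>' \<and>
    (\<forall>\<alpha>. (\<forall>i\<in>I. \<bar>\<alpha> i - c' i\<bar> \<le> \<rho>') \<longrightarrow>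
      (\<exists>N\<ge>K. well_approx I (insert j0 J) (\<lambda>i j. if j = j0 then \<alpha> i else A i j) \<omega> N))"
proof -
  define a where "a = card I"
  define m where "m = card J"
  define e where "e = (real m + 1) / real a"
  have a1: "a \<ge> 1" using I by (simp add: a_def Suc_leI card_gt_0_iff)
  have e0: "e > 0" using a1 by (simp add: e_def)
  have \<omega>e: "e < \<omega>" and \<mu>e: "\<mu> < e" using \<omega> \<mu> by (simp_all add: e_def m_def a_def)
  have ea: "e * real a = real m + 1" using a1 by (simp add: e_def)
  define \<epsilon> where "\<epsilon> = 1 / (4 * 3 ^ m * 8 ^ a :: real)"
  have \<epsilon>0: "\<epsilon> > 0" by (simp add: \<epsilon>_def)
  define \<delta> where "\<delta> H = 2 * real H powr - e" for H :: nat
  define \<Delta> where "\<Delta> H = \<delta> H / (\<epsilon> * real H)" for H :: nat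
  \<comment> \<open>Small enough that all columns in the new box are approximated through the same
    \<open>(q, b, p)\<close>; the factor \<open>1 / 2\<close> makes the inequality strict.\<close>
  define \<rho>' where "\<rho>' H = real H powr - (\<omega> + 1) / 2" for H :: nat
  obtain c0 where c0: "c0 > 0" "\<And>N b. N \<ge> 1 \<Longrightarrow> has_height J b N \<Longrightarrow>
      \<exists>i\<in>I. \<not> near_int (c0 * real N powr - \<mu>) (lin_forms J A b i)"
    using not_near_int_if_finite_well_approx[OF \<mu>(1) good] by metis
  define C1 where "C1 = 2 ^ (a + 1) * \<rho> powr t * 2 powr t"
  define C2 where "C2 = \<rho> ^ a * \<epsilon> ^ a / (4 * 4 ^ a * 2 ^ a)"
  have C2: "C2 > 0" using \<rho> \<epsilon>0 by (simp add: C2_def)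
  define B where "B = 3 ^ m * 12 ^ a * real (nat \<lceil>2 / \<rho>\<rceil>)"
  have "eventually (\<lambda>H::nat. H \<ge> 1) sequentially" by (rule eventually_ge_at_top)
  moreover have "eventually (\<lambda>H::nat. 2 * real H powr - e \<le> 1 / 2) sequentially" using e0 by real_asymp
  moreover have "eventually (\<lambda>H::nat. 2 * real H powr - e \<le> c0 * real H powr - \<mu>) sequentially"
    using \<mu>e c0(1) by real_asymp
  moreover have "eventually (\<lambda>H::nat. 2 * real H powr - e / (\<epsilon> * real H) \<le> \<rho> / 4) sequentially"
    using e0 \<epsilon>0 \<rho>(1) by real_asymp
  moreover have "eventually (\<lambda>H::nat. B / real H \<le> \<rho> ^ a / 4) sequentially"
  proof -
    have "\<rho> ^ a / 4 > 0" using \<rho> by simp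
    then show ?thesis by real_asymp
  qed
  moreover have "eventually (\<lambda>H::nat. real H powr - (\<omega> + 1) / 2 \<le> \<rho> / 4) sequentially"
    using e0 \<omega>e \<rho>(1) by real_asymp
  moreover have "eventually (\<lambda>H::nat. 4 * (real H powr - (\<omega> + 1) / 2) \<le> 2 * real H powr - e / (\<epsilon> * real H)) sequentially"
    using e0 \<omega>e \<epsilon>0 by real_asymp
  moreover have "eventually (\<lambda>H::nat. C1 * real H powr ((\<omega> + 1) * t) < C2 * real H powr (real m + 1 + real a)) sequentially"
  proof -
    have "(\<omega> + 1) * t < real m + 1 + real a" using t by (simp add: m_def a_def)
    then show ?thesis using C2 by real_asymp
  qed
  moreover have "eventually (\<lambda>H::nat. real K \<le> \<epsilon> * real H) sequentially"
    using \<epsilon>0 by real_asymp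
  ultimately have "eventually (\<lambda>H. H \<ge> 1 \<and> \<delta> H \<le> 1 / 2 \<and> \<delta> H \<le> c0 * real H powr - \<mu> \<and> \<Delta> H \<le> \<rho> / 4 \<and>
      B / real H \<le> \<rho> ^ a / 4 \<and> \<rho>' H \<le> \<rho> / 4 \<and> 4 * \<rho>' H \<le> \<Delta> H \<and>
      C1 * real H powr ((\<omega> + 1) * t) < C2 * real H powr (real m + 1 + real a) \<and> real K \<le> \<epsilon> * real H) sequentially"
    unfolding \<delta>_def \<Delta>_def \<rho>'_def by eventually_elim blast
  then obtain H where H: "H \<ge> 1" "\<delta> H \<le> 1 / 2" "\<delta> H \<le> c0 * real H powr - \<mu>" "\<Delta> H \<le> \<rho> / 4"
      "B / real H \<le> \<rho> ^ a / 4" "\<rho>' H \<le> \<rho> / 4" "4 * \<rho>' H \<le> \<Delta> H"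
      "C1 * real H powr ((\<omega> + 1) * t) < C2 * real H powr (real m + 1 + real a)" "real K \<le> \<epsilon> * real H"
    unfolding eventually_sequentially by blast
  have \<rho>'0: "\<rho>' H > 0" using H(1) by (simp add: \<rho>'_def)
  have \<Delta>0: "\<Delta> H > 0" using H(1) \<epsilon>0 by (simp add: \<Delta>_def \<delta>_def)
  have "\<exists>i\<in>I. \<not> near_int (\<delta> H) (lin_forms J A b i)"
    if b0: "\<exists>j\<in>J. b j \<noteq> 0" and bH: "\<forall>j\<in>J. \<bar>b j\<bar> \<le> int H" for b
  proof -
    from b0 obtain j where j: "j \<in> J" "b j \<noteq> 0" by blast
    obtain N where N: "1 \<le> N" "N \<le> H" "has_height J b N"
      using has_height_le[of J j b H, OF J(1) j] bH by metis
    have "c0 * real H powr - \<mu> \<le> c0 * real N powr - \<mu>"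
      using N \<mu>(1) c0(1) by (intro mult_left_mono powr_mono2') auto
    then have "\<delta> H \<le> c0 * real N powr - \<mu>" using H(3) by simp
    then show ?thesis using c0(2)[OF N(1,3)] near_int_mono by blast
  qed
  then obtain X where X: "finite X" "\<forall>x\<in>X. \<forall>i\<in>I. \<bar>x i - c i\<bar> \<le> 3 * \<rho> / 4"
      "\<forall>x\<in>X. \<forall>y\<in>X. x \<noteq> y \<longrightarrow> (\<exists>i\<in>I. \<Delta> H < \<bar>x i - y i\<bar>)"
      "\<rho> ^ card I / (2 * 4 ^ card I * \<Delta> H ^ card I) \<le> real (card X)"
      "\<forall>x\<in>X. \<exists>q b p. q \<le> H \<and> \<epsilon> * real H < real q \<and> (\<forall>j\<in>J. \<bar>b j\<bar> \<le> int H) \<and>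
        (\<forall>i\<in>I. x i = (of_int (p i) - lin_forms J A b i) / real q)"
    using resonant_points_ubiquity[of I J j0 H "\<delta> H" A \<rho> \<epsilon> "\<Delta> H" c] I J H \<rho>
    unfolding \<delta>_def \<Delta>_def \<epsilon>_def e_def m_def a_def B_def by (auto simp: mult.assoc)
  have "\<exists>x\<in>X. thin_in_box I \<Lambda> u r t \<kappa> x (\<rho>' H)"
  proof (rule thin_sub_box_exists[OF I t(1,2) r \<rho>(1) \<rho>'0 H(6,7) X(1) _ _ \<kappa> X(4) _ thin])
    show "\<bar>x i - c i\<bar> \<le> 3 * \<rho> / 4" if "x \<in> X" "i \<in> I" for x i using X(2) that by blast
    show "\<exists>i\<in>I. \<Delta> H < \<bar>x i - y i\<bar>" if "x \<in> X" "y \<in> X" "x \<noteq> y" for x y using X(3) that by blast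
    have \<rho>'t: "\<rho>' H powr t = 1 / (2 powr t * real H powr ((\<omega> + 1) * t))"
    proof -
      have "\<rho>' H powr t = real H powr - ((\<omega> + 1) * t) / 2 powr t"
        unfolding \<rho>'_def minus_mult_left using H(1)
        by (simp only: powr_divide powr_powr powr_ge_zero)
      then show ?thesis by (simp add: powr_minus_divide)
    qed
    have \<Delta>a: "\<Delta> H ^ a = 2 ^ a / (\<epsilon> ^ a * real H powr (real m + 1 + real a))"
    proof -
      have "(real H powr - e) ^ a = real H powr (- e * real a)"
        using H(1) by (simp add: powr_powr flip: powr_realpow)
      also have "- e * real a = - (real m + 1)" using ea by simp
      also have "real H powr \<dots> = 1 / real H powr (real m + 1)" by (rule powr_minus_divide)
      finally have 1: "(real H powr - e) ^ a = 1 / real H powr (real m + 1)" .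
      have "real H ^ a = real H powr real a" using H(1) by (simp add: powr_realpow)
      then have 2: "real H powr (real m + 1 + real a) = real H powr (real m + 1) * real H ^ a"
        by (simp only: powr_add)
      show ?thesis unfolding \<Delta>_def \<delta>_def 2 by (simp add: power_mult_distrib power_divide 1)
    qed
    have "2 ^ (a + 1) * (\<rho> powr t / \<rho>' H powr t) = C1 * real H powr ((\<omega> + 1) * t)"
      unfolding \<rho>'t C1_def by simp
    also have "\<dots> < C2 * real H powr (real m + 1 + real a)" by (rule H(8))
    also have "\<dots> = \<rho> ^ a / (4 * 4 ^ a * \<Delta> H ^ a)" unfolding \<Delta>a C2_def by simp
    finally show "2 ^ (card I + 1) * (\<rho> powr t / \<rho>' H powr t) < \<rho> ^ card I / (4 * 4 ^ card I * \<Delta> H ^ card I)"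
      by (simp only: a_def)
  qed
  then obtain x where x: "x \<in> X" "thin_in_box I \<Lambda> u r t \<kappa> x (\<rho>' H)" by blast
  obtain q b p where q: "q \<le> H" "\<epsilon> * real H < real q" and b: "\<forall>j\<in>J. \<bar>b j\<bar> \<le> int H"
      and xi: "\<forall>i\<in>I. x i = (of_int (p i) - lin_forms J A b i) / real q"
    using X(5) x(1) by blast
  have "0 \<le> \<epsilon> * real H" using \<epsilon>0 by simp
  then have q0: "q > 0" using q(2) by linarith
  have wa: "\<exists>N\<ge>K. well_approx I (insert j0 J) (\<lambda>i j. if j = j0 then \<alpha> i else A i j) \<omega> N"
    if \<alpha>: "\<forall>i\<in>I. \<bar>\<alpha> i - x i\<bar> \<le> \<rho>' H" for \<alpha>
  proof -
    define b' where "b' = b(j0 := int q)"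
    have b'H: "\<bar>b' j\<bar> \<le> int H" if "j \<in> insert j0 J" for j
      using b q(1) that by (auto simp: b'_def)
    obtain N where N: "1 \<le> N" "N \<le> H" "has_height (insert j0 J) b' N"
      using has_height_le[of "insert j0 J" j0 b' H] J(1) b'H q0 by (auto simp: b'_def)
    \<comment> \<open>Since \<open>q\<close> exceeds \<open>\<epsilon> * H \<ge> K\<close>, the
      height is at least \<open>K\<close>; this is why small denominators were discarded.\<close>
    have "q \<le> N" using N(3) by (simp add: has_height_def b'_def)
    then have "N \<ge> K" using q(2) H(9) by linarith
    moreover have "near_int (real N powr - \<omega>) (lin_forms (insert j0 J) (\<lambda>i j. if j = j0 then \<alpha> i else A i j) b' i)"
      if i: "i \<in> I" for i
    proof -
      have "(\<Sum>j\<in>J. (if j = j0 then \<alpha> i else A i j) * real_of_int (b' j)) = lin_forms J A b i"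
        unfolding lin_forms_def using J(2) by (intro sum.cong) (auto simp: b'_def)
      then have "lin_forms (insert j0 J) (\<lambda>i j. if j = j0 then \<alpha> i else A i j) b' i
          = \<alpha> i * real q + lin_forms J A b i"
        using J by (simp add: lin_forms_def b'_def)
      then have "lin_forms (insert j0 J) (\<lambda>i j. if j = j0 then \<alpha> i else A i j) b' i - of_int (p i)
          = real q * (\<alpha> i - x i)"
        using xi i q0 by (simp add: field_simps)
      then have "\<bar>lin_forms (insert j0 J) (\<lambda>i j. if j = j0 then \<alpha> i else A i j) b' i - of_int (p i)\<bar>
          = real q * \<bar>\<alpha> i - x i\<bar>"
        by (simp add: abs_mult)
      also have "\<dots> \<le> real H * \<rho>' H"
        using \<alpha> i q(1) by (intro mult_mono) auto
      also have "\<dots> = real H powr - \<omega> / 2"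
        using H(1) by (simp add: \<rho>'_def powr_diff powr_minus_divide)
      also have "\<dots> < real H powr - \<omega>" using H(1) by simp
      also have "\<dots> \<le> real N powr - \<omega>"
        using N \<omega>e e0 by (intro powr_mono2') auto
      finally show ?thesis unfolding near_int_def by blast
    qed
    ultimately show ?thesis unfolding well_approx_def using N(3) by blast
  qed
  show ?thesis
    using X(2) x wa \<rho>'0 H(6) by (intro exI[of _ x] exI[of _ "\<rho>' H"]) blast
qed

text \<open>Nested boxes, starting with the box of radius \<open>1\<close> about \<open>0\<close>,
  whose thinness follows from \<open>thin\<close>; step \<open>n\<close> provides a solution of
  height at least \<open>n\<close>. The limit avoids every member \<open>l\<close>: otherwise all
  boxes would meet \<open>l\<close>, thinness for the family \<open>{l}\<close> would force
  \<open>r l \<le> \<rho> n\<close>, and \<open>\<rho> n\<close> tends to \<open>0\<close>.\<close>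

theorem well_approx_column_avoiding_thin_family:
  fixes A :: "'i \<Rightarrow> 'j \<Rightarrow> real" and u :: "'l \<Rightarrow> 'i \<Rightarrow> real"
  assumes I: "finite I" "I \<noteq> {}" and J: "finite J" "j0 \<notin> J"
    and \<mu>: "0 < \<mu>" "\<mu> < (real (card J) + 1) / real (card I)" and good: "\<not> (\<exists>\<^sub>\<infinity>N. well_approx I J A \<mu> N)"
    and \<omega>: "(real (card J) + 1) / real (card I) < \<omega>"
    and t: "0 < t" "t \<le> 1" "(\<omega> + 1) * t < real (card J) + 1 + real (card I)"
    and r: "\<And>l. l \<in> \<Lambda> \<Longrightarrow> 0 < r l"
    and thin: "\<And>F. finite F \<Longrightarrow> F \<subseteq> \<Lambda> \<Longrightarrow> (\<Sum>l\<in>F. r l powr t) \<le> 1 / (8 * 32 ^ card I)"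
  shows "\<exists>\<alpha>. (\<forall>i\<in>I. \<bar>\<alpha> i\<bar> \<le> 1) \<and> (\<forall>l\<in>\<Lambda>. \<exists>i\<in>I. r l < \<bar>\<alpha> i - u l i\<bar>) \<and>
    (\<exists>\<^sub>\<infinity>N. well_approx I (insert j0 J) (\<lambda>i j. if j = j0 then \<alpha> i else A i j) \<omega> N)"
proof -
  define \<kappa> where "\<kappa> = (1 / (8 * 32 ^ card I) :: real)"
  have \<kappa>1: "\<kappa> \<le> 1"
  proof -
    have "(1::real) \<le> 32 ^ card I" by (rule one_le_power) simp
    then have "(1::real) \<le> 8 * 32 ^ card I" by linarith
    then show ?thesis by (simp add: \<kappa>_def divide_le_eq)
  qed
  define P where "P n s = (case s of (c, \<rho>) \<Rightarrow> 0 < \<rho> \<and> \<rho> \<le> (1 / 4) ^ n \<and> thin_in_box I \<Lambda> u r t \<kappa> c \<rho> \<and>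
      (n = 0 \<longrightarrow> c = (\<lambda>_. 0)))" for n :: nat and s :: "('i \<Rightarrow> real) \<times> real"
  define S where "S n s s' = (case s of (c, \<rho>) \<Rightarrow> case s' of (c', \<rho>') \<Rightarrow> \<rho>' \<le> \<rho> / 4 \<and>
      (\<forall>i\<in>I. \<bar>c' i - c i\<bar> \<le> 3 * \<rho> / 4) \<and> (\<forall>\<alpha>. (\<forall>i\<in>I. \<bar>\<alpha> i - c' i\<bar> \<le> \<rho>') \<longrightarrow>
      (\<exists>N\<ge>n. well_approx I (insert j0 J) (\<lambda>i j. if j = j0 then \<alpha> i else A i j) \<omega> N)))"
    for n :: nat and s s' :: "('i \<Rightarrow> real) \<times> real"
  have "\<exists>f. \<forall>n. P n (f n) \<and> S n (f n) (f (Suc n))"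
  proof (rule dependent_nat_choice)
    have "thin_in_box I \<Lambda> u r t \<kappa> (\<lambda>_. 0) 1" unfolding thin_in_box_def using thin by (auto simp: \<kappa>_def)
    then show "\<exists>s. P 0 s" by (intro exI[of _ "(\<lambda>_. 0, 1)"]) (simp add: P_def)
  next
    fix s n assume "P n s"
    then obtain c \<rho> where s: "s = (c, \<rho>)" and \<rho>: "0 < \<rho>" "\<rho> \<le> (1 / 4) ^ n"
      and th: "thin_in_box I \<Lambda> u r t \<kappa> c \<rho>"
      by (auto simp: P_def split: prod.splits)
    have "\<rho> \<le> 1" using \<rho>(2) power_le_one[of "1 / 4 :: real" n] by simp
    from thin_resonant_sub_box_exists[OF I J \<mu> good \<omega> t r \<kappa>_def \<rho>(1) this th, of n]
    obtain c' \<rho>' where "0 < \<rho>'" "\<rho>' \<le> \<rho> / 4" "\<forall>i\<in>I. \<bar>c' i - c i\<bar> \<le> 3 * \<rho> / 4" "thin_in_box I \<Lambda> u r t \<kappa> c' \<rho>'"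
      "\<forall>\<alpha>. (\<forall>i\<in>I. \<bar>\<alpha> i - c' i\<bar> \<le> \<rho>') \<longrightarrow>
        (\<exists>N\<ge>n. well_approx I (insert j0 J) (\<lambda>i j. if j = j0 then \<alpha> i else A i j) \<omega> N)"
      by blast
    then show "\<exists>s'. P (Suc n) s' \<and> S n s s'"
      using \<rho> by (intro exI[of _ "(c', \<rho>')"]) (simp add: P_def S_def s)
  qed
  then obtain f where f: "\<And>n. P n (f n)" "\<And>n. S n (f n) (f (Suc n))" by blast
  define c where "c n = fst (f n)" for n
  define \<rho> where "\<rho> n = snd (f n)" for n
  have fP: "0 < \<rho> n" "\<rho> n \<le> (1 / 4) ^ n" "thin_in_box I \<Lambda> u r t \<kappa> (c n) (\<rho> n)" for n
    using f(1)[of n] by (auto simp: P_def c_def \<rho>_def split: prod.splits)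
  have c0: "c 0 = (\<lambda>_. 0)" using f(1)[of 0] by (auto simp: P_def c_def split: prod.splits)
  have fS: "\<rho> (Suc n) \<le> \<rho> n / 4" "\<And>i. i \<in> I \<Longrightarrow> \<bar>c (Suc n) i - c n i\<bar> \<le> 3 * \<rho> n / 4"
    "\<And>\<alpha>. (\<And>i. i \<in> I \<Longrightarrow> \<bar>\<alpha> i - c (Suc n) i\<bar> \<le> \<rho> (Suc n)) \<Longrightarrow>
      \<exists>N\<ge>n. well_approx I (insert j0 J) (\<lambda>i j. if j = j0 then \<alpha> i else A i j) \<omega> N" for n
    using f(2)[of n] by (auto simp: S_def c_def \<rho>_def split: prod.splits)
  \<comment> \<open>The common point of the nested boxes, coordinatewise the supremum of the left
    end points.\<close>
  define \<alpha> where "\<alpha> i = (SUP n. c n i - \<rho> n)" for i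
  have \<alpha>: "\<bar>\<alpha> i - c n i\<bar> \<le> \<rho> n" if i: "i \<in> I" for i n
  proof -
    have "c n i - \<rho> n \<le> c (Suc n) i - \<rho> (Suc n)" for n
      using fS(1)[of n] fS(2)[OF i, of n] by linarith
    then have inc: "incseq (\<lambda>n. c n i - \<rho> n)" by (rule incseq_SucI)
    have "c (Suc n) i + \<rho> (Suc n) \<le> c n i + \<rho> n" for n
      using fS(1)[of n] fS(2)[OF i, of n] by linarith
    then have dec: "decseq (\<lambda>n. c n i + \<rho> n)" by (rule decseq_SucI)
    have le: "c k i - \<rho> k \<le> c n i + \<rho> n" for k n
    proof -
      have "c k i - \<rho> k \<le> c (max k n) i - \<rho> (max k n)" using inc by (auto simp: incseq_def)
      also have "\<dots> \<le> c (max k n) i + \<rho> (max k n)" using fP(1)[of "max k n"] by simp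
      also have "\<dots> \<le> c n i + \<rho> n" using dec by (auto simp: decseq_def)
      finally show ?thesis .
    qed
    have "\<alpha> i \<le> c n i + \<rho> n" unfolding \<alpha>_def using le by (intro cSUP_least) auto
    moreover have "c n i - \<rho> n \<le> \<alpha> i"
      unfolding \<alpha>_def using le by (intro cSUP_upper bdd_aboveI2[of _ _ "c n i + \<rho> n"]) auto
    ultimately show ?thesis by linarith
  qed
  have "\<bar>\<alpha> i\<bar> \<le> 1" if "i \<in> I" for i
    using \<alpha>[OF that, of 0] fP(2)[of 0] c0 by simp
  moreover have "\<exists>i\<in>I. r l < \<bar>\<alpha> i - u l i\<bar>" if l: "l \<in> \<Lambda>" for l
  proof (rule ccontr)
    assume "\<not> ?thesis"
    then have close: "\<bar>\<alpha> i - u l i\<bar> \<le> r l" if "i \<in> I" for i using that by force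
    have "r l \<le> \<rho> n" for n
    proof (rule ccontr)
      assume "\<not> r l \<le> \<rho> n"
      then have "\<rho> n powr t < r l powr t" using fP(1)[of n] t(1) by (intro powr_less_mono2) auto
      have "\<bar>u l i - c n i\<bar> \<le> r l + \<rho> n" if "i \<in> I" for i
        using close[OF that] \<alpha>[OF that, of n] by linarith
      then have "{l} \<subseteq> {l \<in> \<Lambda>. meets I (u l) (r l) (c n) (\<rho> n)}" using l by (simp add: meets_def)
      then have "r l powr t \<le> \<kappa> * \<rho> n powr t"
        using fP(3)[of n, unfolded thin_in_box_def, rule_format, of "{l}"] by simp
      also have "\<dots> \<le> 1 * \<rho> n powr t" using \<kappa>1 by (intro mult_right_mono) auto
      finally show False using \<open>\<rho> n powr t < r l powr t\<close> by simp
    qed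
    moreover obtain n where "(1 / 4) ^ n < r l"
      using real_arch_pow_inv[of "r l" "1 / 4"] r[OF l] by auto
    ultimately show False using fP(2)[of n] by (smt (verit))
  qed
  moreover have "\<exists>\<^sub>\<infinity>N. well_approx I (insert j0 J) (\<lambda>i j. if j = j0 then \<alpha> i else A i j) \<omega> N"
    unfolding INFM_nat_le using fS(3)[OF \<alpha>] by blast
  ultimately show ?thesis by blast
qed

section \<open>The dimension of the set of non-extremal subspaces\<close>

lemma hausdorff_measure_countable_UN_0:
  fixes E :: "'k \<Rightarrow> 'a::metric_space set"
  assumes K: "countable K" and null: "\<And>k. k \<in> K \<Longrightarrow> hausdorff_measure s (E k) = 0"
  shows "hausdorff_measure s (\<Union>k\<in>K. E k) = 0"
proof (cases "K = {}")
  case True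
  have "hausdorff_measure s ({} :: 'a set) = 0"
    by (rule hausdorff_measure_eq_0I) (rule exI[of _ "\<lambda>_. {}"], simp add: diameter_def)
  then show ?thesis using True by simp
next
  case False
  have "(\<Union>k\<in>K. E k) = (\<Union>l. E (from_nat_into K l))"
    using range_from_nat_into[OF False K] by (metis image_image)
  then show ?thesis
    using null from_nat_into[OF False] hausdorff_measure_UN_0[of s "\<lambda>l. E (from_nat_into K l)"] by simp
qed

text \<open>The map from matrices to the Grassmannian is Lipschitz, so the boxes of the cover become
  sets of diameter about \<open>N powr - (\<omega> + 1)\<close>. Their \<open>s\<close>-weight at
  height \<open>N\<close> has order \<open>N powr (e - (\<omega> + 1) * s)\<close>, and
  \<open>exponent\<close> says that this power is summable.\<close>

lemma hausdorff_measure_chart_well_approx_0: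
  fixes D :: "'n::finite set"
  assumes D: "card D = d" and nd: "CARD('n) = d + m" and \<omega>: "0 < \<omega>" and R: "0 \<le> R" and s: "0 < s"
    and exponent: "real (d + m) + 1 < (\<omega> + 1) * (s - (real d + 1) * (real m - 1))"
  shows "hausdorff_measure s ((\<lambda>A. grassmann_point (chart_subspace D A)) `
    {A. (\<forall>i\<in>chart_index D. \<forall>j\<in>- D. \<bar>A i j\<bar> \<le> R) \<and> (\<exists>\<^sub>\<infinity>N. well_approx (chart_index D) (- D) A \<omega> N)}) = 0"
proof -
  define I where "I = chart_index D"
  define J where "J = - D"
  define g where "g A = grassmann_point (chart_subspace D A)" for A :: "'n option \<Rightarrow> 'n \<Rightarrow> real"
  have fin: "finite I" "finite J" by (simp_all add: I_def J_def finite_chart_index)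
  have cI: "real (card I) = real d + 1" by (simp add: I_def card_chart_index D)
  have cJ: "card J = m" unfolding J_def Compl_eq_Diff_UNIV using D nd by (simp add: card_Diff_subset)
  define e where "e = real m - 1 + (real d + 1) + (\<omega> + 1) * ((real d + 1) * (real m - 1))"
  define \<rho> where "\<rho> N = real (m + 1) * real N powr - (\<omega> + 1)" for N :: nat
  obtain C X where C: "C > 0" and X: "\<And>N. finite (X N)" "\<And>N. real (card (X N)) \<le> C * real N powr e"
    "\<And>N A. N \<ge> 1 \<Longrightarrow> \<forall>i\<in>I. \<forall>j\<in>J. \<bar>A i j\<bar> \<le> R \<Longrightarrow> well_approx I J A \<omega> N \<Longrightarrow>
      \<exists>Y\<in>X N. \<forall>i\<in>I. \<forall>j\<in>J. \<bar>A i j - Y i j\<bar> \<le> \<rho> N"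
    by (rule well_approx_cover_sequence[OF fin \<omega> R, unfolded cI cJ, folded e_def \<rho>_def]) blast
  define U where "U N Y = g ` {A. \<forall>i\<in>I. \<forall>j\<in>J. \<bar>A i j - Y i j\<bar> \<le> \<rho> N}" for N Y
  define c where "c = 4 * (real CARD('n) * (real CARD('n) + 1)) * real (m + 1)"
  define r where "r N = c * real N powr - (\<omega> + 1)" for N :: nat
  have c0: "c \<ge> 0" by (simp add: c_def)
  have \<rho>0: "\<rho> N \<ge> 0" for N by (simp add: \<rho>_def)
  have dist: "dist x y \<le> r N" if x: "x \<in> U N Y" and y: "y \<in> U N Y" for x y N Y
  proof -
    obtain A B where AB: "x = g A" "y = g B" "\<forall>i\<in>I. \<forall>j\<in>J. \<bar>A i j - Y i j\<bar> \<le> \<rho> N"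
      "\<forall>i\<in>I. \<forall>j\<in>J. \<bar>B i j - Y i j\<bar> \<le> \<rho> N"
      using x y by (auto simp: U_def)
    have "\<bar>A i j - B i j\<bar> \<le> 2 * \<rho> N" if "i \<in> I" "j \<in> J" for i j
      using AB(3,4) that by (smt (verit))
    then have "dist (g A) (g B) \<le> 2 * (real CARD('n) * (real CARD('n) + 1)) * (2 * \<rho> N)"
      unfolding g_def using \<rho>0[of N] by (intro dist_grassmann_chart_le) (auto simp: I_def J_def)
    also have "\<dots> = r N" by (simp add: r_def c_def \<rho>_def)
    finally show ?thesis by (simp add: AB)
  qed
  have r0: "0 \<le> r N" for N using c0 by (simp add: r_def)
  show ?thesis
  proof (rule hausdorff_measure_limsup_0[OF s, of X U r])
    show "finite (X N)" for N by (rule X(1))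
    show "bounded (U N Y)" for N Y
    proof (cases "U N Y = {}")
      case False
      then obtain x where "x \<in> U N Y" by blast
      then show ?thesis unfolding bounded_def using dist by blast
    qed simp
    show "diameter (U N Y) \<le> r N" for N Y
      using r0 dist by (intro diameter_le) (auto simp: dist_norm)
    show "r \<longlonglongrightarrow> 0" unfolding r_def using \<omega> by real_asymp
    show "0 \<le> r N" for N by (rule r0)
    show "summable (\<lambda>N. real (card (X N)) * r N powr s)"
    proof (rule summable_comparison_test'[where N = 0])
      have "e - (\<omega> + 1) * s = real (d + m) - (\<omega> + 1) * (s - (real d + 1) * (real m - 1))"
        by (simp add: e_def algebra_simps)
      then have "e - (\<omega> + 1) * s < - 1" using exponent by linarith
      then have "summable (\<lambda>N. real N powr (e - (\<omega> + 1) * s))" by (simp add: summable_real_powr_iff)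
      then show "summable (\<lambda>N. C * c powr s * real N powr (e - (\<omega> + 1) * s))" by (rule summable_mult)
      show "norm (real (card (X N)) * r N powr s) \<le> C * c powr s * real N powr (e - (\<omega> + 1) * s)" for N
      proof -
        have "real (card (X N)) * r N powr s \<le> C * real N powr e * r N powr s"
          by (intro mult_right_mono X(2)) auto
        moreover have "r N powr s = c powr s * real N powr (- ((\<omega> + 1) * s))"
          unfolding r_def minus_mult_left using c0 by (simp only: powr_mult powr_powr powr_ge_zero)
        moreover have "real N powr e * real N powr (- ((\<omega> + 1) * s)) = real N powr (e - (\<omega> + 1) * s)"
          by (simp only: powr_add[symmetric] diff_conv_add_uminus)
        ultimately have "real (card (X N)) * r N powr s \<le> C * c powr s * real N powr (e - (\<omega> + 1) * s)"
          by (metis mult.assoc mult.left_commute)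
        then show ?thesis by simp
      qed
    qed
    fix y assume "y \<in> (\<lambda>A. grassmann_point (chart_subspace D A)) `
      {A. (\<forall>i\<in>chart_index D. \<forall>j\<in>- D. \<bar>A i j\<bar> \<le> R) \<and> (\<exists>\<^sub>\<infinity>N. well_approx (chart_index D) (- D) A \<omega> N)}"
    then obtain A where A: "y = g A" "\<forall>i\<in>I. \<forall>j\<in>J. \<bar>A i j\<bar> \<le> R" "\<exists>\<^sub>\<infinity>N. well_approx I J A \<omega> N"
      unfolding g_def I_def J_def by blast
    show "\<exists>\<^sub>\<infinity>N. \<exists>Y\<in>X N. y \<in> U N Y"
      unfolding INFM_nat_le
    proof
      fix K
      obtain N where N: "N \<ge> max 1 K" "well_approx I J A \<omega> N"
        using A(3) unfolding INFM_nat_le by blast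
      then obtain Y where "Y \<in> X N" "\<forall>i\<in>I. \<forall>j\<in>J. \<bar>A i j - Y i j\<bar> \<le> \<rho> N"
        using X(3)[of N A] A(2) by auto
      then show "\<exists>N\<ge>K. \<exists>Y\<in>X N. y \<in> U N Y"
        using N A(1) by (intro exI[of _ N]) (auto simp: U_def)
    qed
  qed
qed

lemma hausdorff_measure_non_extremal_0:
  assumes n: "CARD('n::finite) = d + m" and dm: "d \<ge> 1" "m \<ge> 1"
    and s: "(real d + 1) * real m - real d < s"
  shows "hausdorff_measure s (grassmann_point ` {L \<in> affine_subspaces d. \<not> extremal (L :: (real ^ 'n) set)}) = 0"
proof -
  define v where "v = s - (real d + 1) * (real m - 1)"
  have v: "v > 1" using s by (simp add: v_def algebra_simps)
  have "0 \<le> (real d + 1) * (real m - 1)" using dm by simp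
  then have s0: "s > 0" using v by (simp add: v_def)
  define n1 where "n1 = real (d + m) + 1"
  have n1: "n1 \<ge> 3" using dm by (simp add: n1_def)
  have average: "x < (x + y) / 2 \<and> (x + y) / 2 < y" if "x < y" for x y :: real
    using that by simp
  \<comment> \<open>\<open>\<omega> + 1\<close> is the midpoint of \<open>n1 / v\<close> and
    \<open>n1\<close>: above the first for the convergence of the cover, below the second for
    \<open>\<omega> < n\<close>.\<close>
  define \<omega> where "\<omega> = (n1 / v + n1) / 2 - 1"
  have "n1 / v > 0" using n1 v by simp
  then have \<omega>0: "\<omega> > 0" using n1 by (simp add: \<omega>_def field_simps)
  have "n1 / v < n1" using n1 v by (simp add: field_simps)
  then have "\<omega> < n1 - 1" unfolding \<omega>_def using average[of "n1 / v" n1] by simp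
  then have \<omega>n: "\<omega> < real CARD('n)" by (simp add: n1_def n)
  have "(\<omega> + 1) * v = (n1 + n1 * v) / 2" using v by (simp add: \<omega>_def field_simps)
  moreover have "n1 * 1 < n1 * v" using n1 v by (intro mult_strict_left_mono) auto
  ultimately have "n1 < (\<omega> + 1) * v" using average[of n1 "n1 * v"] by simp
  then have exponent: "real (d + m) + 1 < (\<omega> + 1) * v" by (simp only: n1_def)
  \<comment> \<open>Finitely many charts, each exhausted by countably many bounded sets of matrices,
    because the cover needs bounded entries.\<close>
  define E where "E = (\<lambda>(D :: 'n set, R :: nat). (\<lambda>A. grassmann_point (chart_subspace D A)) `
    {A. (\<forall>i\<in>chart_index D. \<forall>j\<in>- D. \<bar>A i j\<bar> \<le> real R) \<and> (\<exists>\<^sub>\<infinity>N. well_approx (chart_index D) (- D) A \<omega> N)})"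
  define K where "K = {D :: 'n set. card D = d} \<times> (UNIV :: nat set)"
  have "countable K" unfolding K_def by (rule countable_SIGMA) (auto intro: countable_finite)
  moreover have "hausdorff_measure s (E k) = 0" if "k \<in> K" for k
    using that exponent \<omega>0 s0 n unfolding E_def K_def v_def
    by (auto intro!: hausdorff_measure_chart_well_approx_0)
  ultimately have "hausdorff_measure s (\<Union>k\<in>K. E k) = 0" by (rule hausdorff_measure_countable_UN_0)
  moreover have "grassmann_point ` {L \<in> affine_subspaces d. \<not> extremal (L :: (real ^ 'n) set)} \<subseteq> (\<Union>k\<in>K. E k)"
  proof clarify
    fix L :: "(real ^ 'n) set" assume L: "L \<in> affine_subspaces d" "\<not> extremal L"
    obtain D A where D: "card D = d" "L = chart_subspace D A" using affine_subspace_is_chart[OF L(1)] by blast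
    have wa: "\<exists>\<^sub>\<infinity>N. well_approx (chart_index D) (- D) A \<omega> N"
      using extremal_chart_subspace[OF \<omega>0 \<omega>n] L(2) D(2) by blast
    obtain R :: nat where R: "(\<Sum>i\<in>chart_index D. \<Sum>j\<in>- D. \<bar>A i j\<bar>) \<le> real R" using real_arch_simple by blast
    have "\<bar>A i j\<bar> \<le> real R" if "i \<in> chart_index D" "j \<in> - D" for i j
      using abs_entry_le_sum[of "chart_index D" "- D" i j A] that R finite_chart_index[of D] by simp
    then have "grassmann_point L \<in> E (D, R)" unfolding E_def prod.case D(2) using wa by blast
    moreover have "(D, R) \<in> K" using D by (simp add: K_def)
    ultimately show "grassmann_point L \<in> (\<Union>k\<in>K. E k)" by blast
  qed
  ultimately show ?thesis by (rule hausdorff_measure_subset_0)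
qed

section \<open>Lower bound for the dimension\<close>

lemma AE_not_well_approx:
  fixes I :: "'i set" and J :: "'j set"
  assumes I: "finite I" and J: "finite J" and \<mu>: "0 < \<mu>" "real (card J) < \<mu> * real (card I)"
  shows "AE B in (\<Pi>\<^sub>M ij\<in>I \<times> J. (lborel :: real measure)).
    (\<forall>i\<in>I. \<forall>j\<in>J. \<bar>B (i, j)\<bar> \<le> 1) \<longrightarrow> \<not> (\<exists>\<^sub>\<infinity>N. well_approx I J (\<lambda>i j. B (i, j)) \<mu> N)"
proof -
  interpret product_sigma_finite "\<lambda>_::'i \<times> 'j. lborel :: real measure" by standard
  define M where "M = (\<Pi>\<^sub>M ij\<in>I \<times> J. (lborel :: real measure))"
  define a where "a = card I"
  define m where "m = card J"
  define e where "e = real m - 1 + real a + (\<mu> + 1) * (real a * (real m - 1))"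
  define \<rho> where "\<rho> N = real (m + 1) * real N powr - (\<mu> + 1)" for N :: nat
  have \<rho>0: "\<rho> N \<ge> 0" for N by (simp add: \<rho>_def)
  have finIJ: "finite (I \<times> J)" and cardIJ: "card (I \<times> J) = a * m"
    using I J by (simp_all add: a_def m_def card_cartesian_product)
  obtain C X where C: "C > 0" and X: "\<And>N. finite (X N)" "\<And>N. real (card (X N)) \<le> C * real N powr e"
    "\<And>N A. N \<ge> 1 \<Longrightarrow> \<forall>i\<in>I. \<forall>j\<in>J. \<bar>A i j\<bar> \<le> 1 \<Longrightarrow> well_approx I J A \<mu> N \<Longrightarrow>
      \<exists>Y\<in>X N. \<forall>i\<in>I. \<forall>j\<in>J. \<bar>A i j - Y i j\<bar> \<le> \<rho> N"
    by (rule well_approx_cover_sequence[OF I J \<mu>(1) zero_le_one, folded a_def m_def, folded e_def \<rho>_def]) blast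
  define Box where "Box N Y = (\<Pi>\<^sub>E ij\<in>I \<times> J. {Y (fst ij) (snd ij) - \<rho> N..Y (fst ij) (snd ij) + \<rho> N})"
    for N and Y :: "'i \<Rightarrow> 'j \<Rightarrow> real"
  have Box: "Box N Y \<in> sets M" "emeasure M (Box N Y) = ennreal ((2 * \<rho> N) ^ (a * m))" for N Y
  proof -
    show "Box N Y \<in> sets M" unfolding Box_def M_def using finIJ by (intro sets_PiM_I_finite) auto
    have "emeasure M (Box N Y) = (\<Prod>ij\<in>I \<times> J. emeasure lborel {Y (fst ij) (snd ij) - \<rho> N..Y (fst ij) (snd ij) + \<rho> N})"
      unfolding Box_def M_def using finIJ by (intro emeasure_PiM) auto
    also have "\<dots> = ennreal ((2 * \<rho> N) ^ (a * m))" using \<rho>0[of N] by (simp add: cardIJ ennreal_power)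
    finally show "emeasure M (Box N Y) = ennreal ((2 * \<rho> N) ^ (a * m))" .
  qed
  define W where "W N = (\<Union>Y\<in>X N. Box N Y)" for N
  have W: "W N \<in> sets M" for N unfolding W_def using X(1) Box(1) by (intro sets.finite_UN) auto
  define c where "c = 2 * real (m + 1)"
  have bound: "real (card (X N)) * (2 * \<rho> N) ^ (a * m) \<le> C * c ^ (a * m) * real N powr (real m - 1 - \<mu> * real a)" for N
  proof (cases "N = 0")
    case False
    have "(2 * \<rho> N) ^ (a * m) = c ^ (a * m) * (real N powr - (\<mu> + 1)) ^ (a * m)"
      by (simp only: \<rho>_def c_def power_mult_distrib mult.assoc)
    moreover have "(real N powr - (\<mu> + 1)) ^ (a * m) = real N powr (- (\<mu> + 1) * real (a * m))"
      using False by (subst powr_realpow[symmetric]) (simp_all only: powr_powr powr_gt_zero of_nat_eq_0_iff not_False_eq_True)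
    moreover have "real (card (X N)) * (2 * \<rho> N) ^ (a * m) \<le> C * real N powr e * (2 * \<rho> N) ^ (a * m)"
      using \<rho>0[of N] by (intro mult_right_mono X(2)) auto
    ultimately have "real (card (X N)) * (2 * \<rho> N) ^ (a * m)
        \<le> C * c ^ (a * m) * (real N powr e * real N powr (- (\<mu> + 1) * real (a * m)))"
      by (simp only: mult_ac)
    also have "real N powr e * real N powr (- (\<mu> + 1) * real (a * m)) = real N powr (e + (- (\<mu> + 1) * real (a * m)))"
      by (simp only: powr_add)
    also have "e + (- (\<mu> + 1) * real (a * m)) = real m - 1 - \<mu> * real a" by (simp add: e_def algebra_simps)
    finally show ?thesis .
  qed (use X(2)[of 0] in simp)
  have eW: "emeasure M (W N) \<le> ennreal (C * c ^ (a * m) * real N powr (real m - 1 - \<mu> * real a))" for N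
  proof -
    have "emeasure M (W N) \<le> (\<Sum>Y\<in>X N. emeasure M (Box N Y))"
      unfolding W_def using X(1) Box(1) by (intro emeasure_subadditive_finite) auto
    also have "\<dots> = ennreal (real (card (X N)) * (2 * \<rho> N) ^ (a * m))"
      using \<rho>0[of N] by (simp add: Box(2) ennreal_mult ennreal_of_nat_eq_real_of_nat)
    also have "\<dots> \<le> ennreal (C * c ^ (a * m) * real N powr (real m - 1 - \<mu> * real a))"
      by (intro ennreal_leI bound)
    finally show ?thesis .
  qed
  have fW: "emeasure M (W N) < \<infinity>" for N using eW[of N] by (auto simp: less_top[symmetric] top_unique)
  \<comment> \<open>The convergence case of the Khintchine-Groshev theorem for a power:
    \<open>\<mu> * card I > card J\<close> makes the exponent smaller than
    \<open>- 1\<close>.\<close>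
  have "summable (\<lambda>N. real N powr (real m - 1 - \<mu> * real a))"
    using \<mu>(2) by (simp add: summable_real_powr_iff m_def a_def)
  then have "summable (\<lambda>N. C * c ^ (a * m) * real N powr (real m - 1 - \<mu> * real a))" by (rule summable_mult)
  then have "summable (\<lambda>N. measure M (W N))"
  proof (rule summable_comparison_test'[where N = 0])
    fix N :: nat
    have "ennreal (measure M (W N)) \<le> ennreal (C * c ^ (a * m) * real N powr (real m - 1 - \<mu> * real a))"
      using eW[of N] fW[of N] by (simp add: emeasure_eq_ennreal_measure less_top)
    then show "norm (measure M (W N)) \<le> C * c ^ (a * m) * real N powr (real m - 1 - \<mu> * real a)"
      using C by (subst (asm) ennreal_le_iff) (auto simp: c_def)
  qed
  then have "limsup W \<in> null_sets M" by (intro borel_cantelli_limsup1 W fW)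
  then have "AE B in M. B \<notin> limsup W" by (rule AE_not_in)
  then have "AE B in M. (\<forall>i\<in>I. \<forall>j\<in>J. \<bar>B (i, j)\<bar> \<le> 1) \<longrightarrow> \<not> (\<exists>\<^sub>\<infinity>N. well_approx I J (\<lambda>i j. B (i, j)) \<mu> N)"
    using AE_space
  proof eventually_elim
    case (elim B)
    show ?case
    proof (intro impI notI)
      assume B1: "\<forall>i\<in>I. \<forall>j\<in>J. \<bar>B (i, j)\<bar> \<le> 1" and wa: "\<exists>\<^sub>\<infinity>N. well_approx I J (\<lambda>i j. B (i, j)) \<mu> N"
      have "\<exists>N\<ge>K. B \<in> W N" for K
      proof -
        obtain N where N: "N \<ge> max 1 K" "well_approx I J (\<lambda>i j. B (i, j)) \<mu> N"
          using wa unfolding INFM_nat_le by blast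
        then obtain Y where Y: "Y \<in> X N" "\<forall>i\<in>I. \<forall>j\<in>J. \<bar>B (i, j) - Y i j\<bar> \<le> \<rho> N"
          using X(3)[of N "\<lambda>i j. B (i, j)"] B1 by auto
        have "B \<in> Box N Y"
          using elim(2) Y(2) unfolding Box_def M_def space_PiM
          by (auto simp: PiE_iff abs_le_iff) (smt (verit))+
        then show ?thesis using N Y(1) by (intro exI[of _ N]) (auto simp: W_def)
      qed
      then show False using elim(1) by (auto simp: limsup_INF_SUP)
    qed
  qed
  then show ?thesis unfolding M_def .
qed

text \<open>A cover of \<open>E\<close> of small \<open>s\<close>-weight becomes a family of boxes
  in one chart. For fixed columns \<open>B\<close>, the function \<open>G B\<close> is the total
  weight, with exponent \<open>t\<close>, of the boxes whose projection to these columns contains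
  \<open>B\<close>. If it is below \<open>\<kappa>\<close>, a last column avoids all the slices,
  which yields a non-extremal subspace outside the cover. So \<open>G\<close> is at least
  \<open>\<kappa>\<close> almost everywhere on the box of radius \<open>1\<close>, against the small
  integral that the cover allows.\<close>

lemma hausdorff_measure_non_extremal_neq_0:
  assumes n: "CARD('n::finite) = d + m" and dm: "d \<ge> 1" "m \<ge> 1"
    and s: "0 < s" "s < (real d + 1) * real m - real d"
  shows "hausdorff_measure s (grassmann_point ` {L \<in> affine_subspaces d. \<not> extremal (L :: (real ^ 'n) set)}) \<noteq> 0"
proof
  define E where "E = grassmann_point ` {L \<in> affine_subspaces d. \<not> extremal (L :: (real ^ 'n) set)}"
  assume "hausdorff_measure s (grassmann_point ` {L \<in> affine_subspaces d. \<not> extremal (L :: (real ^ 'n) set)}) = 0"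
  then have null: "hausdorff_measure s E = 0" by (simp add: E_def)
  obtain D :: "'n set" where D: "card D = d"
    using obtain_subset_with_card_n[of d "UNIV :: 'n set"] n by auto
  define I where "I = chart_index D"
  have I: "finite I" "I \<noteq> {}" by (simp_all add: I_def finite_chart_index) (simp add: chart_index_def)
  have cardD': "card (- D) = m" unfolding Compl_eq_Diff_UNIV using D n by (simp add: card_Diff_subset)
  then have "- D \<noteq> {}" using dm by auto
  then obtain j0 where j0: "j0 \<in> - D" by blast
  define J where "J = - D - {j0}"
  have J: "finite J" "j0 \<notin> J" "insert j0 J = - D" using j0 by (auto simp: J_def)
  have cardJ: "real (card J) + 1 = real m" using cardD' j0 dm by (simp add: J_def of_nat_diff)
  define a where "a = card I"
  have a: "a = d + 1" by (simp add: a_def I_def card_chart_index D)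
  define am where "am = a * card J"
  have am: "real am = (real d + 1) * (real m - 1)"
  proof -
    have "real (card J) = real m - 1" using cardJ by simp
    then show ?thesis unfolding am_def a of_nat_mult by (simp only: of_nat_add of_nat_1)
  qed
  \<comment> \<open>The bound on \<open>s\<close> gives \<open>s - am < 1\<close>; the maximum with
    \<open>1 / 2\<close> keeps \<open>t\<close> positive.\<close>
  define t where "t = max (1 / 2) (s - real am)"
  have t: "0 < t" "t < 1" "s \<le> real am + t" using s by (auto simp: t_def am algebra_simps)
  define n1 where "n1 = real (d + m) + 1"
  have n1: "n1 > 1" using dm by (simp add: n1_def)
  \<comment> \<open>\<open>\<omega> + 1\<close> is the midpoint of \<open>n1\<close> and
    \<open>n1 / t\<close>: above the first for non-extremality, below the second for the theorem on
    columns.\<close>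
  define \<omega> where "\<omega> = (n1 + n1 / t) / 2 - 1"
  have average: "x < (x + y) / 2 \<and> (x + y) / 2 < y" if "x < y" for x y :: real
    using that by simp
  have "n1 < n1 / t" using n1 t by (simp add: field_simps)
  from average[OF this] have \<omega>n: "n1 - 1 < \<omega>" and \<omega>t': "\<omega> + 1 < n1 / t" by (simp_all add: \<omega>_def)
  have \<omega>t: "(\<omega> + 1) * t < real (card J) + 1 + real (card I)"
    using \<omega>t' t a cardJ by (simp add: a_def n1_def field_simps)
  have \<omega>n': "real CARD('n) < \<omega>" using \<omega>n by (simp add: n1_def n)
  have \<omega>e: "(real (card J) + 1) / real (card I) < \<omega>"
  proof -
    have "(real (card J) + 1) / real (card I) \<le> real m / 1"
      unfolding cardJ a_def[symmetric] a by (intro divide_left_mono) auto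
    also have "\<dots> < \<omega>" using \<omega>n by (simp add: n1_def)
    finally show ?thesis .
  qed
  \<comment> \<open>Strictly between \<open>card J / a\<close>, beyond which almost no matrix with
    columns \<open>J\<close> is well approximable, and \<open>(card J + 1) / a\<close>, the
    Dirichlet exponent with one more column.\<close>
  define \<mu> where "\<mu> = (real (card J) + 1 / 2) / real a"
  have \<mu>: "0 < \<mu>" "\<mu> < (real (card J) + 1) / real (card I)" "real (card J) < \<mu> * real (card I)"
    by (simp_all add: \<mu>_def a a_def[symmetric] divide_strict_right_mono add_nonneg_pos)
  define \<kappa> where "\<kappa> = (1 / (8 * 32 ^ card I) :: real)"
  have \<kappa>0: "\<kappa> > 0" by (simp add: \<kappa>_def)
  define g where "g A = grassmann_point (chart_subspace D A)" for A :: "'n option \<Rightarrow> 'n \<Rightarrow> real"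
  define bdd where "bdd A \<longleftrightarrow> (\<forall>i\<in>I. \<forall>j\<in>- D. \<bar>A i j\<bar> \<le> 1)" for A :: "'n option \<Rightarrow> 'n \<Rightarrow> real"
  define c where "c = (real CARD('n) + 2)\<^sup>2"
  have c0: "c > 0" by (simp add: c_def)
  have lip: "\<bar>A i j - B i j\<bar> \<le> c * dist (g A) (g B)" if "bdd A" "bdd B" "i \<in> I" "j \<in> - D" for A B i j
    unfolding c_def g_def using that by (intro chart_coordinate_diff_le) (auto simp: bdd_def I_def)
  define \<sigma> where "\<sigma> = real am + t"
  have \<sigma>: "\<sigma> > 0" "s \<le> \<sigma>" using t by (auto simp: \<sigma>_def)
  \<comment> \<open>Makes \<open>c powr \<sigma> * \<epsilon> + \<epsilon> = \<kappa> / 2\<close>,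
    the first term for the diameters and the second for \<open>\<eta>\<close>.\<close>
  define \<epsilon> where "\<epsilon> = \<kappa> / (2 * (c powr \<sigma> + 1))"
  have cs: "c powr \<sigma> + 1 > 0" by (simp add: add_nonneg_pos)
  have \<epsilon>: "\<epsilon> > 0" using \<kappa>0 cs by (simp add: \<epsilon>_def)
  from hausdorff_measure_eq_0D[OF null zero_less_one \<epsilon>]
  obtain U :: "nat \<Rightarrow> ((real \<times> (real ^ 'n)) \<Rightarrow>\<^sub>L (real \<times> (real ^ 'n))) set" where
    U': "E \<subseteq> (\<Union>l. U l) \<and> (\<forall>l. bounded (U l) \<and> diameter (U l) \<le> 1) \<and>
      (\<Sum>l. ennreal (diameter (U l) powr s)) \<le> ennreal \<epsilon>"
    by (rule exE) blast
  then have U: "E \<subseteq> (\<Union>l. U l)" "\<And>l. bounded (U l)" "\<And>l. diameter (U l) \<le> 1"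
    "(\<Sum>l. ennreal (diameter (U l) powr s)) \<le> ennreal \<epsilon>"
    by simp_all
  \<comment> \<open>A set of the cover is replaced by a box about one of its own bounded matrices,
    since on bounded matrices the coordinates are Lipschitz functions of the point of the
    Grassmannian.\<close>
  define ctr where "ctr l = (SOME A. bdd A \<and> g A \<in> U l)" for l
  define \<Lambda>0 where "\<Lambda>0 = {l. \<exists>A. bdd A \<and> g A \<in> U l}"
  have ctr: "bdd (ctr l) \<and> g (ctr l) \<in> U l" if "l \<in> \<Lambda>0" for l
    unfolding ctr_def using that someI_ex[of "\<lambda>A. bdd A \<and> g A \<in> U l"] by (simp add: \<Lambda>0_def)
  \<comment> \<open>A set of diameter \<open>0\<close> would give a box of radius \<open>0\<close>,
    but the theorem on columns needs positive radii; the \<open>\<eta> l\<close> have total weight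
    \<open>\<epsilon>\<close>.\<close>
  define \<eta> where "\<eta> l = (\<epsilon> * (1 / 2) ^ Suc l) powr (1 / \<sigma>)" for l :: nat
  have \<eta>: "\<eta> l > 0" "\<eta> l powr \<sigma> = \<epsilon> * (1 / 2) ^ Suc l" for l
    using \<epsilon> \<sigma> by (simp_all add: \<eta>_def powr_powr)
  define r where "r l = max (c * diameter (U l)) (\<eta> l)" for l
  have r0: "r l > 0" for l using \<eta>(1)[of l] by (simp add: r_def)
  have diam0: "0 \<le> diameter (U l)" for l by (rule diameter_ge_0[OF U(2)])
  have r\<sigma>: "r l powr \<sigma> \<le> c powr \<sigma> * diameter (U l) powr s + \<epsilon> * (1 / 2) ^ Suc l" for l
  proof -
    have "r l powr \<sigma> \<le> (c * diameter (U l)) powr \<sigma> + \<eta> l powr \<sigma>"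
      unfolding r_def max_def by auto
    also have "(c * diameter (U l)) powr \<sigma> = c powr \<sigma> * diameter (U l) powr \<sigma>"
      using c0 diam0 by (simp add: powr_mult)
    \<comment> \<open>The diameters are at most \<open>1\<close>, so the exponent \<open>s\<close>
      may be raised to \<open>\<sigma>\<close>.\<close>
    also have "c powr \<sigma> * diameter (U l) powr \<sigma> \<le> c powr \<sigma> * diameter (U l) powr s"
      using U(3)[of l] diam0[of l] \<sigma> by (intro mult_left_mono powr_mono') auto
    finally show ?thesis by (simp add: \<eta>)
  qed
  have sum_r: "(\<Sum>l. ennreal (r l powr \<sigma>)) \<le> ennreal (\<kappa> / 2)"
  proof -
    have "(\<Sum>l. ennreal (r l powr \<sigma>))
        \<le> (\<Sum>l. ennreal (c powr \<sigma>) * ennreal (diameter (U l) powr s) + ennreal (\<epsilon> * (1 / 2) ^ Suc l))"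
    proof (rule suminf_le)
      show "ennreal (r l powr \<sigma>)
          \<le> ennreal (c powr \<sigma>) * ennreal (diameter (U l) powr s) + ennreal (\<epsilon> * (1 / 2) ^ Suc l)" for l
        using ennreal_leI[OF r\<sigma>[of l]] \<epsilon> by (simp add: ennreal_plus ennreal_mult del: power_Suc)
    qed auto
    also have "\<dots> = ennreal (c powr \<sigma>) * (\<Sum>l. ennreal (diameter (U l) powr s)) + (\<Sum>l. ennreal (\<epsilon> * (1 / 2) ^ Suc l))"
      by (simp add: suminf_add[symmetric] del: power_Suc)
    also have "(\<Sum>l. ennreal (\<epsilon> * (1 / 2) ^ Suc l)) = ennreal \<epsilon>"
      using \<epsilon> sums_mult[OF power_half_series, of \<epsilon>] by (intro suminf_ennreal_eq) auto
    also have "ennreal (c powr \<sigma>) * (\<Sum>l. ennreal (diameter (U l) powr s)) + ennreal \<epsilon>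
        \<le> ennreal (c powr \<sigma>) * ennreal \<epsilon> + ennreal \<epsilon>"
      by (intro add_right_mono mult_left_mono U(4)) auto
    also have "\<dots> = ennreal (\<kappa> / 2)"
    proof -
      have "x * (\<kappa> / (2 * x)) = \<kappa> / 2" if "x > 0" for x using that by (simp add: field_simps)
      from this[OF cs] have "c powr \<sigma> * \<epsilon> + \<epsilon> = \<kappa> / 2"
        unfolding \<epsilon>_def[symmetric] by (simp add: algebra_simps)
      moreover have "ennreal (c powr \<sigma>) * ennreal \<epsilon> + ennreal \<epsilon> = ennreal (c powr \<sigma> * \<epsilon> + \<epsilon>)"
        using \<epsilon> by (simp add: ennreal_mult)
      ultimately show ?thesis by (simp only:)
    qed
    finally show ?thesis .
  qed
  interpret product_sigma_finite "\<lambda>_::'n option \<times> 'n. lborel :: real measure" by standard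
  define M where "M = (\<Pi>\<^sub>M ij\<in>I \<times> J. (lborel :: real measure))"
  have finIJ: "finite (I \<times> J)" and cardIJ: "card (I \<times> J) = am"
    using I J by (simp_all add: a_def am_def card_cartesian_product)
  define Box where "Box Y u = (\<Pi>\<^sub>E ij\<in>I \<times> J. {Y (fst ij) (snd ij) - u..Y (fst ij) (snd ij) + u})"
    for Y :: "'n option \<Rightarrow> 'n \<Rightarrow> real" and u
  have Box_sets: "Box Y u \<in> sets M" for Y u
    unfolding Box_def M_def using finIJ by (intro sets_PiM_I_finite) auto
  have Box_vol: "emeasure M (Box Y u) = ennreal ((2 * u) ^ am)" if "u \<ge> 0" for Y u
  proof -
    have "emeasure M (Box Y u) = (\<Prod>ij\<in>I \<times> J. emeasure lborel {Y (fst ij) (snd ij) - u..Y (fst ij) (snd ij) + u})"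
      unfolding Box_def M_def using finIJ by (intro emeasure_PiM) auto
    also have "\<dots> = ennreal ((2 * u) ^ am)" using that by (simp add: cardIJ ennreal_power)
    finally show ?thesis .
  qed
  have mem_Box: "B \<in> Box Y u \<longleftrightarrow> (\<forall>i\<in>I. \<forall>j\<in>J. \<bar>B (i, j) - Y i j\<bar> \<le> u)" if "B \<in> space M" for B Y u
    using that unfolding Box_def M_def space_PiM by (auto simp: PiE_iff abs_le_iff) (smt (verit))+
  define G where "G B = (\<Sum>l. ennreal (r l powr t) * indicator (Box (ctr l) (r l)) B)" for B
  have intG: "(\<integral>\<^sup>+ B. G B \<partial>M) \<le> ennreal (2 ^ am * (\<kappa> / 2))"
  proof -
    have "(\<integral>\<^sup>+ B. G B \<partial>M) = (\<Sum>l. \<integral>\<^sup>+ B. ennreal (r l powr t) * indicator (Box (ctr l) (r l)) B \<partial>M)"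
      unfolding G_def using Box_sets by (intro nn_integral_suminf) auto
    \<comment> \<open>Integration over the \<open>am\<close> entries of \<open>B\<close> turns the
      exponent \<open>t\<close> into \<open>\<sigma> = am + t\<close>.\<close>
    also have "\<dots> = (\<Sum>l. ennreal (2 ^ am) * ennreal (r l powr \<sigma>))"
    proof (rule suminf_cong)
      fix l
      have "(\<integral>\<^sup>+ B. ennreal (r l powr t) * indicator (Box (ctr l) (r l)) B \<partial>M)
          = ennreal (r l powr t) * ennreal ((2 * r l) ^ am)"
        using Box_sets r0[of l] by (simp add: nn_integral_cmult_indicator Box_vol)
      also have "\<dots> = ennreal (r l powr t * (2 * r l) ^ am)"
        using r0[of l] by (intro ennreal_mult[symmetric]) auto
      also have "r l powr t * (2 * r l) ^ am = 2 ^ am * r l powr \<sigma>"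
        using r0[of l] by (simp add: \<sigma>_def powr_add powr_realpow power_mult_distrib)
      finally show "(\<integral>\<^sup>+ B. ennreal (r l powr t) * indicator (Box (ctr l) (r l)) B \<partial>M)
          = ennreal (2 ^ am) * ennreal (r l powr \<sigma>)"
        by (simp add: ennreal_mult)
    qed
    also have "\<dots> = ennreal (2 ^ am) * (\<Sum>l. ennreal (r l powr \<sigma>))" by simp
    also have "\<dots> \<le> ennreal (2 ^ am) * ennreal (\<kappa> / 2)" by (intro mult_left_mono sum_r) auto
    also have "\<dots> = ennreal (2 ^ am * (\<kappa> / 2))" using \<kappa>0 by (intro ennreal_mult[symmetric]) auto
    finally show ?thesis .
  qed
  have good_ge: "ennreal \<kappa> \<le> G B"
    if B: "B \<in> space M" "B \<in> Box (\<lambda>_ _. 0) 1" and good: "\<not> (\<exists>\<^sub>\<infinity>N. well_approx I J (\<lambda>i j. B (i, j)) \<mu> N)" for B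
  proof (rule ccontr)
    assume "\<not> ennreal \<kappa> \<le> G B"
    then have G_less: "G B < ennreal \<kappa>" by simp
    define \<Lambda> where "\<Lambda> = {l. B \<in> Box (ctr l) (r l)}"
    have thin: "(\<Sum>l\<in>F. r l powr t) \<le> 1 / (8 * 32 ^ card I)" if F: "finite F" "F \<subseteq> \<Lambda>" for F
    proof -
      have "ennreal (\<Sum>l\<in>F. r l powr t) = (\<Sum>l\<in>F. ennreal (r l powr t) * indicator (Box (ctr l) (r l)) B)"
      proof -
        have "ennreal (r l powr t) * indicator (Box (ctr l) (r l)) B = ennreal (r l powr t)" if "l \<in> F" for l
          using F(2) that by (auto simp: \<Lambda>_def)
        then show ?thesis by simp
      qed
      also have "\<dots> \<le> G B" unfolding G_def by (rule sum_le_suminf[OF _ F(1)]) auto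
      finally have "ennreal (\<Sum>l\<in>F. r l powr t) \<le> ennreal \<kappa>" using G_less by simp
      then show ?thesis using \<kappa>0 by (subst (asm) ennreal_le_iff) (auto simp: \<kappa>_def)
    qed
    obtain \<alpha> where \<alpha>: "\<forall>i\<in>I. \<bar>\<alpha> i\<bar> \<le> 1" "\<forall>l\<in>\<Lambda>. \<exists>i\<in>I. r l < \<bar>\<alpha> i - ctr l i j0\<bar>"
      "\<exists>\<^sub>\<infinity>N. well_approx I (insert j0 J) (\<lambda>i j. if j = j0 then \<alpha> i else B (i, j)) \<omega> N"
      using well_approx_column_avoiding_thin_family[OF I J(1,2) \<mu>(1,2) good \<omega>e t(1) less_imp_le[OF t(2)] \<omega>t r0 thin,
        where u = "\<lambda>l i. ctr l i j0"] by blast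
    define A where "A = (\<lambda>i j. if j = j0 then \<alpha> i else B (i, j))"
    have bddA: "bdd A"
      unfolding bdd_def
    proof (intro ballI)
      fix i j assume ij: "i \<in> I" "j \<in> - D"
      show "\<bar>A i j\<bar> \<le> 1"
      proof (cases "j = j0")
        case False
        then have "j \<in> J" using ij by (simp add: J_def)
        then show ?thesis using B(2) ij False unfolding mem_Box[OF B(1)] by (simp add: A_def)
      qed (use \<alpha>(1) ij in \<open>simp add: A_def\<close>)
    qed
    have "\<not> extremal (chart_subspace D A)"
      using \<alpha>(3) J(3) by (intro not_extremal_chart_subspace[OF \<omega>n']) (simp add: A_def I_def)
    then have "g A \<in> E"
      unfolding E_def g_def using chart_subspace_in_affine_subspaces[of D A] D by blast
    then obtain l where l: "g A \<in> U l" using U(1) by blast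
    then have "l \<in> \<Lambda>0" using bddA by (auto simp: \<Lambda>0_def)
    then have ctrl: "bdd (ctr l)" "g (ctr l) \<in> U l" using ctr by auto
    have close: "\<bar>A i j - ctr l i j\<bar> \<le> r l" if "i \<in> I" "j \<in> - D" for i j
    proof -
      have "\<bar>A i j - ctr l i j\<bar> \<le> c * dist (g A) (g (ctr l))" using lip[OF bddA ctrl(1) that] .
      also have "\<dots> \<le> c * diameter (U l)"
        using c0 diameter_bounded_bound[OF U(2) l ctrl(2)] by (intro mult_left_mono) auto
      also have "\<dots> \<le> r l" by (simp add: r_def)
      finally show ?thesis .
    qed
    have "\<bar>B (i, j) - ctr l i j\<bar> \<le> r l" if "i \<in> I" "j \<in> J" for i j
      using close[of i j] that J(2) by (auto simp: A_def J_def)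
    then have "l \<in> \<Lambda>" unfolding \<Lambda>_def mem_Collect_eq mem_Box[OF B(1)] by blast
    then obtain i where "i \<in> I" "r l < \<bar>\<alpha> i - ctr l i j0\<bar>" using \<alpha>(2) by blast
    then show False using close[of i j0] j0 by (simp add: A_def)
  qed
  \<comment> \<open>The box of radius \<open>1\<close> has volume \<open>2 ^ am\<close>, so the
    lower bound for the integral of \<open>G\<close> is twice the upper bound.\<close>
  have "ennreal (\<kappa> * 2 ^ am) = ennreal \<kappa> * emeasure M (Box (\<lambda>_ _. 0) 1)"
    using \<kappa>0 by (simp add: Box_vol ennreal_mult)
  also have "\<dots> = (\<integral>\<^sup>+ B. ennreal \<kappa> * indicator (Box (\<lambda>_ _. 0) 1) B \<partial>M)"
    using Box_sets by (simp add: nn_integral_cmult_indicator)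
  also have "\<dots> \<le> (\<integral>\<^sup>+ B. G B \<partial>M)"
  proof (rule nn_integral_mono_AE)
    show "AE B in M. ennreal \<kappa> * indicator (Box (\<lambda>_ _. 0) 1) B \<le> G B"
      using AE_not_well_approx[OF I(1) J(1) \<mu>(1,3), folded M_def] AE_space
    proof eventually_elim
      case (elim B)
      show ?case
      proof (cases "B \<in> Box (\<lambda>_ _. 0) 1")
        case True
        then have "\<forall>i\<in>I. \<forall>j\<in>J. \<bar>B (i, j)\<bar> \<le> 1" unfolding mem_Box[OF elim(2)] by simp
        then have "ennreal \<kappa> \<le> G B" using good_ge[OF elim(2) True] elim(1) by blast
        then show ?thesis using True by simp
      qed simp
    qed
  qed
  also have "\<dots> \<le> ennreal (2 ^ am * (\<kappa> / 2))" by (rule intG)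
  finally have "\<kappa> * 2 ^ am \<le> 2 ^ am * (\<kappa> / 2)" using \<kappa>0 by (subst (asm) ennreal_le_iff) auto
  then show False using \<kappa>0 by simp
qed

theorem corollary1p3:
  fixes d m :: nat
  assumes "d \<ge> 1" and "m \<ge> 1" and "CARD('n::finite) = d + m"
  shows "hausdorff_dim (grassmann_point ` {L \<in> affine_subspaces d. \<not> extremal (L :: (real ^ 'n) set)})
           = ereal ((real d + 1) * real m - real d)"
proof (rule hausdorff_dim_eqI)
  have "(real d + 1) * real m - real d = real d * (real m - 1) + real m"
    by (simp add: algebra_simps)
  moreover have "0 \<le> real d * (real m - 1)" using assms(2) by simp
  ultimately show "0 < (real d + 1) * real m - real d" using assms(2) by linarith
qed (use assms in \<open>auto dest: hausdorff_measure_non_extremal_0 hausdorff_measure_non_extremal_neq_0\<close>)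

end
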